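(* Let $\mathcal{C}$ be a pivotal fusion category and let $\mathcal{M}$ be an indecomposable $\mathcal{C}$-module category with $\mathcal{C}$-module trace $\Theta$. For any other $\mathcal{C}$-module trace $\widetilde{\Theta}$ on $\mathcal{M}$ there is a $z\in\mathbb{C}^{\times}$ such that $\widetilde{\Theta}=z\cdot\Theta$, i.e. $\widetilde{\Theta}_m=z\cdot\Theta_m$ for all $m\in\mathcal{M}$.
   Context: All categories are abelian and locally finite over $\mathbb{C}$. A fusion category is a semisimple rigid monoidal $\mathbb{C}$-linear category with tensor product bilinear on morphisms, simple unit $1$ and finitely many isomorphism classes of simple objects (treated as strict). The right dual of $c$ is $c^{*}$ with $\mathrm{ev}_c:c^{*}\otimes c\to1$, $\mathrm{coev}_c:1\to c\otimes c^{*}$; the left dual is ${}^{*}c$ with $\mathrm{ev}'_c:c\otimes{}^{*}c\to1$, $\mathrm{coev}'_c:1\to{}^{*}c\otimes c$; $({}^{*}c)^{*}\cong c\cong{}^{*}(c^{*})$ canonically, treated as identities. A pivotal structure is a monoidal natural isomorphism $a:\mathrm{id}\to(-)^{**}$. A (left) $\mathcal{C}$-module category is a semisimple $\mathbb{C}$-linear abelian category $\mathcal{M}$ with a bifunctor $\triangleright:\mathcal{C}\times\mathcal{M}\to\mathcal{M}$ and natural isomorphisms $(c\otimes d)\triangleright m\cong c\triangleright(d\triangleright m)$, $1\triangleright m\cong m$ satisfying the usual pentagon and triangle axioms (suppressed below). It is indecomposable if it is nonzero and not equivalent to a direct sum of two nonzero module categories. For $f\in\mathrm{End}_{\mathcal{M}}(c\triangleright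 m)$ put $\mathrm{tr}^{\mathcal{C}}(f)=(\mathrm{ev}_c\triangleright\mathrm{id}_m)\circ(a_{{}^{*}c}\triangleright f)\circ(\mathrm{coev}'_c\triangleright\mathrm{id}_m)\in\mathrm{End}_{\mathcal{M}}(m)$. A $\mathcal{C}$-module trace on $\mathcal{M}$ is a family of linear maps $\Theta_m:\mathrm{End}_{\mathcal{M}}(m)\to\mathbb{C}$ that is symmetric ($\Theta_m(g\circ f)=\Theta_n(f\circ g)$ for $f:m\to n$, $g:n\to m$), non-degenerate (the pairing $\mathrm{Hom}(m,n)\times\mathrm{Hom}(n,m)\to\mathbb{C}$, $(f,g)\mapsto\Theta_m(g\circ f)$ is non-degenerate for all $m,n$) and $\mathcal{C}$-compatible ($\Theta_{c\triangleright m}=\Theta_m\circ\mathrm{tr}^{\mathcal{C}}$). *)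

theory Defs
  imports Complex_Main "HOL-Algebra.Module"
begin

section \<open>Linear and abelian categories over the complex numbers\<close>

text \<open>
  Every arrow has a unique domain and codomain. \<open>Comp C g f\<close>, written \<open>g \<cdot>\<^bsub>C\<^esub> f\<close>,
  means: first \<open>f\<close>, then \<open>g\<close>. All operations are meaningful only on composable,
  respectively parallel, arrows.
\<close>

record ('o, 'a) lin_cat =
  Obj :: "'o set"
  Arr :: "'a set"
  Dom :: "'a \<Rightarrow> 'o"
  Cod :: "'a \<Rightarrow> 'o"
  Ident :: "'o \<Rightarrow> 'a"
  Comp :: "'a \<Rightarrow> 'a \<Rightarrow> 'a"  (infixr "\<cdot>\<index>" 65)
  Zero :: "'o \<Rightarrow> 'o \<Rightarrow> 'a"
  Add :: "'a \<Rightarrow> 'a \<Rightarrow> 'a"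
  Scale :: "complex \<Rightarrow> 'a \<Rightarrow> 'a"

definition Hom :: "('o, 'a, 'm) lin_cat_scheme \<Rightarrow> 'o \<Rightarrow> 'o \<Rightarrow> 'a set" where
  "Hom C x y = {f \<in> Arr C. Dom C f = x \<and> Cod C f = y}"

definition complex_ring :: "complex ring" where
  "complex_ring = \<lparr>carrier = UNIV, monoid.mult = (*), one = 1, zero = 0, add = (+)\<rparr>"

text \<open>The multiplicative fields are irrelevant for a \<open>module\<close> and left undefined.\<close>

definition hom_space ::
  "('o, 'a, 'm) lin_cat_scheme \<Rightarrow> 'o \<Rightarrow> 'o \<Rightarrow> (complex, 'a) module" where
  "hom_space C x y =
     \<lparr>carrier = Hom C x y, monoid.mult = undefined, one = undefined,
      zero = Zero C x y, add = Add C, smult = Scale C\<rparr>"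

locale linear_category =
  fixes C :: "('o, 'a, 'm) lin_cat_scheme" (structure)
  assumes Dom_Obj: "f \<in> Arr C \<Longrightarrow> Dom C f \<in> Obj C"
    and Cod_Obj: "f \<in> Arr C \<Longrightarrow> Cod C f \<in> Obj C"
    and Ident_Hom: "x \<in> Obj C \<Longrightarrow> Ident C x \<in> Hom C x x"
    and Comp_Hom: "\<lbrakk>f \<in> Hom C x y; g \<in> Hom C y z\<rbrakk> \<Longrightarrow> g \<cdot> f \<in> Hom C x z"
    and Comp_assoc:
      "\<lbrakk>f \<in> Hom C w x; g \<in> Hom C x y; h \<in> Hom C y z\<rbrakk> \<Longrightarrow> (h \<cdot> g) \<cdot> f = h \<cdot> (g \<cdot> f)"
    and Comp_Ident_left: "f \<in> Hom C x y \<Longrightarrow> Ident C y \<cdot> f = f"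
    and Comp_Ident_right: "f \<in> Hom C x y \<Longrightarrow> f \<cdot> Ident C x = f"
    and hom_space_module:
      "\<lbrakk>x \<in> Obj C; y \<in> Obj C\<rbrakk> \<Longrightarrow> module complex_ring (hom_space C x y)"
    and Comp_Add_left:
      "\<lbrakk>f \<in> Hom C x y; g \<in> Hom C y z; h \<in> Hom C y z\<rbrakk>
        \<Longrightarrow> Add C g h \<cdot> f = Add C (g \<cdot> f) (h \<cdot> f)"
    and Comp_Add_right:
      "\<lbrakk>f \<in> Hom C x y; g \<in> Hom C x y; h \<in> Hom C y z\<rbrakk>
        \<Longrightarrow> h \<cdot> Add C f g = Add C (h \<cdot> f) (h \<cdot> g)"
    and Comp_Scale_left:
      "\<lbrakk>f \<in> Hom C x y; g \<in> Hom C y z\<rbrakk> \<Longrightarrow> Scale C k g \<cdot> f = Scale C k (g \<cdot> f)"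
    and Comp_Scale_right:
      "\<lbrakk>f \<in> Hom C x y; g \<in> Hom C y z\<rbrakk> \<Longrightarrow> g \<cdot> Scale C k f = Scale C k (g \<cdot> f)"

definition is_inverse :: "('o, 'a, 'm) lin_cat_scheme \<Rightarrow> 'a \<Rightarrow> 'a \<Rightarrow> bool" where
  "is_inverse C f g \<longleftrightarrow>
     f \<in> Arr C \<and> g \<in> Hom C (Cod C f) (Dom C f) \<and>
     g \<cdot>\<^bsub>C\<^esub> f = Ident C (Dom C f) \<and> f \<cdot>\<^bsub>C\<^esub> g = Ident C (Cod C f)"

definition is_iso :: "('o, 'a, 'm) lin_cat_scheme \<Rightarrow> 'a \<Rightarrow> bool" where
  "is_iso C f \<longleftrightarrow> (\<exists>g. is_inverse C f g)"

definition inv_arr :: "('o, 'a, 'm) lin_cat_scheme \<Rightarrow> 'a \<Rightarrow> 'a" where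
  "inv_arr C f = (THE g. is_inverse C f g)"

definition isomorphic :: "('o, 'a, 'm) lin_cat_scheme \<Rightarrow> 'o \<Rightarrow> 'o \<Rightarrow> bool" where
  "isomorphic C x y \<longleftrightarrow> (\<exists>f \<in> Hom C x y. is_iso C f)"

definition zero_object :: "('o, 'a, 'm) lin_cat_scheme \<Rightarrow> 'o \<Rightarrow> bool" where
  "zero_object C z \<longleftrightarrow>
     z \<in> Obj C \<and> (\<forall>x \<in> Obj C. (\<exists>!f. f \<in> Hom C x z) \<and> (\<exists>!f. f \<in> Hom C z x))"

definition monic :: "('o, 'a, 'm) lin_cat_scheme \<Rightarrow> 'a \<Rightarrow> bool" where
  "monic C f \<longleftrightarrow>
     f \<in> Arr C \<and>
     (\<forall>w. \<forall>g \<in> Hom C w (Dom C f). \<forall>h \<in> Hom C w (Dom C f).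
        f \<cdot>\<^bsub>C\<^esub> g = f \<cdot>\<^bsub>C\<^esub> h \<longrightarrow> g = h)"

definition epic :: "('o, 'a, 'm) lin_cat_scheme \<Rightarrow> 'a \<Rightarrow> bool" where
  "epic C f \<longleftrightarrow>
     f \<in> Arr C \<and>
     (\<forall>w. \<forall>g \<in> Hom C (Cod C f) w. \<forall>h \<in> Hom C (Cod C f) w.
        g \<cdot>\<^bsub>C\<^esub> f = h \<cdot>\<^bsub>C\<^esub> f \<longrightarrow> g = h)"

definition is_kernel :: "('o, 'a, 'm) lin_cat_scheme \<Rightarrow> 'a \<Rightarrow> 'a \<Rightarrow> bool" where
  "is_kernel C k f \<longleftrightarrow>
     k \<in> Arr C \<and> f \<in> Arr C \<and> Cod C k = Dom C f \<and>
     f \<cdot>\<^bsub>C\<^esub> k = Zero C (Dom C k) (Cod C f) \<and>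
     (\<forall>w. \<forall>g \<in> Hom C w (Dom C f). f \<cdot>\<^bsub>C\<^esub> g = Zero C w (Cod C f) \<longrightarrow>
        (\<exists>!u. u \<in> Hom C w (Dom C k) \<and> k \<cdot>\<^bsub>C\<^esub> u = g))"

definition is_cokernel :: "('o, 'a, 'm) lin_cat_scheme \<Rightarrow> 'a \<Rightarrow> 'a \<Rightarrow> bool" where
  "is_cokernel C q f \<longleftrightarrow>
     q \<in> Arr C \<and> f \<in> Arr C \<and> Dom C q = Cod C f \<and>
     q \<cdot>\<^bsub>C\<^esub> f = Zero C (Dom C f) (Cod C q) \<and>
     (\<forall>w. \<forall>g \<in> Hom C (Cod C f) w. g \<cdot>\<^bsub>C\<^esub> f = Zero C (Dom C f) w \<longrightarrow>
        (\<exists>!u. u \<in> Hom C (Cod C q) w \<and> u \<cdot>\<^bsub>C\<^esub> q = g))"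

definition is_direct_sum ::
  "('o, 'a, 'm) lin_cat_scheme \<Rightarrow> nat \<Rightarrow> (nat \<Rightarrow> 'o) \<Rightarrow> 'o \<Rightarrow> (nat \<Rightarrow> 'a) \<Rightarrow> (nat \<Rightarrow> 'a) \<Rightarrow> bool" where
  "is_direct_sum C n X s inc pr \<longleftrightarrow>
     s \<in> Obj C \<and>
     (\<forall>i<n. X i \<in> Obj C \<and> inc i \<in> Hom C (X i) s \<and> pr i \<in> Hom C s (X i)) \<and>
     (\<forall>i<n. \<forall>j<n. pr i \<cdot>\<^bsub>C\<^esub> inc j = (if i = j then Ident C (X i) else Zero C (X j) (X i))) \<and>
     finsum (hom_space C s s) (\<lambda>i. inc i \<cdot>\<^bsub>C\<^esub> pr i) {..<n} = Ident C s"

text \<open>The empty direct sum (\<open>n = 0\<close>) provides a zero object.\<close>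

locale abelian_category = linear_category +
  assumes direct_sums:
      "(\<And>i. i < n \<Longrightarrow> X i \<in> Obj C) \<Longrightarrow> \<exists>s inc pr. is_direct_sum C n X s inc pr"
    and kernels: "f \<in> Arr C \<Longrightarrow> \<exists>k. is_kernel C k f"
    and cokernels: "f \<in> Arr C \<Longrightarrow> \<exists>q. is_cokernel C q f"
    and monic_normal: "monic C f \<Longrightarrow> \<exists>g. is_kernel C f g"
    and epic_normal: "epic C f \<Longrightarrow> \<exists>g. is_cokernel C f g"

definition simple :: "('o, 'a, 'm) lin_cat_scheme \<Rightarrow> 'o \<Rightarrow> bool" where
  "simple C x \<longleftrightarrow>
     x \<in> Obj C \<and> \<not> zero_object C x \<and>
     (\<forall>f. monic C f \<and> Cod C f = x \<longrightarrow> zero_object C (Dom C f) \<or> is_iso C f)"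

inductive finite_length :: "('o, 'a, 'm) lin_cat_scheme \<Rightarrow> 'o \<Rightarrow> bool"
  for C :: "('o, 'a, 'm) lin_cat_scheme" where
  zero: "zero_object C x \<Longrightarrow> finite_length C x"
| extension:
    "\<lbrakk>finite_length C x; simple C s; k \<in> Hom C x y; q \<in> Hom C y s;
      is_kernel C k q; is_cokernel C q k\<rbrakk> \<Longrightarrow> finite_length C y"

locale locally_finite_abelian_category = abelian_category +
  assumes finite_dim_Hom:
      "\<lbrakk>x \<in> Obj C; y \<in> Obj C\<rbrakk> \<Longrightarrow>
        \<exists>B. finite B \<and> B \<subseteq> Hom C x y \<and>
          (\<forall>f \<in> Hom C x y. \<exists>c. f = finsum (hom_space C x y) (\<lambda>b. Scale C (c b) b) B)"
    and finite_length: "x \<in> Obj C \<Longrightarrow> finite_length C x"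

locale semisimple_category = locally_finite_abelian_category +
  assumes semisimple:
    "x \<in> Obj C \<Longrightarrow> \<exists>n X inc pr. (\<forall>i<n. simple C (X i)) \<and> is_direct_sum C n X x inc pr"


section \<open>Monoidal categories, duals and pivotal structures\<close>

text \<open>
  \<open>Assoc x y z\<close> goes from \<open>(x \<otimes> y) \<otimes> z\<close> to \<open>x \<otimes> (y \<otimes> z)\<close>, \<open>Lun x\<close> from \<open>1 \<otimes> x\<close>
  to \<open>x\<close> and \<open>Run x\<close> from \<open>x \<otimes> 1\<close> to \<open>x\<close>. The monoidal structure is not required to be
  strict; strict categories are the special case where these arrows are identities.
  The subscripts \<open>o\<close> and \<open>a\<close> distinguish objects from arrows.
\<close>

record ('o, 'a) mon_cat = "('o, 'a) lin_cat" +
  Tens :: "'o \<Rightarrow> 'o \<Rightarrow> 'o"  (infixr "\<otimes>\<^sub>o\<index>" 75)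
  TensA :: "'a \<Rightarrow> 'a \<Rightarrow> 'a"  (infixr "\<otimes>\<^sub>a\<index>" 75)
  Unit :: "'o"
  Assoc :: "'o \<Rightarrow> 'o \<Rightarrow> 'o \<Rightarrow> 'a"
  Lun :: "'o \<Rightarrow> 'a"
  Run :: "'o \<Rightarrow> 'a"

locale monoidal_linear_category = linear_category C
  for C :: "('o, 'a, 'm) mon_cat_scheme" (structure) +
  assumes Unit_Obj: "Unit C \<in> Obj C"
    and Tens_Obj: "\<lbrakk>x \<in> Obj C; y \<in> Obj C\<rbrakk> \<Longrightarrow> x \<otimes>\<^sub>o y \<in> Obj C"
    and TensA_Hom:
      "\<lbrakk>f \<in> Hom C x x'; g \<in> Hom C y y'\<rbrakk> \<Longrightarrow> f \<otimes>\<^sub>a g \<in> Hom C (x \<otimes>\<^sub>o y) (x' \<otimes>\<^sub>o y')"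
    and TensA_Ident:
      "\<lbrakk>x \<in> Obj C; y \<in> Obj C\<rbrakk> \<Longrightarrow> Ident C x \<otimes>\<^sub>a Ident C y = Ident C (x \<otimes>\<^sub>o y)"
    and TensA_Comp:
      "\<lbrakk>f \<in> Hom C x x'; f' \<in> Hom C x' x''; g \<in> Hom C y y'; g' \<in> Hom C y' y''\<rbrakk>
        \<Longrightarrow> (f' \<cdot> f) \<otimes>\<^sub>a (g' \<cdot> g) = (f' \<otimes>\<^sub>a g') \<cdot> (f \<otimes>\<^sub>a g)"
    and TensA_Add_left:
      "\<lbrakk>f \<in> Hom C x x'; f' \<in> Hom C x x'; g \<in> Hom C y y'\<rbrakk>
        \<Longrightarrow> Add C f f' \<otimes>\<^sub>a g = Add C (f \<otimes>\<^sub>a g) (f' \<otimes>\<^sub>a g)"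
    and TensA_Add_right:
      "\<lbrakk>f \<in> Hom C x x'; g \<in> Hom C y y'; g' \<in> Hom C y y'\<rbrakk>
        \<Longrightarrow> f \<otimes>\<^sub>a Add C g g' = Add C (f \<otimes>\<^sub>a g) (f \<otimes>\<^sub>a g')"
    and TensA_Scale_left:
      "\<lbrakk>f \<in> Hom C x x'; g \<in> Hom C y y'\<rbrakk> \<Longrightarrow> Scale C k f \<otimes>\<^sub>a g = Scale C k (f \<otimes>\<^sub>a g)"
    and TensA_Scale_right:
      "\<lbrakk>f \<in> Hom C x x'; g \<in> Hom C y y'\<rbrakk> \<Longrightarrow> f \<otimes>\<^sub>a Scale C k g = Scale C k (f \<otimes>\<^sub>a g)"
    and Assoc_Hom:
      "\<lbrakk>x \<in> Obj C; y \<in> Obj C; z \<in> Obj C\<rbrakk>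
        \<Longrightarrow> Assoc C x y z \<in> Hom C ((x \<otimes>\<^sub>o y) \<otimes>\<^sub>o z) (x \<otimes>\<^sub>o (y \<otimes>\<^sub>o z))"
    and Assoc_iso:
      "\<lbrakk>x \<in> Obj C; y \<in> Obj C; z \<in> Obj C\<rbrakk> \<Longrightarrow> is_iso C (Assoc C x y z)"
    and Assoc_natural:
      "\<lbrakk>f \<in> Hom C x x'; g \<in> Hom C y y'; h \<in> Hom C z z'\<rbrakk>
        \<Longrightarrow> Assoc C x' y' z' \<cdot> ((f \<otimes>\<^sub>a g) \<otimes>\<^sub>a h) = (f \<otimes>\<^sub>a (g \<otimes>\<^sub>a h)) \<cdot> Assoc C x y z"
    and Lun_Hom: "x \<in> Obj C \<Longrightarrow> Lun C x \<in> Hom C (Unit C \<otimes>\<^sub>o x) x"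
    and Lun_iso: "x \<in> Obj C \<Longrightarrow> is_iso C (Lun C x)"
    and Lun_natural:
      "f \<in> Hom C x y \<Longrightarrow> Lun C y \<cdot> (Ident C (Unit C) \<otimes>\<^sub>a f) = f \<cdot> Lun C x"
    and Run_Hom: "x \<in> Obj C \<Longrightarrow> Run C x \<in> Hom C (x \<otimes>\<^sub>o Unit C) x"
    and Run_iso: "x \<in> Obj C \<Longrightarrow> is_iso C (Run C x)"
    and Run_natural:
      "f \<in> Hom C x y \<Longrightarrow> Run C y \<cdot> (f \<otimes>\<^sub>a Ident C (Unit C)) = f \<cdot> Run C x"
    and pentagon:
      "\<lbrakk>w \<in> Obj C; x \<in> Obj C; y \<in> Obj C; z \<in> Obj C\<rbrakk>
        \<Longrightarrow> Assoc C w x (y \<otimes>\<^sub>o z) \<cdot> Assoc C (w \<otimes>\<^sub>o x) y z =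
            (Ident C w \<otimes>\<^sub>a Assoc C x y z) \<cdot> Assoc C w (x \<otimes>\<^sub>o y) z
              \<cdot> (Assoc C w x y \<otimes>\<^sub>a Ident C z)"
    and triangle:
      "\<lbrakk>x \<in> Obj C; y \<in> Obj C\<rbrakk>
        \<Longrightarrow> (Ident C x \<otimes>\<^sub>a Lun C y) \<cdot> Assoc C x (Unit C) y = Run C x \<otimes>\<^sub>a Ident C y"

text \<open>
  \<open>y\<close> is a right dual of \<open>x\<close> via \<open>ev : y \<otimes> x \<rightarrow> 1\<close> and \<open>coev : 1 \<rightarrow> x \<otimes> y\<close>;
  equivalently, \<open>x\<close> is a left dual of \<open>y\<close> via the same arrows.
\<close>

definition is_right_dual ::
  "('o, 'a, 'm) mon_cat_scheme \<Rightarrow> 'o \<Rightarrow> 'o \<Rightarrow> 'a \<Rightarrow> 'a \<Rightarrow> bool" where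
  "is_right_dual C x y ev coev \<longleftrightarrow>
     x \<in> Obj C \<and> y \<in> Obj C \<and>
     ev \<in> Hom C (y \<otimes>\<^sub>o\<^bsub>C\<^esub> x) (Unit C) \<and> coev \<in> Hom C (Unit C) (x \<otimes>\<^sub>o\<^bsub>C\<^esub> y) \<and>
     Run C x \<cdot>\<^bsub>C\<^esub> (Ident C x \<otimes>\<^sub>a\<^bsub>C\<^esub> ev) \<cdot>\<^bsub>C\<^esub> Assoc C x y x
       \<cdot>\<^bsub>C\<^esub> (coev \<otimes>\<^sub>a\<^bsub>C\<^esub> Ident C x) \<cdot>\<^bsub>C\<^esub> inv_arr C (Lun C x) = Ident C x \<and>
     Lun C y \<cdot>\<^bsub>C\<^esub> (ev \<otimes>\<^sub>a\<^bsub>C\<^esub> Ident C y) \<cdot>\<^bsub>C\<^esub> inv_arr C (Assoc C y x y)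
       \<cdot>\<^bsub>C\<^esub> (Ident C y \<otimes>\<^sub>a\<^bsub>C\<^esub> coev) \<cdot>\<^bsub>C\<^esub> inv_arr C (Run C y) = Ident C y"

text \<open>
  Rigidity comes with chosen duals: \<open>RDual c\<close> is the right dual with
  \<open>Ev c : RDual c \<otimes> c \<rightarrow> 1\<close> and \<open>Coev c : 1 \<rightarrow> c \<otimes> RDual c\<close>; \<open>LDual c\<close> is the left dual
  with \<open>LEv c : c \<otimes> LDual c \<rightarrow> 1\<close> and \<open>LCoev c : 1 \<rightarrow> LDual c \<otimes> c\<close>.
\<close>

record ('o, 'a) rigid_cat = "('o, 'a) mon_cat" +
  RDual :: "'o \<Rightarrow> 'o"
  Ev :: "'o \<Rightarrow> 'a"
  Coev :: "'o \<Rightarrow> 'a"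
  LDual :: "'o \<Rightarrow> 'o"
  LEv :: "'o \<Rightarrow> 'a"
  LCoev :: "'o \<Rightarrow> 'a"

locale fusion_category =
  monoidal_linear_category C + semisimple_category C
  for C :: "('o, 'a, 'm) rigid_cat_scheme" (structure) +
  assumes right_dual: "c \<in> Obj C \<Longrightarrow> is_right_dual C c (RDual C c) (Ev C c) (Coev C c)"
    and left_dual: "c \<in> Obj C \<Longrightarrow> is_right_dual C (LDual C c) c (LEv C c) (LCoev C c)"
    and Unit_simple: "simple C (Unit C)"
    and finitely_many_simples:
      "finite ({x. simple C x} // {(x, y). simple C x \<and> simple C y \<and> isomorphic C x y})"

text \<open>
  Given \<open>f : x \<rightarrow> y\<close>, a right dual \<open>y'\<close> of \<open>y\<close> with evaluation \<open>ev\<close> and a right dual \<open>x'\<close>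
  of \<open>x\<close> with coevaluation \<open>coev\<close>, this is the transpose \<open>y' \<rightarrow> x'\<close> of \<open>f\<close>. For \<open>f\<close> an
  identity it is the canonical comparison between two right duals of the same object.
\<close>

definition transpose_arr ::
  "('o, 'a, 'm) mon_cat_scheme \<Rightarrow> 'o \<Rightarrow> 'a \<Rightarrow> 'o \<Rightarrow> 'a \<Rightarrow> 'a \<Rightarrow> 'a" where
  "transpose_arr C y' ev x' coev f =
     Lun C x' \<cdot>\<^bsub>C\<^esub> (ev \<otimes>\<^sub>a\<^bsub>C\<^esub> Ident C x') \<cdot>\<^bsub>C\<^esub> inv_arr C (Assoc C y' (Cod C f) x')
       \<cdot>\<^bsub>C\<^esub> (Ident C y' \<otimes>\<^sub>a\<^bsub>C\<^esub> ((f \<otimes>\<^sub>a\<^bsub>C\<^esub> Ident C x') \<cdot>\<^bsub>C\<^esub> coev)) \<cdot>\<^bsub>C\<^esub> inv_arr C (Run C y')"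

definition dual_arr :: "('o, 'a, 'm) rigid_cat_scheme \<Rightarrow> 'a \<Rightarrow> 'a" where
  "dual_arr C f =
     transpose_arr C (RDual C (Cod C f)) (Ev C (Cod C f)) (RDual C (Dom C f)) (Coev C (Dom C f)) f"

text \<open>
  The canonical isomorphism \<open>c \<rightarrow> RDual (LDual c)\<close>, both objects being right duals of
  \<open>LDual c\<close>.
\<close>

definition left_right_dual :: "('o, 'a, 'm) rigid_cat_scheme \<Rightarrow> 'o \<Rightarrow> 'a" where
  "left_right_dual C c =
     transpose_arr C c (LEv C c) (RDual C (LDual C c)) (Coev C (LDual C c)) (Ident C (LDual C c))"

text \<open>
  Evaluation \<open>(d* \<otimes> c*) \<otimes> (c \<otimes> d) \<rightarrow> 1\<close> and coevaluation \<open>1 \<rightarrow> (c \<otimes> d) \<otimes> (d* \<otimes> c*)\<close>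
  exhibiting \<open>d* \<otimes> c*\<close> as a right dual of \<open>c \<otimes> d\<close>, where \<open>*\<close> stands for \<open>RDual\<close>.
\<close>

definition tens_ev :: "('o, 'a, 'm) rigid_cat_scheme \<Rightarrow> 'o \<Rightarrow> 'o \<Rightarrow> 'a" where
  "tens_ev C c d =
     (let c' = RDual C c; d' = RDual C d in
      Ev C d \<cdot>\<^bsub>C\<^esub> (Ident C d' \<otimes>\<^sub>a\<^bsub>C\<^esub> Lun C d) \<cdot>\<^bsub>C\<^esub> (Ident C d' \<otimes>\<^sub>a\<^bsub>C\<^esub> (Ev C c \<otimes>\<^sub>a\<^bsub>C\<^esub> Ident C d))
        \<cdot>\<^bsub>C\<^esub> (Ident C d' \<otimes>\<^sub>a\<^bsub>C\<^esub> inv_arr C (Assoc C c' c d)) \<cdot>\<^bsub>C\<^esub> Assoc C d' c' (c \<otimes>\<^sub>o\<^bsub>C\<^esub> d))"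

definition tens_coev :: "('o, 'a, 'm) rigid_cat_scheme \<Rightarrow> 'o \<Rightarrow> 'o \<Rightarrow> 'a" where
  "tens_coev C c d =
     (let c' = RDual C c; d' = RDual C d in
      inv_arr C (Assoc C c d (d' \<otimes>\<^sub>o\<^bsub>C\<^esub> c')) \<cdot>\<^bsub>C\<^esub> (Ident C c \<otimes>\<^sub>a\<^bsub>C\<^esub> Assoc C d d' c')
        \<cdot>\<^bsub>C\<^esub> (Ident C c \<otimes>\<^sub>a\<^bsub>C\<^esub> (Coev C d \<otimes>\<^sub>a\<^bsub>C\<^esub> Ident C c'))
        \<cdot>\<^bsub>C\<^esub> (Ident C c \<otimes>\<^sub>a\<^bsub>C\<^esub> inv_arr C (Lun C c')) \<cdot>\<^bsub>C\<^esub> Coev C c)"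

text \<open>
  The monoidal structure \<open>c** \<otimes> d** \<rightarrow> (c \<otimes> d)**\<close> and \<open>1 \<rightarrow> 1**\<close> of the double dual functor:
  the transposes of the canonical isomorphisms \<open>(c \<otimes> d)* \<rightarrow> d* \<otimes> c*\<close> and \<open>1* \<rightarrow> 1\<close>.
\<close>

definition double_dual_tens :: "('o, 'a, 'm) rigid_cat_scheme \<Rightarrow> 'o \<Rightarrow> 'o \<Rightarrow> 'a" where
  "double_dual_tens C c d =
     (let c' = RDual C c; d' = RDual C d; cd' = RDual C (c \<otimes>\<^sub>o\<^bsub>C\<^esub> d);
          comparison = transpose_arr C cd' (Ev C (c \<otimes>\<^sub>o\<^bsub>C\<^esub> d)) (d' \<otimes>\<^sub>o\<^bsub>C\<^esub> c') (tens_coev C c d)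
            (Ident C (c \<otimes>\<^sub>o\<^bsub>C\<^esub> d))
      in transpose_arr C (RDual C c' \<otimes>\<^sub>o\<^bsub>C\<^esub> RDual C d') (tens_ev C d' c')
           (RDual C cd') (Coev C cd') comparison)"

definition double_dual_unit :: "('o, 'a, 'm) rigid_cat_scheme \<Rightarrow> 'a" where
  "double_dual_unit C =
     (let u = Unit C; u' = RDual C u;
          comparison = transpose_arr C u' (Ev C u) u (inv_arr C (Lun C u)) (Ident C u)
      in transpose_arr C u (Lun C u) (RDual C u') (Coev C u') comparison)"

record ('o, 'a) pivotal_cat = "('o, 'a) rigid_cat" +
  Piv :: "'o \<Rightarrow> 'a"

locale pivotal_fusion_category = fusion_category C
  for C :: "('o, 'a, 'm) pivotal_cat_scheme" (structure) +
  assumes Piv_Hom: "c \<in> Obj C \<Longrightarrow> Piv C c \<in> Hom C c (RDual C (RDual C c))"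
    and Piv_iso: "c \<in> Obj C \<Longrightarrow> is_iso C (Piv C c)"
    and Piv_natural:
      "f \<in> Hom C c d \<Longrightarrow> Piv C d \<cdot> f = dual_arr C (dual_arr C f) \<cdot> Piv C c"
    and Piv_Tens:
      "\<lbrakk>c \<in> Obj C; d \<in> Obj C\<rbrakk>
        \<Longrightarrow> Piv C (c \<otimes>\<^sub>o d) = double_dual_tens C c d \<cdot> (Piv C c \<otimes>\<^sub>a Piv C d)"
    and Piv_Unit: "Piv C (Unit C) = double_dual_unit C"


section \<open>Module categories\<close>

text \<open>
  \<open>MAssoc c d m\<close> goes from \<open>(c \<otimes> d) \<triangleright> m\<close> to \<open>c \<triangleright> (d \<triangleright> m)\<close> and \<open>MUn m\<close> from \<open>1 \<triangleright> m\<close>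
  to \<open>m\<close>. The type variables \<open>'c\<close> and \<open>'f\<close> are those of the objects and arrows of the
  acting category.
\<close>

record ('c, 'f, 'o, 'a) mod_cat = "('o, 'a) lin_cat" +
  Act :: "'c \<Rightarrow> 'o \<Rightarrow> 'o"  (infixr "\<triangleright>\<^sub>o\<index>" 75)
  ActA :: "'f \<Rightarrow> 'a \<Rightarrow> 'a"  (infixr "\<triangleright>\<^sub>a\<index>" 75)
  MAssoc :: "'c \<Rightarrow> 'c \<Rightarrow> 'o \<Rightarrow> 'a"
  MUn :: "'o \<Rightarrow> 'a"

text \<open>As usual for linear categories, the action bifunctor is bilinear on morphisms.\<close>

locale module_category =
  C: monoidal_linear_category C + M: semisimple_category M
  for C :: "('c, 'f, 'p) mon_cat_scheme"
    and M :: "('c, 'f, 'o, 'a, 'q) mod_cat_scheme" (structure) +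
  assumes Act_Obj: "\<lbrakk>c \<in> Obj C; m \<in> Obj M\<rbrakk> \<Longrightarrow> c \<triangleright>\<^sub>o m \<in> Obj M"
    and ActA_Hom:
      "\<lbrakk>f \<in> Hom C c d; g \<in> Hom M m n\<rbrakk> \<Longrightarrow> f \<triangleright>\<^sub>a g \<in> Hom M (c \<triangleright>\<^sub>o m) (d \<triangleright>\<^sub>o n)"
    and ActA_Ident:
      "\<lbrakk>c \<in> Obj C; m \<in> Obj M\<rbrakk> \<Longrightarrow> Ident C c \<triangleright>\<^sub>a Ident M m = Ident M (c \<triangleright>\<^sub>o m)"
    and ActA_Comp:
      "\<lbrakk>f \<in> Hom C c c'; f' \<in> Hom C c' c''; g \<in> Hom M m m'; g' \<in> Hom M m' m''\<rbrakk>
        \<Longrightarrow> (f' \<cdot>\<^bsub>C\<^esub> f) \<triangleright>\<^sub>a (g' \<cdot> g) = (f' \<triangleright>\<^sub>a g') \<cdot> (f \<triangleright>\<^sub>a g)"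
    and ActA_Add_left:
      "\<lbrakk>f \<in> Hom C c d; f' \<in> Hom C c d; g \<in> Hom M m n\<rbrakk>
        \<Longrightarrow> Add C f f' \<triangleright>\<^sub>a g = Add M (f \<triangleright>\<^sub>a g) (f' \<triangleright>\<^sub>a g)"
    and ActA_Add_right:
      "\<lbrakk>f \<in> Hom C c d; g \<in> Hom M m n; g' \<in> Hom M m n\<rbrakk>
        \<Longrightarrow> f \<triangleright>\<^sub>a Add M g g' = Add M (f \<triangleright>\<^sub>a g) (f \<triangleright>\<^sub>a g')"
    and ActA_Scale_left:
      "\<lbrakk>f \<in> Hom C c d; g \<in> Hom M m n\<rbrakk> \<Longrightarrow> Scale C k f \<triangleright>\<^sub>a g = Scale M k (f \<triangleright>\<^sub>a g)"
    and ActA_Scale_right: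
      "\<lbrakk>f \<in> Hom C c d; g \<in> Hom M m n\<rbrakk> \<Longrightarrow> f \<triangleright>\<^sub>a Scale M k g = Scale M k (f \<triangleright>\<^sub>a g)"
    and MAssoc_Hom:
      "\<lbrakk>c \<in> Obj C; d \<in> Obj C; m \<in> Obj M\<rbrakk>
        \<Longrightarrow> MAssoc M c d m \<in> Hom M ((c \<otimes>\<^sub>o\<^bsub>C\<^esub> d) \<triangleright>\<^sub>o m) (c \<triangleright>\<^sub>o (d \<triangleright>\<^sub>o m))"
    and MAssoc_iso:
      "\<lbrakk>c \<in> Obj C; d \<in> Obj C; m \<in> Obj M\<rbrakk> \<Longrightarrow> is_iso M (MAssoc M c d m)"
    and MAssoc_natural:
      "\<lbrakk>f \<in> Hom C c c'; f' \<in> Hom C d d'; g \<in> Hom M m m'\<rbrakk>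
        \<Longrightarrow> MAssoc M c' d' m' \<cdot> ((f \<otimes>\<^sub>a\<^bsub>C\<^esub> f') \<triangleright>\<^sub>a g) = (f \<triangleright>\<^sub>a (f' \<triangleright>\<^sub>a g)) \<cdot> MAssoc M c d m"
    and MUn_Hom: "m \<in> Obj M \<Longrightarrow> MUn M m \<in> Hom M (Unit C \<triangleright>\<^sub>o m) m"
    and MUn_iso: "m \<in> Obj M \<Longrightarrow> is_iso M (MUn M m)"
    and MUn_natural:
      "g \<in> Hom M m n \<Longrightarrow> MUn M n \<cdot> (Ident C (Unit C) \<triangleright>\<^sub>a g) = g \<cdot> MUn M m"
    and module_pentagon:
      "\<lbrakk>b \<in> Obj C; c \<in> Obj C; d \<in> Obj C; m \<in> Obj M\<rbrakk>
        \<Longrightarrow> MAssoc M b c (d \<triangleright>\<^sub>o m) \<cdot> MAssoc M (b \<otimes>\<^sub>o\<^bsub>C\<^esub> c) d m =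
            (Ident C b \<triangleright>\<^sub>a MAssoc M c d m) \<cdot> MAssoc M b (c \<otimes>\<^sub>o\<^bsub>C\<^esub> d) m
              \<cdot> (Assoc C b c d \<triangleright>\<^sub>a Ident M m)"
    and module_triangle:
      "\<lbrakk>c \<in> Obj C; m \<in> Obj M\<rbrakk>
        \<Longrightarrow> (Ident C c \<triangleright>\<^sub>a MUn M m) \<cdot> MAssoc M c (Unit C) m = Run C c \<triangleright>\<^sub>a Ident M m"

definition is_linear_functor ::
  "('o, 'a, 'm) lin_cat_scheme \<Rightarrow> ('p, 'b, 'n) lin_cat_scheme \<Rightarrow> ('o \<Rightarrow> 'p) \<Rightarrow> ('a \<Rightarrow> 'b) \<Rightarrow> bool" where
  "is_linear_functor A B Fo Fa \<longleftrightarrow>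
     (\<forall>x \<in> Obj A. Fo x \<in> Obj B \<and> Fa (Ident A x) = Ident B (Fo x)) \<and>
     (\<forall>x y. \<forall>f \<in> Hom A x y. Fa f \<in> Hom B (Fo x) (Fo y)) \<and>
     (\<forall>x y z. \<forall>f \<in> Hom A x y. \<forall>g \<in> Hom A y z. Fa (g \<cdot>\<^bsub>A\<^esub> f) = Fa g \<cdot>\<^bsub>B\<^esub> Fa f) \<and>
     (\<forall>x y. \<forall>f \<in> Hom A x y. \<forall>g \<in> Hom A x y. Fa (Add A f g) = Add B (Fa f) (Fa g)) \<and>
     (\<forall>k. \<forall>f \<in> Arr A. Fa (Scale A k f) = Scale B k (Fa f))"

definition is_natural_iso ::
  "('o, 'a, 'm) lin_cat_scheme \<Rightarrow> ('p, 'b, 'n) lin_cat_scheme \<Rightarrow> ('o \<Rightarrow> 'p) \<Rightarrow> ('a \<Rightarrow> 'b)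
    \<Rightarrow> ('o \<Rightarrow> 'p) \<Rightarrow> ('a \<Rightarrow> 'b) \<Rightarrow> ('o \<Rightarrow> 'b) \<Rightarrow> bool" where
  "is_natural_iso A B Fo Fa Go Ga t \<longleftrightarrow>
     (\<forall>x \<in> Obj A. t x \<in> Hom B (Fo x) (Go x) \<and> is_iso B (t x)) \<and>
     (\<forall>x y. \<forall>f \<in> Hom A x y. t y \<cdot>\<^bsub>B\<^esub> Fa f = Ga f \<cdot>\<^bsub>B\<^esub> t x)"

definition is_equivalence ::
  "('o, 'a, 'm) lin_cat_scheme \<Rightarrow> ('p, 'b, 'n) lin_cat_scheme \<Rightarrow> ('o \<Rightarrow> 'p) \<Rightarrow> ('a \<Rightarrow> 'b) \<Rightarrow> bool" where
  "is_equivalence A B Fo Fa \<longleftrightarrow>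
     is_linear_functor A B Fo Fa \<and>
     (\<exists>Go Ga t u. is_linear_functor B A Go Ga \<and>
        is_natural_iso A A id id (Go \<circ> Fo) (Ga \<circ> Fa) t \<and>
        is_natural_iso B B (Fo \<circ> Go) (Fa \<circ> Ga) id id u)"

text \<open>\<open>s c m : F (c \<triangleright> m) \<rightarrow> c \<triangleright> F m\<close> is the module structure of the functor \<open>F\<close>.\<close>

definition is_module_functor ::
  "('c, 'f, 'r) mon_cat_scheme \<Rightarrow> ('c, 'f, 'o, 'a, 'm) mod_cat_scheme
    \<Rightarrow> ('c, 'f, 'p, 'b, 'n) mod_cat_scheme
    \<Rightarrow> ('o \<Rightarrow> 'p) \<Rightarrow> ('a \<Rightarrow> 'b) \<Rightarrow> ('c \<Rightarrow> 'o \<Rightarrow> 'b) \<Rightarrow> bool" where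
  "is_module_functor C M N Fo Fa s \<longleftrightarrow>
     is_linear_functor M N Fo Fa \<and>
     (\<forall>c \<in> Obj C. \<forall>m \<in> Obj M.
        s c m \<in> Hom N (Fo (c \<triangleright>\<^sub>o\<^bsub>M\<^esub> m)) (c \<triangleright>\<^sub>o\<^bsub>N\<^esub> Fo m) \<and> is_iso N (s c m)) \<and>
     (\<forall>c d m n. \<forall>f \<in> Hom C c d. \<forall>g \<in> Hom M m n.
        s d n \<cdot>\<^bsub>N\<^esub> Fa (f \<triangleright>\<^sub>a\<^bsub>M\<^esub> g) = (f \<triangleright>\<^sub>a\<^bsub>N\<^esub> Fa g) \<cdot>\<^bsub>N\<^esub> s c m) \<and>
     (\<forall>c \<in> Obj C. \<forall>d \<in> Obj C. \<forall>m \<in> Obj M.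
        (Ident C c \<triangleright>\<^sub>a\<^bsub>N\<^esub> s d m) \<cdot>\<^bsub>N\<^esub> s c (d \<triangleright>\<^sub>o\<^bsub>M\<^esub> m) \<cdot>\<^bsub>N\<^esub> Fa (MAssoc M c d m) =
        MAssoc N c d (Fo m) \<cdot>\<^bsub>N\<^esub> s (c \<otimes>\<^sub>o\<^bsub>C\<^esub> d) m) \<and>
     (\<forall>m \<in> Obj M. MUn N (Fo m) \<cdot>\<^bsub>N\<^esub> s (Unit C) m = Fa (MUn M m))"

definition module_equivalent ::
  "('c, 'f, 'r) mon_cat_scheme \<Rightarrow> ('c, 'f, 'o, 'a, 'm) mod_cat_scheme
    \<Rightarrow> ('c, 'f, 'p, 'b, 'n) mod_cat_scheme \<Rightarrow> bool" where
  "module_equivalent C M N \<longleftrightarrow>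
     (\<exists>Fo Fa s. is_module_functor C M N Fo Fa s \<and> is_equivalence M N Fo Fa)"

definition mod_cat_sum ::
  "('c, 'f, 'o, 'a) mod_cat \<Rightarrow> ('c, 'f, 'p, 'b) mod_cat \<Rightarrow> ('c, 'f, 'o \<times> 'p, 'a \<times> 'b) mod_cat" where
  "mod_cat_sum M N =
     \<lparr>Obj = Obj M \<times> Obj N, Arr = Arr M \<times> Arr N,
      Dom = map_prod (Dom M) (Dom N), Cod = map_prod (Cod M) (Cod N),
      Ident = map_prod (Ident M) (Ident N),
      Comp = (\<lambda>(g, g') (f, f'). (g \<cdot>\<^bsub>M\<^esub> f, g' \<cdot>\<^bsub>N\<^esub> f')),
      Zero = (\<lambda>(m, n) (m', n'). (Zero M m m', Zero N n n')),
      Add = (\<lambda>(f, f') (g, g'). (Add M f g, Add N f' g')),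
      Scale = (\<lambda>k. map_prod (Scale M k) (Scale N k)),
      Act = (\<lambda>c. map_prod (Act M c) (Act N c)),
      ActA = (\<lambda>f. map_prod (ActA M f) (ActA N f)),
      MAssoc = (\<lambda>c d. map_prod (MAssoc M c d) (MAssoc N c d)),
      MUn = map_prod (MUn M) (MUn N)\<rparr>"

definition nonzero_category :: "('o, 'a, 'm) lin_cat_scheme \<Rightarrow> bool" where
  "nonzero_category M \<longleftrightarrow> (\<exists>m \<in> Obj M. \<not> zero_object M m)"

text \<open>
  The summands range over module categories with objects and arrows in the same types as
  those of \<open>M\<close>. This is no restriction: if \<open>M\<close> is equivalent to a direct sum of any two
  module categories, then the summands are equivalent to full subcategories of \<open>M\<close>.
\<close>

definition indecomposable_module_category ::
  "('c, 'f, 'r) mon_cat_scheme \<Rightarrow> ('c, 'f, 'o, 'a) mod_cat \<Rightarrow> bool" where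
  "indecomposable_module_category C M \<longleftrightarrow>
     module_category C M \<and> nonzero_category M \<and>
     \<not> (\<exists>(M1 :: ('c, 'f, 'o, 'a) mod_cat) (M2 :: ('c, 'f, 'o, 'a) mod_cat).
          module_category C M1 \<and> nonzero_category M1 \<and>
          module_category C M2 \<and> nonzero_category M2 \<and>
          module_equivalent C M (mod_cat_sum M1 M2))"


section \<open>Module traces\<close>

text \<open>
  For \<open>f : c \<triangleright> m \<rightarrow> c \<triangleright> m\<close>, the composite
  \<open>m \<rightarrow> 1 \<triangleright> m \<rightarrow> (\<^sup>*c \<otimes> c) \<triangleright> m \<rightarrow> \<^sup>*c \<triangleright> (c \<triangleright> m) \<rightarrow> c* \<triangleright> (c \<triangleright> m) \<rightarrow> (c* \<otimes> c) \<triangleright> m \<rightarrow> 1 \<triangleright> m \<rightarrow> m\<close>.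
  The arrow \<open>\<^sup>*c \<rightarrow> c*\<close> is the pivotal structure \<open>\<^sup>*c \<rightarrow> (\<^sup>*c)**\<close> followed by the canonical
  isomorphism \<open>(\<^sup>*c)** \<rightarrow> c*\<close>, which is the dual of \<open>c \<rightarrow> (\<^sup>*c)*\<close>.
\<close>

definition partial_trace ::
  "('c, 'f, 'r) pivotal_cat_scheme \<Rightarrow> ('c, 'f, 'o, 'a, 'm) mod_cat_scheme
    \<Rightarrow> 'c \<Rightarrow> 'o \<Rightarrow> 'a \<Rightarrow> 'a" where
  "partial_trace C M c m f =
     MUn M m \<cdot>\<^bsub>M\<^esub> (Ev C c \<triangleright>\<^sub>a\<^bsub>M\<^esub> Ident M m) \<cdot>\<^bsub>M\<^esub> inv_arr M (MAssoc M (RDual C c) c m)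
       \<cdot>\<^bsub>M\<^esub> ((dual_arr C (left_right_dual C c) \<cdot>\<^bsub>C\<^esub> Piv C (LDual C c)) \<triangleright>\<^sub>a\<^bsub>M\<^esub> f)
       \<cdot>\<^bsub>M\<^esub> MAssoc M (LDual C c) c m \<cdot>\<^bsub>M\<^esub> (LCoev C c \<triangleright>\<^sub>a\<^bsub>M\<^esub> Ident M m) \<cdot>\<^bsub>M\<^esub> inv_arr M (MUn M m)"

text \<open>Only the values \<open>\<Theta> m f\<close> with \<open>f\<close> an endomorphism of \<open>m\<close> are meaningful.\<close>

locale module_trace =
  fixes C :: "('c, 'f, 'r) pivotal_cat_scheme"
    and M :: "('c, 'f, 'o, 'a, 'm) mod_cat_scheme" (structure)
    and \<Theta> :: "'o \<Rightarrow> 'a \<Rightarrow> complex"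
  assumes trace_Add:
      "\<lbrakk>m \<in> Obj M; f \<in> Hom M m m; g \<in> Hom M m m\<rbrakk> \<Longrightarrow> \<Theta> m (Add M f g) = \<Theta> m f + \<Theta> m g"
    and trace_Scale:
      "\<lbrakk>m \<in> Obj M; f \<in> Hom M m m\<rbrakk> \<Longrightarrow> \<Theta> m (Scale M k f) = k * \<Theta> m f"
    and trace_symmetric:
      "\<lbrakk>m \<in> Obj M; n \<in> Obj M; f \<in> Hom M m n; g \<in> Hom M n m\<rbrakk>
        \<Longrightarrow> \<Theta> m (g \<cdot> f) = \<Theta> n (f \<cdot> g)"
    and trace_nondegenerate_left:
      "\<lbrakk>m \<in> Obj M; n \<in> Obj M; f \<in> Hom M m n; \<And>g. g \<in> Hom M n m \<Longrightarrow> \<Theta> m (g \<cdot> f) = 0\<rbrakk>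
        \<Longrightarrow> f = Zero M m n"
    and trace_nondegenerate_right:
      "\<lbrakk>m \<in> Obj M; n \<in> Obj M; g \<in> Hom M n m; \<And>f. f \<in> Hom M m n \<Longrightarrow> \<Theta> m (g \<cdot> f) = 0\<rbrakk>
        \<Longrightarrow> g = Zero M n m"
    and trace_compatible:
      "\<lbrakk>c \<in> Obj C; m \<in> Obj M; f \<in> Hom M (c \<triangleright>\<^sub>o m) (c \<triangleright>\<^sub>o m)\<rbrakk>
        \<Longrightarrow> \<Theta> (c \<triangleright>\<^sub>o m) f = \<Theta> m (partial_trace C M c m f)"

end

theory Submission
  imports Defs "HOL-Computational_Algebra.Fundamental_Theorem_Algebra"
begin

text \<open>
  For a scalar \<open>w\<close>, let \<open>Q w\<close> be the set of objects on whose endomorphisms \<open>\<Theta>' = w * \<Theta>\<close>. Since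
  simple objects have scalar endomorphisms, each of them lies in some \<open>Q w\<close>. By \<open>C\<close>-compatibility
  \<open>Q w\<close> is stable under the action, and by symmetry and non-degeneracy there are no nonzero arrows
  between \<open>Q w\<close> and \<open>Q w'\<close> for \<open>w \<noteq> w'\<close>. If simple objects had two different ratios \<open>w\<close>, the
  objects orthogonal to one ratio and those orthogonal to all other ratios would decompose \<open>M\<close>
  into two nonzero module subcategories. So a single ratio \<open>z\<close> occurs, and \<open>\<Theta>' = z * \<Theta>\<close> because
  a trace is determined by its values on simple objects.
\<close>

section \<open>Linear categories\<close>

text \<open>Indecomposability only excludes a genuine equivalence with a direct sum, so two classes
  of simple objects are not enough: both summands have to be built as semisimple module categories,
  and the equivalence has to be given with its module structure. Separating one ratio from all the
  others keeps this to two summands, whatever the number of ratios. The union of the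
  \<open>Q w\<close> over the other ratios is not closed under direct sums of objects with different
  ratios. Orthogonal complements are, and their closure under subobjects and quotients is a matter
  of cancelling monics and epics. Endomorphisms of simple objects are scalars because the complex
  numbers are algebraically closed; non-degeneracy of the trace turns the annihilating polynomial of
  an endomorphism into a family of numerical identities. The scalar \<open>z\<close> is the ratio of
  the traces of the identity of a simple object, and it is nonzero because neither trace vanishes
  there.\<close>

lemma hom_space_simps [simp]:
  "carrier (hom_space C x y) = Hom C x y" "add (hom_space C x y) = Add C"
  "zero (hom_space C x y) = Zero C x y" "module.smult (hom_space C x y) = Scale C"
  by (simp_all add: hom_space_def)

lemma complex_ring_simps [simp]:
  "carrier complex_ring = UNIV" "monoid.mult complex_ring = (*)" "one complex_ring = 1"
  "zero complex_ring = 0" "add complex_ring = (+)"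
  by (simp_all add: complex_ring_def)

lemma HomI: "\<lbrakk>f \<in> Arr C; Dom C f = x; Cod C f = y\<rbrakk> \<Longrightarrow> f \<in> Hom C x y"
  by (simp add: Hom_def)

lemma HomD:
  assumes "f \<in> Hom C x y"
  shows "f \<in> Arr C" "Dom C f = x" "Cod C f = y"
  using assms by (simp_all add: Hom_def)

context linear_category
begin

lemma Hom_Obj:
  assumes "f \<in> Hom C x y"
  shows "x \<in> Obj C" "y \<in> Obj C"
  using assms Dom_Obj Cod_Obj by (auto simp: Hom_def)

lemma hom_abelian_group:
  assumes "x \<in> Obj C" "y \<in> Obj C"
  shows "abelian_group (hom_space C x y)"
  using hom_space_module[OF assms] by (simp add: module_def)

lemma Zero_Hom: "\<lbrakk>x \<in> Obj C; y \<in> Obj C\<rbrakk> \<Longrightarrow> Zero C x y \<in> Hom C x y"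
  using abelian_monoid.zero_closed[OF abelian_group.axioms(1)[OF hom_abelian_group]] by fastforce

lemma Add_Hom:
  assumes "f \<in> Hom C x y" "g \<in> Hom C x y"
  shows "Add C f g \<in> Hom C x y"
  using abelian_monoid.a_closed[OF abelian_group.axioms(1)[OF hom_abelian_group[OF Hom_Obj[OF assms(1)]]],
    of f g] assms by simp

lemma Scale_Hom:
  assumes "f \<in> Hom C x y"
  shows "Scale C k f \<in> Hom C x y"
  using module.smult_closed[OF hom_space_module[OF Hom_Obj[OF assms]], of k f] assms by simp

lemma Add_assoc:
  assumes "f \<in> Hom C x y" "g \<in> Hom C x y" "h \<in> Hom C x y"
  shows "Add C (Add C f g) h = Add C f (Add C g h)"
  using abelian_monoid.a_assoc[OF abelian_group.axioms(1)[OF hom_abelian_group[OF Hom_Obj[OF assms(1)]]],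
    of f g h] assms by simp

lemma Add_commute:
  assumes "f \<in> Hom C x y" "g \<in> Hom C x y"
  shows "Add C f g = Add C g f"
  using abelian_monoid.a_comm[OF abelian_group.axioms(1)[OF hom_abelian_group[OF Hom_Obj[OF assms(1)]]],
    of f g] assms by simp

lemma Add_Zero_left:
  assumes "f \<in> Hom C x y"
  shows "Add C (Zero C x y) f = f"
  using abelian_monoid.l_zero[OF abelian_group.axioms(1)[OF hom_abelian_group[OF Hom_Obj[OF assms(1)]]],
    of f] assms by simp

lemma Add_Zero_right:
  assumes "f \<in> Hom C x y"
  shows "Add C f (Zero C x y) = f"
  using Add_Zero_left[OF assms] Add_commute[OF assms Zero_Hom[OF Hom_Obj[OF assms]]] by simp

lemma Scale_one:
  assumes "f \<in> Hom C x y"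
  shows "Scale C 1 f = f"
  using module.smult_one[OF hom_space_module[OF Hom_Obj[OF assms]], of f] assms by simp

lemma Scale_zero:
  assumes "f \<in> Hom C x y"
  shows "Scale C 0 f = Zero C x y"
  using module.smult_l_null[OF hom_space_module[OF Hom_Obj[OF assms]], of f] assms by simp

lemma Scale_Scale:
  assumes "f \<in> Hom C x y"
  shows "Scale C k (Scale C l f) = Scale C (k * l) f"
  using module.smult_assoc1[OF hom_space_module[OF Hom_Obj[OF assms]], of k l f] assms by simp

lemma Scale_add:
  assumes "f \<in> Hom C x y"
  shows "Scale C (k + l) f = Add C (Scale C k f) (Scale C l f)"
  using module.smult_l_distr[OF hom_space_module[OF Hom_Obj[OF assms]], of k l f] assms by simp

text \<open>The record has no negation; multiplication by -1 plays that role throughout.\<close>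

lemma Add_neg:
  assumes "f \<in> Hom C x y"
  shows "Add C f (Scale C (-1) f) = Zero C x y"
  using Scale_add[OF assms, of 1 "-1"] by (simp add: Scale_one[OF assms] Scale_zero[OF assms])

lemma eq_if_diff_Zero:
  assumes f: "f \<in> Hom C x y" and g: "g \<in> Hom C x y"
    and "Add C f (Scale C (-1) g) = Zero C x y"
  shows "f = g"
proof -
  have "Add C (Add C f (Scale C (-1) g)) g = Add C f (Add C g (Scale C (-1) g))"
    using Add_assoc[OF f Scale_Hom[OF g] g] Add_commute[OF g Scale_Hom[OF g]] by simp
  then show ?thesis
    using assms(3) by (simp add: Add_neg[OF g] Add_Zero_left[OF g] Add_Zero_right[OF f])
qed

text \<open>The zero arrow is its own multiple by 0, and scalars move out of a composite.\<close>

lemma Comp_Zero_left: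
  assumes "f \<in> Hom C x y" "z \<in> Obj C"
  shows "Zero C y z \<cdot> f = Zero C x z"
proof -
  have Z: "Zero C y z \<in> Hom C y z"
    using Zero_Hom Hom_Obj assms by blast
  show ?thesis
    using Comp_Scale_left[OF assms(1) Z, of 0]
    by (simp add: Scale_zero[OF Z] Scale_zero[OF Comp_Hom[OF assms(1) Z]])
qed

lemma Comp_Zero_right:
  assumes "g \<in> Hom C y z" "x \<in> Obj C"
  shows "g \<cdot> Zero C x y = Zero C x z"
proof -
  have Z: "Zero C x y \<in> Hom C x y"
    using Zero_Hom Hom_Obj assms by blast
  show ?thesis
    using Comp_Scale_right[OF Z assms(1), of 0]
    by (simp add: Scale_zero[OF Z] Scale_zero[OF Comp_Hom[OF Z assms(1)]])
qed

section \<open>Finite sums of arrows\<close>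

lemma finsum_empty:
  assumes "x \<in> Obj C" "y \<in> Obj C"
  shows "finsum (hom_space C x y) F {} = Zero C x y"
  using abelian_monoid.finsum_empty[OF abelian_group.axioms(1)[OF hom_abelian_group[OF assms]]] by simp

lemma finsum_insert:
  assumes "x \<in> Obj C" "y \<in> Obj C" "finite A" "a \<notin> A" "\<And>i. i \<in> insert a A \<Longrightarrow> F i \<in> Hom C x y"
  shows "finsum (hom_space C x y) F (insert a A) = Add C (F a) (finsum (hom_space C x y) F A)"
  using abelian_monoid.finsum_insert[OF abelian_group.axioms(1)[OF hom_abelian_group[OF assms(1,2)]] assms(3,4), of F]
    assms(5) by auto

lemma finsum_Hom:
  assumes "x \<in> Obj C" "y \<in> Obj C" "\<And>i. i \<in> A \<Longrightarrow> F i \<in> Hom C x y"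
  shows "finsum (hom_space C x y) F A \<in> Hom C x y"
  using abelian_monoid.finsum_closed[OF abelian_group.axioms(1)[OF hom_abelian_group[OF assms(1,2)]], of F A]
    assms(3) by auto

lemma finsum_Zero:
  assumes "x \<in> Obj C" "y \<in> Obj C" "finite A" "\<And>i. i \<in> A \<Longrightarrow> F i = Zero C x y"
  shows "finsum (hom_space C x y) F A = Zero C x y"
  using assms(3,4)
proof (induction A rule: finite_induct)
  case empty
  then show ?case by (simp add: finsum_empty assms)
next
  case (insert a A)
  then show ?case
    by (subst finsum_insert) (auto simp: assms Zero_Hom Add_Zero_left)
qed

text \<open>Stated for an arbitrary additive \<open>T\<close>, so that composition on either side
  and the action of an identity arrow are instances.\<close>

lemma finsum_additive:
  assumes "x \<in> Obj C" "y \<in> Obj C" "x' \<in> Obj C" "y' \<in> Obj C" "finite A"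
    and "\<And>i. i \<in> A \<Longrightarrow> F i \<in> Hom C x y"
    and "\<And>f. f \<in> Hom C x y \<Longrightarrow> T f \<in> Hom C x' y'"
    and "T (Zero C x y) = Zero C x' y'"
    and "\<And>f g. \<lbrakk>f \<in> Hom C x y; g \<in> Hom C x y\<rbrakk> \<Longrightarrow> T (Add C f g) = Add C (T f) (T g)"
  shows "T (finsum (hom_space C x y) F A) = finsum (hom_space C x' y') (\<lambda>i. T (F i)) A"
  using assms(5,6)
proof (induction A rule: finite_induct)
  case empty
  then show ?case by (simp add: finsum_empty assms)
next
  case (insert a A)
  then show ?case
    by (subst (1 2) finsum_insert) (auto simp: assms finsum_Hom)
qed

lemma Comp_finsum_right:
  assumes "g \<in> Hom C y z" "x \<in> Obj C" "finite A" "\<And>i. i \<in> A \<Longrightarrow> F i \<in> Hom C x y"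
  shows "g \<cdot> finsum (hom_space C x y) F A = finsum (hom_space C x z) (\<lambda>i. g \<cdot> F i) A"
  using assms Hom_Obj[OF assms(1)]
  by (intro finsum_additive[where T = "\<lambda>f. g \<cdot> f"])
    (auto simp: Comp_Zero_right Comp_Add_right intro: Comp_Hom)

lemma Comp_finsum_left:
  assumes "f \<in> Hom C x y" "z \<in> Obj C" "finite A" "\<And>i. i \<in> A \<Longrightarrow> F i \<in> Hom C y z"
  shows "finsum (hom_space C y z) F A \<cdot> f = finsum (hom_space C x z) (\<lambda>i. F i \<cdot> f) A"
  using assms Hom_Obj[OF assms(1)]
  by (intro finsum_additive[where T = "\<lambda>g. g \<cdot> f"])
    (auto simp: Comp_Zero_left Comp_Add_left intro: Comp_Hom)

section \<open>Zero objects, monics and epics\<close>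

lemma zero_objectI:
  assumes "x \<in> Obj C" "Ident C x = Zero C x x"
  shows "zero_object C x"
proof -
  have "f = Zero C y x" if f: "f \<in> Hom C y x" for f y
    using Comp_Ident_left[OF f] Comp_Zero_left[OF f assms(1)] assms(2) by simp
  moreover have "f = Zero C x y" if f: "f \<in> Hom C x y" for f y
    using Comp_Ident_right[OF f] Comp_Zero_right[OF f assms(1)] assms(2) by simp
  ultimately show ?thesis
    unfolding zero_object_def using assms(1) Zero_Hom by blast
qed

lemma zero_object_Ident: "zero_object C x \<Longrightarrow> Ident C x = Zero C x x"
  unfolding zero_object_def using Ident_Hom Zero_Hom by blast

lemma zero_object_Hom:
  assumes "zero_object C x"
  shows "f \<in> Hom C x y \<Longrightarrow> f = Zero C x y" "f \<in> Hom C y x \<Longrightarrow> f = Zero C y x"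
proof -
  have x: "x \<in> Obj C" using assms by (simp add: zero_object_def)
  show "f = Zero C x y" if f: "f \<in> Hom C x y"
    using Comp_Ident_right[OF f] Comp_Zero_right[OF f x] zero_object_Ident[OF assms] by simp
  show "f = Zero C y x" if f: "f \<in> Hom C y x"
    using Comp_Ident_left[OF f] Comp_Zero_left[OF f x] zero_object_Ident[OF assms] by simp
qed

text \<open>Linearity reduces cancellation to the arrows killed by \<open>f\<close>, applied to the
  difference of two arrows.\<close>

lemma monicI:
  assumes f: "f \<in> Hom C x y"
    and inj: "\<And>w g. \<lbrakk>g \<in> Hom C w x; f \<cdot> g = Zero C w y\<rbrakk> \<Longrightarrow> g = Zero C w x"
  shows "monic C f"
  unfolding monic_def
proof (intro conjI allI ballI impI)
  show "f \<in> Arr C" using f by (rule HomD)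
  fix w g h assume "g \<in> Hom C w (Dom C f)" "h \<in> Hom C w (Dom C f)" and eq: "f \<cdot> g = f \<cdot> h"
  then have g: "g \<in> Hom C w x" and h: "h \<in> Hom C w x"
    using HomD[OF f] by simp_all
  have "f \<cdot> Add C g (Scale C (-1) h) = Zero C w y"
    using Comp_Add_right[OF g Scale_Hom[OF h] f] Comp_Scale_right[OF h f] eq Add_neg[OF Comp_Hom[OF h f]]
    by simp
  then have "Add C g (Scale C (-1) h) = Zero C w x"
    using inj Add_Hom[OF g Scale_Hom[OF h]] by blast
  then show "g = h" using eq_if_diff_Zero g h by blast
qed

lemma monic_cancel:
  assumes "monic C f" "f \<in> Hom C x y" "g \<in> Hom C w x" "h \<in> Hom C w x" "f \<cdot> g = f \<cdot> h"
  shows "g = h"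
  using assms HomD[OF assms(2)] unfolding monic_def by blast

lemma monic_Zero:
  assumes "monic C f" "f \<in> Hom C x y" "g \<in> Hom C w x" "f \<cdot> g = Zero C w y"
  shows "g = Zero C w x"
  using monic_cancel[OF assms(1-3) Zero_Hom[OF Hom_Obj(1)[OF assms(3)] Hom_Obj(1)[OF assms(2)]]]
    Comp_Zero_right[OF assms(2) Hom_Obj(1)[OF assms(3)]] assms(4) by simp

lemma epicI:
  assumes f: "f \<in> Hom C x y"
    and inj: "\<And>w g. \<lbrakk>g \<in> Hom C y w; g \<cdot> f = Zero C x w\<rbrakk> \<Longrightarrow> g = Zero C y w"
  shows "epic C f"
  unfolding epic_def
proof (intro conjI allI ballI impI)
  show "f \<in> Arr C" using f by (rule HomD)
  fix w g h assume "g \<in> Hom C (Cod C f) w" "h \<in> Hom C (Cod C f) w" and eq: "g \<cdot> f = h \<cdot> f"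
  then have g: "g \<in> Hom C y w" and h: "h \<in> Hom C y w"
    using HomD[OF f] by simp_all
  have "Add C g (Scale C (-1) h) \<cdot> f = Zero C x w"
    using Comp_Add_left[OF f g Scale_Hom[OF h]] Comp_Scale_left[OF f h] eq Add_neg[OF Comp_Hom[OF f h]]
    by simp
  then have "Add C g (Scale C (-1) h) = Zero C y w"
    using inj Add_Hom[OF g Scale_Hom[OF h]] by blast
  then show "g = h" using eq_if_diff_Zero g h by blast
qed

lemma epic_cancel:
  assumes "epic C f" "f \<in> Hom C x y" "g \<in> Hom C y w" "h \<in> Hom C y w" "g \<cdot> f = h \<cdot> f"
  shows "g = h"
  using assms HomD[OF assms(2)] unfolding epic_def by blast

lemma epic_Zero:
  assumes "epic C f" "f \<in> Hom C x y" "g \<in> Hom C y w" "g \<cdot> f = Zero C x w"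
  shows "g = Zero C y w"
  using epic_cancel[OF assms(1-3) Zero_Hom[OF Hom_Obj(2)[OF assms(2)] Hom_Obj(2)[OF assms(3)]]]
    Comp_Zero_left[OF assms(2) Hom_Obj(2)[OF assms(3)]] assms(4) by simp

lemma split_monic:
  assumes f: "f \<in> Hom C x y" and g: "g \<in> Hom C y x" and gf: "g \<cdot> f = Ident C x"
  shows "monic C f"
proof (rule monicI[OF f])
  fix w h assume h: "h \<in> Hom C w x" and "f \<cdot> h = Zero C w y"
  then have "(g \<cdot> f) \<cdot> h = Zero C w x"
    using Comp_assoc[OF h f g] Comp_Zero_right[OF g Hom_Obj(1)[OF h]] by simp
  then show "h = Zero C w x" using gf Comp_Ident_left[OF h] by simp
qed

section \<open>Kernels, cokernels and inverses\<close>

lemma is_kernelD: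
  assumes "is_kernel C k f" "f \<in> Hom C x y"
  shows "k \<in> Hom C (Dom C k) x" "f \<cdot> k = Zero C (Dom C k) y"
    "\<lbrakk>g \<in> Hom C w x; f \<cdot> g = Zero C w y\<rbrakk> \<Longrightarrow> \<exists>u \<in> Hom C w (Dom C k). k \<cdot> u = g"
proof -
  show "k \<in> Hom C (Dom C k) x" "f \<cdot> k = Zero C (Dom C k) y"
    using assms(1) HomD[OF assms(2)] unfolding is_kernel_def by (auto intro: HomI)
next
  assume "g \<in> Hom C w x" "f \<cdot> g = Zero C w y"
  then show "\<exists>u \<in> Hom C w (Dom C k). k \<cdot> u = g"
    using assms(1) HomD[OF assms(2)] unfolding is_kernel_def by metis
qed

lemma is_cokernelD:
  assumes "is_cokernel C q f" "f \<in> Hom C x y"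
  shows "q \<in> Hom C y (Cod C q)" "q \<cdot> f = Zero C x (Cod C q)"
    "\<lbrakk>g \<in> Hom C y w; g \<cdot> f = Zero C x w\<rbrakk> \<Longrightarrow> \<exists>u \<in> Hom C (Cod C q) w. u \<cdot> q = g"
proof -
  show "q \<in> Hom C y (Cod C q)" "q \<cdot> f = Zero C x (Cod C q)"
    using assms(1) HomD[OF assms(2)] unfolding is_cokernel_def by (auto intro: HomI)
next
  assume "g \<in> Hom C y w" "g \<cdot> f = Zero C x w"
  then show "\<exists>u \<in> Hom C (Cod C q) w. u \<cdot> q = g"
    using assms(1) HomD[OF assms(2)] unfolding is_cokernel_def by metis
qed

lemma kernel_monic:
  assumes k: "is_kernel C k f"
  shows "monic C k"
proof -
  have f: "f \<in> Hom C (Dom C f) (Cod C f)" and kH: "k \<in> Hom C (Dom C k) (Dom C f)"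
    and fk: "f \<cdot> k = Zero C (Dom C k) (Cod C f)"
    using k unfolding is_kernel_def by (auto intro: HomI)
  show ?thesis
    unfolding monic_def
  proof (intro conjI allI ballI impI)
    show "k \<in> Arr C" using kH by (rule HomD)
    fix w g h assume g: "g \<in> Hom C w (Dom C k)" and h: "h \<in> Hom C w (Dom C k)" and eq: "k \<cdot> g = k \<cdot> h"
    have "f \<cdot> (k \<cdot> g) = Zero C w (Cod C f)"
      using Comp_assoc[OF g kH f] fk Comp_Zero_left[OF g Hom_Obj(2)[OF f]] by simp
    then have "\<exists>!u. u \<in> Hom C w (Dom C k) \<and> k \<cdot> u = k \<cdot> g"
      using k Comp_Hom[OF g kH] unfolding is_kernel_def by blast
    then show "g = h" using g h eq by metis
  qed
qed

lemma is_kernelI: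
  assumes "monic C k" "k \<in> Hom C x y" "f \<in> Hom C y z" "f \<cdot> k = Zero C x z"
    and "\<And>w g. \<lbrakk>g \<in> Hom C w y; f \<cdot> g = Zero C w z\<rbrakk> \<Longrightarrow> \<exists>u \<in> Hom C w x. k \<cdot> u = g"
  shows "is_kernel C k f"
proof -
  have "\<exists>!u. u \<in> Hom C w x \<and> k \<cdot> u = g" if "g \<in> Hom C w y" "f \<cdot> g = Zero C w z" for w g
    using assms(5)[OF that] monic_cancel[OF assms(1,2)] by blast
  then show ?thesis
    using assms(4) by (simp add: is_kernel_def HomD[OF assms(2)] HomD[OF assms(3)])
qed

lemma cokernel_epic:
  assumes k: "is_cokernel C k f"
  shows "epic C k"
proof -
  have f: "f \<in> Hom C (Dom C f) (Cod C f)" and kH: "k \<in> Hom C (Cod C f) (Cod C k)"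
    and fk: "k \<cdot> f = Zero C (Dom C f) (Cod C k)"
    using k unfolding is_cokernel_def by (auto intro: HomI)
  show ?thesis
    unfolding epic_def
  proof (intro conjI allI ballI impI)
    show "k \<in> Arr C" using kH by (rule HomD)
    fix w g h assume g: "g \<in> Hom C (Cod C k) w" and h: "h \<in> Hom C (Cod C k) w" and eq: "g \<cdot> k = h \<cdot> k"
    have "(g \<cdot> k) \<cdot> f = Zero C (Dom C f) w"
      using Comp_assoc[OF f kH g] fk Comp_Zero_right[OF g Hom_Obj(1)[OF f]] by simp
    then have "\<exists>!u. u \<in> Hom C (Cod C k) w \<and> u \<cdot> k = g \<cdot> k"
      using k Comp_Hom[OF kH g] unfolding is_cokernel_def by blast
    then show "g = h" using g h eq by metis
  qed
qed

lemma is_cokernelI: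
  assumes "epic C q" "q \<in> Hom C y z" "f \<in> Hom C x y" "q \<cdot> f = Zero C x z"
    and "\<And>w g. \<lbrakk>g \<in> Hom C y w; g \<cdot> f = Zero C x w\<rbrakk> \<Longrightarrow> \<exists>u \<in> Hom C z w. u \<cdot> q = g"
  shows "is_cokernel C q f"
proof -
  have "\<exists>!u. u \<in> Hom C z w \<and> u \<cdot> q = g" if "g \<in> Hom C y w" "g \<cdot> f = Zero C x w" for w g
    using assms(5)[OF that] epic_cancel[OF assms(1,2)] by blast
  then show ?thesis
    using assms(4) by (simp add: is_cokernel_def HomD[OF assms(2)] HomD[OF assms(3)])
qed

lemma is_inverse_iff:
  assumes "f \<in> Hom C x y"
  shows "is_inverse C f g \<longleftrightarrow> g \<in> Hom C y x \<and> g \<cdot> f = Ident C x \<and> f \<cdot> g = Ident C y"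
  using HomD[OF assms] by (simp add: is_inverse_def)

lemma is_isoE:
  assumes "is_iso C f" "f \<in> Hom C x y"
  obtains g where "g \<in> Hom C y x" "g \<cdot> f = Ident C x" "f \<cdot> g = Ident C y"
  using assms by (auto simp: is_iso_def is_inverse_iff)

lemma is_isoI:
  "\<lbrakk>f \<in> Hom C x y; g \<in> Hom C y x; g \<cdot> f = Ident C x; f \<cdot> g = Ident C y\<rbrakk> \<Longrightarrow> is_iso C f"
  by (auto simp: is_iso_def is_inverse_iff)

text \<open>\<open>inv_arr\<close> is a definite description, so it takes the uniqueness of inverses
  to know anything about its value.\<close>

lemma inv_arr_Hom:
  assumes "is_iso C f" and f: "f \<in> Hom C x y"
  shows "inv_arr C f \<in> Hom C y x"
proof -
  obtain g where g: "is_inverse C f g" using assms(1) by (auto simp: is_iso_def)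
  have "h = g" if "is_inverse C f h" for h
    using that g Comp_assoc[of g y x f y h x] Comp_Ident_left[of g y x] Comp_Ident_right[of h y x] f
    by (simp add: is_inverse_iff[OF f])
  then have "is_inverse C f (inv_arr C f)"
    unfolding inv_arr_def using g by (metis theI)
  then show ?thesis by (simp add: is_inverse_iff[OF f])
qed

end

section \<open>Normality and simple objects in abelian categories\<close>

context abelian_category
begin

text \<open>The arrow \<open>g\<close> provided by \<open>monic_normal\<close> factors through the
  cokernel \<open>q\<close>, so whatever \<open>q\<close> kills is killed by \<open>g\<close> and
  hence factors through \<open>f\<close>. With \<open>q\<close> in place of an unspecified
  \<open>g\<close>, normality can be inherited by a full subcategory closed under quotients.\<close>

lemma kernel_of_cokernel:
  assumes "monic C f" "f \<in> Hom C x y" and q: "is_cokernel C q f"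
  shows "is_kernel C f q"
proof -
  note qD = is_cokernelD[OF q assms(2)]
  obtain g where g: "is_kernel C f g" using monic_normal assms(1) by blast
  have gH: "g \<in> Hom C y (Cod C g)"
    using g HomD[OF assms(2)] unfolding is_kernel_def by (auto intro: HomI)
  note gD = is_kernelD[OF g gH]
  obtain v where v: "v \<in> Hom C (Cod C q) (Cod C g)" "v \<cdot> q = g"
    using qD(3)[OF gH] gD(2) HomD[OF assms(2)] by auto
  show ?thesis
  proof (rule is_kernelI[OF assms(1,2) qD(1,2)])
    fix w h assume h: "h \<in> Hom C w y" "q \<cdot> h = Zero C w (Cod C q)"
    have "g \<cdot> h = Zero C w (Cod C g)"
      using Comp_assoc[OF h(1) qD(1) v(1)] v(2) h(2) Comp_Zero_right[OF v(1) Hom_Obj(1)[OF h(1)]] by simp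
    then show "\<exists>u \<in> Hom C w x. f \<cdot> u = h" using gD(3)[OF h(1)] HomD[OF assms(2)] by auto
  qed
qed

text \<open>Dual argument; the kernel of \<open>f\<close> stays inside any full subcategory closed
  under subobjects.\<close>

lemma cokernel_of_kernel:
  assumes "epic C f" "f \<in> Hom C x y" and k: "is_kernel C k f"
  shows "is_cokernel C f k"
proof -
  note kD = is_kernelD[OF k assms(2)]
  obtain g where g: "is_cokernel C f g" using epic_normal assms(1) by blast
  have gH: "g \<in> Hom C (Dom C g) x"
    using g HomD[OF assms(2)] unfolding is_cokernel_def by (auto intro: HomI)
  note gD = is_cokernelD[OF g gH]
  obtain v where v: "v \<in> Hom C (Dom C g) (Dom C k)" "k \<cdot> v = g"
    using kD(3)[OF gH] gD(2) HomD[OF assms(2)] by auto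
  show ?thesis
  proof (rule is_cokernelI[OF assms(1,2) kD(1,2)])
    fix w h assume h: "h \<in> Hom C x w" "h \<cdot> k = Zero C (Dom C k) w"
    have "h \<cdot> g = Zero C (Dom C g) w"
      using Comp_assoc[OF v(1) kD(1) h(1)] v(2) h(2) Comp_Zero_left[OF v(1) Hom_Obj(2)[OF h(1)]] by simp
    then show "\<exists>u \<in> Hom C y w. u \<cdot> f = h" using gD(3)[OF h(1)] HomD[OF assms(2)] by auto
  qed
qed

text \<open>One half of Schur's lemma. The kernel of \<open>f\<close> is a subobject of
  \<open>X\<close> that cannot be all of \<open>X\<close>, so it is zero; then \<open>f\<close> is
  itself a monic into \<open>X\<close> with nonzero domain, hence invertible.\<close>

lemma simple_endo_iso:
  assumes X: "simple C X" and f: "f \<in> Hom C X X" and "f \<noteq> Zero C X X"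
  shows "is_iso C f"
proof -
  obtain k where k: "is_kernel C k f" using kernels HomD[OF f] by blast
  note kD = is_kernelD[OF k f]
  have "\<not> is_iso C k"
  proof
    assume "is_iso C k"
    then obtain l where l: "l \<in> Hom C X (Dom C k)" "k \<cdot> l = Ident C X"
      using is_isoE[OF _ kD(1)] by metis
    have "f = Zero C X X"
      using Comp_assoc[OF l(1) kD(1) f] kD(2) Comp_Zero_left[OF l(1) Hom_Obj(1)[OF f]] l(2)
        Comp_Ident_right[OF f] by simp
    then show False using assms(3) by simp
  qed
  then have zero: "zero_object C (Dom C k)"
    using X kernel_monic[OF k] HomD[OF kD(1)] unfolding simple_def by blast
  have "monic C f"
  proof (rule monicI[OF f])
    fix w g assume "g \<in> Hom C w X" "f \<cdot> g = Zero C w X"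
    then obtain u where u: "u \<in> Hom C w (Dom C k)" "k \<cdot> u = g" using kD(3) by blast
    show "g = Zero C w X"
      using zero_object_Hom(2)[OF zero u(1)] u Comp_Zero_right[OF kD(1) Hom_Obj(1)[OF u(1)]] by simp
  qed
  then show ?thesis
    using X HomD[OF f] unfolding simple_def by metis
qed

end

section \<open>Full subcategories\<close>

text \<open>Only \<open>Obj\<close> and \<open>Arr\<close> change, so equations between arrows
  restrict verbatim. The scheme parameter preserves further record fields, in particular a module
  structure.\<close>

definition full_sub :: "('o, 'a, 'm) lin_cat_scheme \<Rightarrow> 'o set \<Rightarrow> ('o, 'a, 'm) lin_cat_scheme" where
  "full_sub C P = C\<lparr>Obj := P, Arr := {f \<in> Arr C. Dom C f \<in> P \<and> Cod C f \<in> P}\<rparr>"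

lemma full_sub_simps [simp]:
  "Obj (full_sub C P) = P"
  "Dom (full_sub C P) = Dom C" "Cod (full_sub C P) = Cod C" "Ident (full_sub C P) = Ident C"
  "Comp (full_sub C P) = Comp C" "Zero (full_sub C P) = Zero C" "Add (full_sub C P) = Add C"
  "Scale (full_sub C P) = Scale C"
  by (simp_all add: full_sub_def)

lemma Arr_full_sub: "f \<in> Arr (full_sub C P) \<longleftrightarrow> f \<in> Arr C \<and> Dom C f \<in> P \<and> Cod C f \<in> P"
  by (simp add: full_sub_def)

lemma Hom_full_sub: "f \<in> Hom (full_sub C P) x y \<longleftrightarrow> f \<in> Hom C x y \<and> x \<in> P \<and> y \<in> P"
  by (auto simp: Hom_def Arr_full_sub)

lemma hom_space_full_sub:
  assumes "x \<in> P" "y \<in> P"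
  shows "hom_space (full_sub C P) x y = hom_space C x y"
proof -
  have "Hom (full_sub C P) x y = Hom C x y" using assms by (auto simp: Hom_full_sub)
  then show ?thesis by (simp add: hom_space_def)
qed

lemma is_inverse_full_sub:
  "is_inverse (full_sub C P) f g \<longleftrightarrow> is_inverse C f g \<and> Dom C f \<in> P \<and> Cod C f \<in> P"
  by (auto simp: is_inverse_def Arr_full_sub Hom_full_sub)

lemma is_iso_full_sub:
  "is_iso (full_sub C P) f \<longleftrightarrow> is_iso C f \<and> Dom C f \<in> P \<and> Cod C f \<in> P"
  by (auto simp: is_iso_def is_inverse_full_sub)

lemma is_direct_sum_full_sub:
  assumes "\<And>i. i < n \<Longrightarrow> X i \<in> P" "s \<in> P" "P \<subseteq> Obj C"
  shows "is_direct_sum (full_sub C P) n X s inc pr \<longleftrightarrow> is_direct_sum C n X s inc pr"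
  using assms unfolding is_direct_sum_def by (auto simp: Hom_full_sub hom_space_full_sub)

lemma (in linear_category) linear_category_full_sub:
  assumes "P \<subseteq> Obj C"
  shows "linear_category (full_sub C P)"
proof (rule linear_category.intro)
  fix x y assume "x \<in> Obj (full_sub C P)" "y \<in> Obj (full_sub C P)"
  then show "module complex_ring (hom_space (full_sub C P) x y)"
    using assms hom_space_module by (auto simp: hom_space_full_sub)
qed (use assms Ident_Hom Comp_Hom Comp_assoc Comp_Ident_left Comp_Ident_right
       Comp_Add_left Comp_Add_right Comp_Scale_left Comp_Scale_right in
     \<open>auto simp: Arr_full_sub Hom_full_sub\<close>)

text \<open>Kernels call for closure under subobjects, cokernels for closure under quotients,
  biproducts for closure under direct sums. The case \<open>n = 0\<close> puts the zero objects into
  \<open>P\<close>.\<close>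

locale closed_subset = semisimple_category +
  fixes P
  assumes subset_Obj: "P \<subseteq> Obj C"
    and subobject_closed: "\<lbrakk>monic C k; k \<in> Hom C x y; y \<in> P\<rbrakk> \<Longrightarrow> x \<in> P"
    and quotient_closed: "\<lbrakk>epic C q; q \<in> Hom C x y; x \<in> P\<rbrakk> \<Longrightarrow> y \<in> P"
    and direct_sum_closed: "\<lbrakk>is_direct_sum C n X s inc pr; \<And>i. i < n \<Longrightarrow> X i \<in> P\<rbrakk> \<Longrightarrow> s \<in> P"
begin

sublocale sub: linear_category "full_sub C P"
  by (rule linear_category_full_sub[OF subset_Obj])

lemma kernel_full_sub:
  assumes "is_kernel C k f" "Dom C f \<in> P" "Cod C f \<in> P"
  shows "is_kernel (full_sub C P) k f" "Dom C k \<in> P"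
proof -
  show "Dom C k \<in> P"
    using subobject_closed[OF kernel_monic[OF assms(1)]] assms(1,2) unfolding is_kernel_def
    by (metis HomI)
  then show "is_kernel (full_sub C P) k f"
    using assms unfolding is_kernel_def by (auto simp: Arr_full_sub Hom_full_sub)
qed

lemma cokernel_full_sub:
  assumes "is_cokernel C q f" "Dom C f \<in> P" "Cod C f \<in> P"
  shows "is_cokernel (full_sub C P) q f" "Cod C q \<in> P"
proof -
  show "Cod C q \<in> P"
    using quotient_closed[OF cokernel_epic[OF assms(1)]] assms(1,3) unfolding is_cokernel_def
    by (metis HomI)
  then show "is_cokernel (full_sub C P) q f"
    using assms unfolding is_cokernel_def by (auto simp: Arr_full_sub Hom_full_sub)
qed

lemma zero_object_full_sub: "zero_object (full_sub C P) x \<longleftrightarrow> zero_object C x \<and> x \<in> P"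
proof
  assume z: "zero_object (full_sub C P) x"
  then have "x \<in> P" by (simp add: zero_object_def)
  then show "zero_object C x \<and> x \<in> P"
    using zero_objectI[of x] sub.zero_object_Ident[OF z] subset_Obj by auto
next
  assume z: "zero_object C x \<and> x \<in> P"
  then show "zero_object (full_sub C P) x"
    using sub.zero_objectI[of x] zero_object_Ident by simp
qed

text \<open>Being monic in the subcategory only tests arrows from objects of \<open>P\<close>, but
  the kernel of \<open>f\<close> has its domain in \<open>P\<close>. It is therefore the zero arrow,
  which makes \<open>f\<close> monic in \<open>C\<close>.\<close>

lemma monic_full_sub:
  assumes "monic (full_sub C P) f"
  shows "monic C f" "Dom C f \<in> P" "Cod C f \<in> P"
proof -
  have f: "f \<in> Hom (full_sub C P) (Dom C f) (Cod C f)"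
    using assms by (auto simp: monic_def intro: HomI)
  then have fC: "f \<in> Hom C (Dom C f) (Cod C f)" and P: "Dom C f \<in> P" "Cod C f \<in> P"
    by (simp_all add: Hom_full_sub)
  show "Dom C f \<in> P" "Cod C f \<in> P" by (fact P)+
  obtain k where k: "is_kernel C k f" using kernels HomD(1)[OF fC] by blast
  note kD = is_kernelD[OF k fC]
  have "k \<in> Hom (full_sub C P) (Dom C k) (Dom C f)"
    using kD(1) P kernel_full_sub(2)[OF k P] by (simp add: Hom_full_sub)
  then have k0: "k = Zero C (Dom C k) (Dom C f)"
    using sub.monic_Zero[OF assms f] kD(2) by simp
  show "monic C f"
  proof (rule monicI[OF fC])
    fix w g assume "g \<in> Hom C w (Dom C f)" "f \<cdot> g = Zero C w (Cod C f)"
    then obtain u where u: "u \<in> Hom C w (Dom C k)" "k \<cdot> u = g" using kD(3) by blast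
    show "g = Zero C w (Dom C f)"
      using Comp_Zero_left[OF u(1) Hom_Obj(2)[OF kD(1)]] u(2) k0 by simp
  qed
qed

lemma epic_full_sub:
  assumes "epic (full_sub C P) f"
  shows "epic C f" "Dom C f \<in> P" "Cod C f \<in> P"
proof -
  have f: "f \<in> Hom (full_sub C P) (Dom C f) (Cod C f)"
    using assms by (auto simp: epic_def intro: HomI)
  then have fC: "f \<in> Hom C (Dom C f) (Cod C f)" and P: "Dom C f \<in> P" "Cod C f \<in> P"
    by (simp_all add: Hom_full_sub)
  show "Dom C f \<in> P" "Cod C f \<in> P" by (fact P)+
  obtain q where q: "is_cokernel C q f" using cokernels HomD(1)[OF fC] by blast
  note qD = is_cokernelD[OF q fC]
  have "q \<in> Hom (full_sub C P) (Cod C f) (Cod C q)"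
    using qD(1) P cokernel_full_sub(2)[OF q P] by (simp add: Hom_full_sub)
  then have q0: "q = Zero C (Cod C f) (Cod C q)"
    using sub.epic_Zero[OF assms f] qD(2) by simp
  show "epic C f"
  proof (rule epicI[OF fC])
    fix w g assume "g \<in> Hom C (Cod C f) w" "g \<cdot> f = Zero C (Dom C f) w"
    then obtain u where u: "u \<in> Hom C (Cod C q) w" "u \<cdot> q = g" using qD(3) by blast
    show "g = Zero C (Cod C f) w"
      using Comp_Zero_right[OF u(1) Hom_Obj(1)[OF qD(1)]] u(2) q0 by simp
  qed
qed

lemma simple_full_sub:
  assumes "simple C x" "x \<in> P"
  shows "simple (full_sub C P) x"
  unfolding simple_def
proof (intro conjI allI impI)
  show "x \<in> Obj (full_sub C P)" using assms(2) by simp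
  show "\<not> zero_object (full_sub C P) x"
    using assms(1) by (simp add: zero_object_full_sub simple_def)
  fix f assume "monic (full_sub C P) f \<and> Cod (full_sub C P) f = x"
  then show "zero_object (full_sub C P) (Dom (full_sub C P) f) \<or> is_iso (full_sub C P) f"
    using assms monic_full_sub[of f]
    by (auto simp: simple_def zero_object_full_sub is_iso_full_sub)
qed

text \<open>A composition series stays in \<open>P\<close>: each smaller term is a subobject, and
  each factor a quotient, of an object of \<open>P\<close>.\<close>

lemma finite_length_full_sub:
  assumes "finite_length C x" "x \<in> P"
  shows "finite_length (full_sub C P) x"
  using assms
proof (induction rule: finite_length.induct)
  case (zero x)
  then show ?case by (simp add: finite_length.zero zero_object_full_sub)
next
  case (extension x s k y q)
  have x: "x \<in> P" using subobject_closed[OF kernel_monic] extension by blast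
  have s: "s \<in> P" using quotient_closed[OF cokernel_epic] extension by blast
  show ?case
  proof (rule finite_length.extension)
    show "finite_length (full_sub C P) x" using extension x by blast
    show "simple (full_sub C P) s" using simple_full_sub extension s by blast
    show "k \<in> Hom (full_sub C P) x y" "q \<in> Hom (full_sub C P) y s"
      using extension x s by (simp_all add: Hom_full_sub)
    show "is_kernel (full_sub C P) k q" "is_cokernel (full_sub C P) q k"
      using kernel_full_sub(1) cokernel_full_sub(1) HomD extension x s by metis+
  qed
qed

lemma direct_summand_closed:
  assumes "is_direct_sum C n X s inc pr" "s \<in> P" "i < n"
  shows "X i \<in> P"
proof -
  have "monic C (inc i)" "inc i \<in> Hom C (X i) s"
    using assms by (auto simp: is_direct_sum_def intro: split_monic)
  then show ?thesis using subobject_closed assms(2) by blast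
qed

lemma semisimple_category_full_sub: "semisimple_category (full_sub C P)"
proof unfold_locales
  fix n :: nat and X
  assume X: "\<And>i. i < n \<Longrightarrow> X i \<in> Obj (full_sub C P)"
  then have "\<And>i. i < n \<Longrightarrow> X i \<in> Obj C" using subset_Obj by auto
  then obtain s inc pr where s: "is_direct_sum C n X s inc pr"
    using direct_sums by blast
  then show "\<exists>s inc pr. is_direct_sum (full_sub C P) n X s inc pr"
    using X direct_sum_closed[OF s] subset_Obj is_direct_sum_full_sub[of n X P s C inc pr] by auto
next
  fix f assume "f \<in> Arr (full_sub C P)"
  then show "\<exists>k. is_kernel (full_sub C P) k f" "\<exists>q. is_cokernel (full_sub C P) q f"
    using kernels cokernels kernel_full_sub(1) cokernel_full_sub(1) unfolding Arr_full_sub by blast+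
next
  fix f assume f: "monic (full_sub C P) f"
  note fD = monic_full_sub[OF f]
  then obtain q where q: "is_cokernel C q f" using cokernels unfolding monic_def by blast
  have fH: "f \<in> Hom C (Dom C f) (Cod C f)" using fD(1) by (auto simp: monic_def intro: HomI)
  have "is_kernel C f q" using kernel_of_cokernel[OF fD(1) fH q] .
  then have "is_kernel (full_sub C P) f q"
    using kernel_full_sub(1) cokernel_full_sub(2)[OF q fD(2,3)] fD(3) HomD(2)[OF is_cokernelD(1)[OF q fH]]
    by simp
  then show "\<exists>g. is_kernel (full_sub C P) f g" ..
next
  fix f assume f: "epic (full_sub C P) f"
  note fD = epic_full_sub[OF f]
  then obtain k where k: "is_kernel C k f" using kernels unfolding epic_def by blast
  have fH: "f \<in> Hom C (Dom C f) (Cod C f)" using fD(1) by (auto simp: epic_def intro: HomI)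
  have "is_cokernel C f k" using cokernel_of_kernel[OF fD(1) fH k] .
  then have "is_cokernel (full_sub C P) f k"
    using cokernel_full_sub(1) kernel_full_sub(2)[OF k fD(2,3)] fD(2) HomD(3)[OF is_kernelD(1)[OF k fH]]
    by simp
  then show "\<exists>g. is_cokernel (full_sub C P) f g" ..
next
  fix x y assume "x \<in> Obj (full_sub C P)" "y \<in> Obj (full_sub C P)"
  moreover from this have "Hom (full_sub C P) x y = Hom C x y" by (auto simp: Hom_full_sub)
  ultimately show "\<exists>B. finite B \<and> B \<subseteq> Hom (full_sub C P) x y \<and>
      (\<forall>f\<in>Hom (full_sub C P) x y. \<exists>c. f =
        finsum (hom_space (full_sub C P) x y) (\<lambda>b. Scale (full_sub C P) (c b) b) B)"
    using finite_dim_Hom[of x y] subset_Obj by (simp add: hom_space_full_sub subset_iff)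
next
  fix x assume "x \<in> Obj (full_sub C P)"
  then show "finite_length (full_sub C P) x"
    using finite_length_full_sub finite_length subset_Obj by auto
next
  fix x assume x: "x \<in> Obj (full_sub C P)"
  then obtain n X inc pr where X: "\<forall>i<n. simple C (X i)" and s: "is_direct_sum C n X x inc pr"
    using semisimple[of x] subset_Obj by (auto simp: subset_iff)
  have XP: "X i \<in> P" if "i < n" for i
    using direct_summand_closed[OF s] x that by simp
  have "is_direct_sum (full_sub C P) n X x inc pr"
    using s x XP subset_Obj by (simp add: is_direct_sum_full_sub)
  then show "\<exists>n X inc pr. (\<forall>i<n. simple (full_sub C P) (X i)) \<and> is_direct_sum (full_sub C P) n X x inc pr"
    using X XP simple_full_sub by blast
qed

end

section \<open>Module structure on full subcategories\<close>

lemma full_sub_mod_simps [simp]: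
  "Act (full_sub M P) = Act M" "ActA (full_sub M P) = ActA M"
  "MAssoc (full_sub M P) = MAssoc M" "MUn (full_sub M P) = MUn M"
  by (simp_all add: full_sub_def)

lemma module_category_full_sub:
  assumes "module_category C M" "closed_subset M P"
    and act: "\<And>c x. \<lbrakk>c \<in> Obj C; x \<in> P\<rbrakk> \<Longrightarrow> Act M c x \<in> P"
  shows "module_category C (full_sub M P)"
proof -
  interpret M: module_category C M by fact
  interpret P: closed_subset M P by fact
  interpret N: semisimple_category "full_sub M P" by (rule P.semisimple_category_full_sub)
  have O: "x \<in> Obj M" if "x \<in> P" for x using that P.subset_Obj by blast
  show ?thesis
  proof unfold_locales
    fix c m assume c: "c \<in> Obj C" and "m \<in> Obj (full_sub M P)"
    then have m: "m \<in> P" "m \<in> Obj M" using O by simp_all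
    show "Act (full_sub M P) c m \<in> Obj (full_sub M P)" using act c m by simp
    show "ActA (full_sub M P) (Ident C c) (Ident (full_sub M P) m) =
        Ident (full_sub M P) (Act (full_sub M P) c m)"
      using M.ActA_Ident c m by simp
    show "Comp (full_sub M P) (ActA (full_sub M P) (Ident C c) (MUn (full_sub M P) m))
          (MAssoc (full_sub M P) c (Unit C) m) =
        ActA (full_sub M P) (Run C c) (Ident (full_sub M P) m)"
      using M.module_triangle c m by simp
    fix d assume d: "d \<in> Obj C"
    note assoc = M.MAssoc_Hom[OF c d m(2)]
    have P: "Act M (Tens C c d) m \<in> P" "Act M c (Act M d m) \<in> P"
      using act c d m M.C.Tens_Obj by simp_all
    show "MAssoc (full_sub M P) c d m \<in> Hom (full_sub M P)
        (Act (full_sub M P) (Tens C c d) m) (Act (full_sub M P) c (Act (full_sub M P) d m))"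
      using assoc P by (simp add: Hom_full_sub)
    show "is_iso (full_sub M P) (MAssoc (full_sub M P) c d m)"
      using M.MAssoc_iso[OF c d m(2)] P HomD[OF assoc] by (simp add: is_iso_full_sub)
    fix b assume b: "b \<in> Obj C"
    show "Comp (full_sub M P) (MAssoc (full_sub M P) b c (Act (full_sub M P) d m))
          (MAssoc (full_sub M P) (Tens C b c) d m) =
        Comp (full_sub M P) (ActA (full_sub M P) (Ident C b) (MAssoc (full_sub M P) c d m))
          (Comp (full_sub M P) (MAssoc (full_sub M P) b (Tens C c d) m)
            (ActA (full_sub M P) (Assoc C b c d) (Ident (full_sub M P) m)))"
      using M.module_pentagon[OF b c d m(2)] by simp
  next
    fix f c d g m n
    assume f: "f \<in> Hom C c d" and "g \<in> Hom (full_sub M P) m n"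
    then have g: "g \<in> Hom M m n" "m \<in> P" "n \<in> P" by (simp_all add: Hom_full_sub)
    show "ActA (full_sub M P) f g \<in> Hom (full_sub M P) (Act (full_sub M P) c m) (Act (full_sub M P) d n)"
      using M.ActA_Hom[OF f g(1)] act M.C.Hom_Obj[OF f] g by (simp add: Hom_full_sub)
  next
    fix m assume "m \<in> Obj (full_sub M P)"
    then have m: "m \<in> P" "m \<in> Obj M" using O by simp_all
    note un = M.MUn_Hom[OF m(2)]
    have P: "Act M (Unit C) m \<in> P" using act M.C.Unit_Obj m by simp
    show "MUn (full_sub M P) m \<in> Hom (full_sub M P) (Act (full_sub M P) (Unit C) m) m"
      using un P m by (simp add: Hom_full_sub)
    show "is_iso (full_sub M P) (MUn (full_sub M P) m)"
      using M.MUn_iso[OF m(2)] P m HomD[OF un] by (simp add: is_iso_full_sub)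
  qed (use M.ActA_Comp M.ActA_Add_left M.ActA_Add_right M.ActA_Scale_left M.ActA_Scale_right
        M.MAssoc_natural M.MUn_natural in \<open>auto simp: Hom_full_sub\<close>)
qed

section \<open>Orthogonal decompositions\<close>

text \<open>
  Families indexed by the two summands are functions on \<open>bool\<close>. Relative to splittings of \<open>x\<close>
  and \<open>y\<close>, an arrow \<open>x \<rightarrow> y\<close> is a diagonal matrix, since \<open>P True\<close> and \<open>P False\<close> are orthogonal;
  all arrows of the equivalence with the direct sum are read off from identities in this way.
\<close>

locale orthogonal_pair = module_category C M
  for C :: "('c, 'f, 'p) mon_cat_scheme" and M :: "('c, 'f, 'o, 'a) mod_cat" (structure) +
  fixes P :: "bool \<Rightarrow> 'o set"
  assumes closed: "closed_subset M (P \<beta>)"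
    and act_closed: "\<lbrakk>c \<in> Obj C; x \<in> P \<beta>\<rbrakk> \<Longrightarrow> c \<triangleright>\<^sub>o x \<in> P \<beta>"
    and orthogonal: "\<lbrakk>f \<in> Hom M x y; x \<in> P \<beta>; y \<in> P (\<not> \<beta>)\<rbrakk> \<Longrightarrow> f = Zero M x y"
begin

text \<open>A biproduct decomposition of \<open>x\<close> with one summand from each block. The
  vanishing of the mixed composites \<open>v (\<not> \<beta>) \<cdot> u \<beta>\<close> is not
  recorded because orthogonality supplies it.\<close>

definition splits :: "'o \<Rightarrow> (bool \<Rightarrow> 'o) \<Rightarrow> (bool \<Rightarrow> 'a) \<Rightarrow> (bool \<Rightarrow> 'a) \<Rightarrow> bool" where
  "splits x A u v \<longleftrightarrow> x \<in> Obj M \<and>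
     (\<forall>\<beta>. A \<beta> \<in> P \<beta> \<and> u \<beta> \<in> Hom M (A \<beta>) x \<and> v \<beta> \<in> Hom M x (A \<beta>) \<and> v \<beta> \<cdot> u \<beta> = Ident M (A \<beta>)) \<and>
     Add M (u True \<cdot> v True) (u False \<cdot> v False) = Ident M x"

text \<open>The projections \<open>v\<close> belong to the target of \<open>h\<close> and the
  inclusions \<open>u\<close> to its source.\<close>

definition entry :: "(bool \<Rightarrow> 'a) \<Rightarrow> (bool \<Rightarrow> 'a) \<Rightarrow> 'a \<Rightarrow> bool \<Rightarrow> 'a" where
  "entry v u h \<beta> = v \<beta> \<cdot> (h \<cdot> u \<beta>)"

definition glue :: "(bool \<Rightarrow> 'a) \<Rightarrow> (bool \<Rightarrow> 'a) \<Rightarrow> (bool \<Rightarrow> 'a) \<Rightarrow> 'a" where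
  "glue u v f = Add M (u True \<cdot> (f True \<cdot> v True)) (u False \<cdot> (f False \<cdot> v False))"

lemma P_Obj: "x \<in> P \<beta> \<Longrightarrow> x \<in> Obj M"
  using closed_subset.subset_Obj[OF closed] by blast

lemma splitsD:
  assumes "splits x A u v"
  shows "x \<in> Obj M" "A \<beta> \<in> P \<beta>" "u \<beta> \<in> Hom M (A \<beta>) x" "v \<beta> \<in> Hom M x (A \<beta>)"
    "v \<beta> \<cdot> u \<beta> = Ident M (A \<beta>)" "Add M (u True \<cdot> v True) (u False \<cdot> v False) = Ident M x"
  using assms by (simp_all add: splits_def)

lemma splits_sum:
  assumes "splits x A u v"
  shows "Add M (u \<beta> \<cdot> v \<beta>) (u (\<not> \<beta>) \<cdot> v (\<not> \<beta>)) = Ident M x"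
proof -
  have "u \<gamma> \<cdot> v \<gamma> \<in> Hom M x x" for \<gamma> using M.Comp_Hom splitsD[OF assms] by blast
  then show ?thesis
    using splitsD(6)[OF assms] M.Add_commute[of "u True \<cdot> v True" x x "u False \<cdot> v False"]
    by (cases \<beta>) auto
qed

text \<open>The component of \<open>h\<close> in the other block is an arrow between orthogonal
  objects, hence zero, so only the \<open>\<beta>\<close> term of the decomposed identity
  survives.\<close>

lemma splits_absorb:
  assumes s: "splits x A u v" and h: "h \<in> Hom M a x" and a: "a \<in> P \<beta>"
  shows "u \<beta> \<cdot> (v \<beta> \<cdot> h) = h"
proof -
  note D = splitsD[OF s]
  have uv: "u \<gamma> \<cdot> v \<gamma> \<in> Hom M x x" for \<gamma> using M.Comp_Hom D by blast
  have "v (\<not> \<beta>) \<cdot> h = Zero M a (A (\<not> \<beta>))"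
    using orthogonal[OF M.Comp_Hom[OF h D(4)] a D(2)] .
  then have "u (\<not> \<beta>) \<cdot> (v (\<not> \<beta>) \<cdot> h) = Zero M a x"
    using M.Comp_Zero_right[OF D(3) P_Obj[OF a]] by simp
  then have "Add M (u \<beta> \<cdot> v \<beta>) (u (\<not> \<beta>) \<cdot> v (\<not> \<beta>)) \<cdot> h = u \<beta> \<cdot> (v \<beta> \<cdot> h)"
    using M.Comp_Add_left[OF h uv uv, of \<beta> "\<not> \<beta>"] M.Comp_assoc[OF h D(4) D(3)]
      M.Add_Zero_right[OF M.Comp_Hom[OF M.Comp_Hom[OF h D(4)] D(3)]] by simp
  then show ?thesis
    using splits_sum[OF s] M.Comp_Ident_left[OF h] by simp
qed

lemma entry_Hom:
  assumes "splits x A u v" "splits x' A' u' v'" "h \<in> Hom M x x'"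
  shows "entry v' u h \<beta> \<in> Hom M (A \<beta>) (A' \<beta>)"
  unfolding entry_def using M.Comp_Hom splitsD assms by meson

lemma entry_Comp:
  assumes s: "splits x A u v" and s': "splits x' A' u' v'" and s'': "splits x'' A'' u'' v''"
    and h: "h \<in> Hom M x x'" and g: "g \<in> Hom M x' x''"
  shows "entry v'' u (g \<cdot> h) \<beta> = entry v'' u' g \<beta> \<cdot> entry v' u h \<beta>"
proof -
  note D = splitsD[OF s] and D' = splitsD[OF s'] and D'' = splitsD[OF s'']
  have hu: "h \<cdot> u \<beta> \<in> Hom M (A \<beta>) x'" by (rule M.Comp_Hom[OF D(3) h])
  have vhu: "v' \<beta> \<cdot> (h \<cdot> u \<beta>) \<in> Hom M (A \<beta>) (A' \<beta>)" by (rule M.Comp_Hom[OF hu D'(4)])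
  have "(v'' \<beta> \<cdot> (g \<cdot> u' \<beta>)) \<cdot> (v' \<beta> \<cdot> (h \<cdot> u \<beta>)) = v'' \<beta> \<cdot> (g \<cdot> (u' \<beta> \<cdot> (v' \<beta> \<cdot> (h \<cdot> u \<beta>))))"
    using M.Comp_assoc[OF vhu M.Comp_Hom[OF D'(3) g] D''(4)] M.Comp_assoc[OF vhu D'(3) g] by simp
  also have "u' \<beta> \<cdot> (v' \<beta> \<cdot> (h \<cdot> u \<beta>)) = h \<cdot> u \<beta>"
    by (rule splits_absorb[OF s' hu D(2)])
  finally show ?thesis
    unfolding entry_def using M.Comp_assoc[OF D(3) h g] by simp
qed

lemma entry_Ident:
  assumes "splits x A u v"
  shows "entry v u (Ident M x) \<beta> = Ident M (A \<beta>)"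
  unfolding entry_def using M.Comp_Ident_left[OF splitsD(3)[OF assms]] splitsD(5)[OF assms] by simp

lemma entry_Add:
  assumes "splits x A u v" "splits x' A' u' v'" "g \<in> Hom M x x'" "h \<in> Hom M x x'"
  shows "entry v' u (Add M g h) \<beta> = Add M (entry v' u g \<beta>) (entry v' u h \<beta>)"
  unfolding entry_def
  using M.Comp_Add_left[OF splitsD(3)[OF assms(1)] assms(3,4)]
    M.Comp_Add_right[OF M.Comp_Hom M.Comp_Hom splitsD(4)[OF assms(2)],
      OF splitsD(3)[OF assms(1)] assms(3) splitsD(3)[OF assms(1)] assms(4)] by simp

lemma entry_Scale:
  assumes "splits x A u v" "splits x' A' u' v'" "h \<in> Hom M x x'"
  shows "entry v' u (Scale M k h) \<beta> = Scale M k (entry v' u h \<beta>)"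
  unfolding entry_def
  using M.Comp_Scale_left[OF splitsD(3)[OF assms(1)] assms(3)]
    M.Comp_Scale_right[OF M.Comp_Hom splitsD(4)[OF assms(2)],
      OF splitsD(3)[OF assms(1)] assms(3)] by simp

text \<open>An arrow is determined by its restrictions to the two summands, and absorption recovers
  each restriction from the entry. Equations involving \<open>glue\<close> are verified by this
  test.\<close>

lemma eq_if_entries:
  assumes s: "splits x A u v" and s': "splits x' A' u' v'"
    and h: "h \<in> Hom M x x'" and h': "h' \<in> Hom M x x'"
    and eq: "\<And>\<beta>. entry v' u h \<beta> = entry v' u h' \<beta>"
  shows "h = h'"
proof -
  note D = splitsD[OF s]
  have uv: "u \<gamma> \<cdot> v \<gamma> \<in> Hom M x x" for \<gamma> using M.Comp_Hom D by blast
  have hu: "h \<cdot> u \<beta> = h' \<cdot> u \<beta>" for \<beta>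
    using splits_absorb[OF s' M.Comp_Hom[OF D(3) h] D(2), of \<beta>]
      splits_absorb[OF s' M.Comp_Hom[OF D(3) h'] D(2), of \<beta>] eq[of \<beta>]
    unfolding entry_def by metis
  have "g = Add M ((g \<cdot> u True) \<cdot> v True) ((g \<cdot> u False) \<cdot> v False)" if g: "g \<in> Hom M x x'" for g
    using M.Comp_Add_right[OF uv uv g, of True False] D(6) M.Comp_Ident_right[OF g]
      M.Comp_assoc[OF D(4) D(3) g] by simp
  from this[OF h] this[OF h'] show ?thesis using hu by simp
qed

lemma glue_Hom:
  assumes "splits x A u v" "splits x' A' u' v'" "\<And>\<beta>. f \<beta> \<in> Hom M (A \<beta>) (A' \<beta>)"
  shows "glue u' v f \<in> Hom M x x'"
proof -
  have "u' \<beta> \<cdot> (f \<beta> \<cdot> v \<beta>) \<in> Hom M x x'" for \<beta>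
    by (rule M.Comp_Hom[OF M.Comp_Hom[OF splitsD(4)[OF assms(1)] assms(3)] splitsD(3)[OF assms(2)]])
  then show ?thesis unfolding glue_def by (intro M.Add_Hom)
qed

text \<open>Only the \<open>\<beta>\<close> term of \<open>glue\<close> survives on
  \<open>u \<beta>\<close>; the other one passes through an arrow between orthogonal
  objects.\<close>

lemma entry_glue:
  assumes s: "splits x A u v" and s': "splits x' A' u' v'" and f: "\<And>\<beta>. f \<beta> \<in> Hom M (A \<beta>) (A' \<beta>)"
  shows "entry v' u (glue u' v f) \<beta> = f \<beta>"
proof -
  note D = splitsD[OF s] and D' = splitsD[OF s']
  have fv: "f \<gamma> \<cdot> v \<gamma> \<in> Hom M x (A' \<gamma>)" for \<gamma>
    by (rule M.Comp_Hom[OF D(4) f])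
  have T: "u' \<gamma> \<cdot> (f \<gamma> \<cdot> v \<gamma>) \<in> Hom M x x'" for \<gamma>
    by (rule M.Comp_Hom[OF fv D'(3)])
  have assoc: "(u' \<gamma> \<cdot> (f \<gamma> \<cdot> v \<gamma>)) \<cdot> u \<beta> = u' \<gamma> \<cdot> (f \<gamma> \<cdot> (v \<gamma> \<cdot> u \<beta>))" for \<gamma>
    using M.Comp_assoc[OF D(3) fv D'(3)] M.Comp_assoc[OF D(3) D(4) f] by simp
  have same: "(u' \<beta> \<cdot> (f \<beta> \<cdot> v \<beta>)) \<cdot> u \<beta> = u' \<beta> \<cdot> f \<beta>"
    using assoc D(5) M.Comp_Ident_right[OF f] by simp
  have "v (\<not> \<beta>) \<cdot> u \<beta> = Zero M (A \<beta>) (A (\<not> \<beta>))"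
    using orthogonal[OF M.Comp_Hom[OF D(3,4)] D(2) D(2)] .
  then have other: "(u' (\<not> \<beta>) \<cdot> (f (\<not> \<beta>) \<cdot> v (\<not> \<beta>))) \<cdot> u \<beta> = Zero M (A \<beta>) x'"
    using assoc M.Comp_Zero_right[OF f P_Obj[OF D(2)]] M.Comp_Zero_right[OF D'(3) P_Obj[OF D(2)]] by simp
  have "glue u' v f = Add M (u' \<beta> \<cdot> (f \<beta> \<cdot> v \<beta>)) (u' (\<not> \<beta>) \<cdot> (f (\<not> \<beta>) \<cdot> v (\<not> \<beta>)))"
    unfolding glue_def using M.Add_commute[OF T T, of True False] by (cases \<beta>) auto
  then have "glue u' v f \<cdot> u \<beta> = u' \<beta> \<cdot> f \<beta>"
    using M.Comp_Add_left[OF D(3) T T] same other M.Add_Zero_right[OF M.Comp_Hom[OF f D'(3)]] by simp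
  then show ?thesis
    unfolding entry_def
    using M.Comp_assoc[OF f D'(3) D'(4), symmetric] D'(5) M.Comp_Ident_left[OF f] by simp
qed

text \<open>Acting with a fixed object is an additive functor, so it preserves biproducts, and it
  preserves both blocks.\<close>

lemma splits_Act:
  assumes s: "splits x A u v" and c: "c \<in> Obj C"
  shows "splits (c \<triangleright>\<^sub>o x) (\<lambda>\<beta>. c \<triangleright>\<^sub>o A \<beta>) (\<lambda>\<beta>. Ident C c \<triangleright>\<^sub>a u \<beta>) (\<lambda>\<beta>. Ident C c \<triangleright>\<^sub>a v \<beta>)"
proof -
  note D = splitsD[OF s]
  have I: "Ident C c \<in> Hom C c c" by (rule C.Ident_Hom[OF c])
  have II: "Ident C c \<cdot>\<^bsub>C\<^esub> Ident C c = Ident C c" by (rule C.Comp_Ident_left[OF I])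
  have uv: "u \<gamma> \<cdot> v \<gamma> \<in> Hom M x x" for \<gamma> using M.Comp_Hom D by blast
  have vu: "(Ident C c \<triangleright>\<^sub>a v \<beta>) \<cdot> (Ident C c \<triangleright>\<^sub>a u \<beta>) = Ident M (c \<triangleright>\<^sub>o A \<beta>)" for \<beta>
    using ActA_Comp[OF I I D(3) D(4), of \<beta> \<beta>] II D(5)[of \<beta>] ActA_Ident[OF c P_Obj[OF D(2)], of \<beta>]
    by simp
  have "(Ident C c \<triangleright>\<^sub>a u \<beta>) \<cdot> (Ident C c \<triangleright>\<^sub>a v \<beta>) = Ident C c \<triangleright>\<^sub>a (u \<beta> \<cdot> v \<beta>)" for \<beta>
    using ActA_Comp[OF I I D(4) D(3)] II by simp
  then have "Add M ((Ident C c \<triangleright>\<^sub>a u True) \<cdot> (Ident C c \<triangleright>\<^sub>a v True))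
      ((Ident C c \<triangleright>\<^sub>a u False) \<cdot> (Ident C c \<triangleright>\<^sub>a v False)) = Ident M (c \<triangleright>\<^sub>o x)"
    using ActA_Add_right[OF I uv uv, of True False] D(6) ActA_Ident[OF c D(1)] by simp
  then show ?thesis
    unfolding splits_def using vu act_closed[OF c D(2)] Act_Obj[OF c D(1)] ActA_Hom[OF I D(3)] ActA_Hom[OF I D(4)]
    by blast
qed

lemma entry_ActA:
  assumes s: "splits x A u v" and s': "splits x' A' u' v'" and h: "h \<in> Hom M x x'" and f: "f \<in> Hom C c d"
  shows "entry (\<lambda>\<beta>. Ident C d \<triangleright>\<^sub>a v' \<beta>) (\<lambda>\<beta>. Ident C c \<triangleright>\<^sub>a u \<beta>) (f \<triangleright>\<^sub>a h) \<beta> = f \<triangleright>\<^sub>a entry v' u h \<beta>"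
proof -
  note u = splitsD(3)[OF s, of \<beta>] and v = splitsD(4)[OF s', of \<beta>]
  have I: "Ident C c \<in> Hom C c c" "Ident C d \<in> Hom C d d"
    using C.Ident_Hom C.Hom_Obj[OF f] by blast+
  show ?thesis
    unfolding entry_def
    using ActA_Comp[OF I(1) f u h] ActA_Comp[OF f I(2) M.Comp_Hom[OF u h] v]
      C.Comp_Ident_right[OF f] C.Comp_Ident_left[OF f] by simp
qed

lemma splits_from_summands:
  assumes A: "\<And>\<beta>. A \<beta> \<in> P \<beta>"
  shows "\<exists>x u v. splits x A u v"
proof -
  \<comment> \<open>Direct sums are indexed by initial segments of the naturals: index 0 carries
    \<open>True\<close>, index 1 carries \<open>False\<close>, and \<open>k\<close> below translates
    back.\<close>
  define X where "X = (\<lambda>n::nat. A (n = 0))"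
  have XO: "\<And>n. X n \<in> Obj M" unfolding X_def using P_Obj[OF A] .
  obtain s inc pr where s: "is_direct_sum M 2 X s inc pr"
    using M.direct_sums[of 2 X] XO by blast
  have sO: "s \<in> Obj M" using s by (simp add: is_direct_sum_def)
  have H: "inc n \<in> Hom M (X n) s" "pr n \<in> Hom M s (X n)" "pr n \<cdot> inc n = Ident M (X n)" if "n < 2" for n
    using s that by (simp_all add: is_direct_sum_def)
  have IP: "inc n \<cdot> pr n \<in> Hom M s s" if "n < 2" for n
    using M.Comp_Hom H that by blast
  have "finsum (hom_space M s s) (\<lambda>n. inc n \<cdot> pr n) {..<2} = Add M (inc 0 \<cdot> pr 0) (inc 1 \<cdot> pr 1)"
  proof -
    have two: "{..<2} = insert 0 (insert (1::nat) {})" by auto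
    show ?thesis
      unfolding two using IP sO
      by (subst M.finsum_insert, simp, simp, simp, simp, force)
        (subst M.finsum_insert, auto simp: M.finsum_empty M.Add_Zero_right[OF IP])
  qed
  then have sum: "Add M (inc 0 \<cdot> pr 0) (inc 1 \<cdot> pr 1) = Ident M s"
    using s by (simp add: is_direct_sum_def)
  define k where "k = (\<lambda>\<beta>. if \<beta> then 0 else 1::nat)"
  have k: "k \<beta> < 2" "X (k \<beta>) = A \<beta>" for \<beta> by (auto simp: k_def X_def)
  have "splits s A (\<lambda>\<beta>. inc (k \<beta>)) (\<lambda>\<beta>. pr (k \<beta>))"
    unfolding splits_def using sO A H[OF k(1)] sum by (simp add: k(2)) (simp add: k_def)
  then show ?thesis by blast
qed

end

section \<open>Direct sums of module categories\<close>

lemma Hom_mod_cat_sum: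
  "f \<in> Hom (mod_cat_sum M N) x y \<longleftrightarrow> fst f \<in> Hom M (fst x) (fst y) \<and> snd f \<in> Hom N (snd x) (snd y)"
  by (auto simp: Hom_def mod_cat_sum_def mem_Times_iff prod_eq_iff)

lemma mod_cat_sum_simps:
  "x \<in> Obj (mod_cat_sum M N) \<longleftrightarrow> fst x \<in> Obj M \<and> snd x \<in> Obj N"
  "f \<in> Arr (mod_cat_sum M N) \<longleftrightarrow> fst f \<in> Arr M \<and> snd f \<in> Arr N"
  "Dom (mod_cat_sum M N) f = (Dom M (fst f), Dom N (snd f))"
  "Cod (mod_cat_sum M N) f = (Cod M (fst f), Cod N (snd f))"
  "Ident (mod_cat_sum M N) x = (Ident M (fst x), Ident N (snd x))"
  "Comp (mod_cat_sum M N) g f = (Comp M (fst g) (fst f), Comp N (snd g) (snd f))"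
  "Add (mod_cat_sum M N) g f = (Add M (fst g) (fst f), Add N (snd g) (snd f))"
  "Scale (mod_cat_sum M N) k f = (Scale M k (fst f), Scale N k (snd f))"
  "Act (mod_cat_sum M N) c x = (Act M c (fst x), Act N c (snd x))"
  "ActA (mod_cat_sum M N) e f = (ActA M e (fst f), ActA N e (snd f))"
  "MAssoc (mod_cat_sum M N) c d x = (MAssoc M c d (fst x), MAssoc N c d (snd x))"
  "MUn (mod_cat_sum M N) x = (MUn M (fst x), MUn N (snd x))"
  by (simp_all add: mod_cat_sum_def mem_Times_iff map_prod_def split_beta)

lemma is_iso_mod_cat_sum:
  "is_iso (mod_cat_sum M N) f \<longleftrightarrow> is_iso M (fst f) \<and> is_iso N (snd f)"
  unfolding is_iso_def is_inverse_def
  by (auto simp: mod_cat_sum_simps Hom_mod_cat_sum)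

context orthogonal_pair
begin

text \<open>Arrows of the sum category are pairs, while blocks are functions on \<open>bool\<close>;
  translating between the two lets one statement about \<open>\<beta>\<close> cover both
  components.\<close>

definition to_pair :: "(bool \<Rightarrow> 'b) \<Rightarrow> 'b \<times> 'b" where
  "to_pair f = (f True, f False)"

definition of_pair :: "'b \<times> 'b \<Rightarrow> bool \<Rightarrow> 'b" where
  "of_pair y \<beta> = (if \<beta> then fst y else snd y)"

abbreviation sum_cat :: "('c, 'f, 'o \<times> 'o, 'a \<times> 'a) mod_cat" where
  "sum_cat \<equiv> mod_cat_sum (full_sub M (P True)) (full_sub M (P False))"

lemma pair_simps [simp]:
  "fst (to_pair f) = f True" "snd (to_pair f) = f False" "of_pair (to_pair f) = f"
  "to_pair (of_pair y) = y" "of_pair (a, b) True = a" "of_pair (a, b) False = b"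
  by (auto simp: to_pair_def of_pair_def)

lemma to_pair_eq_iff: "to_pair f = to_pair g \<longleftrightarrow> (\<forall>\<beta>. f \<beta> = g \<beta>)"
  by (auto simp: to_pair_def all_bool_eq)

lemma sum_cat_Obj: "y \<in> Obj sum_cat \<longleftrightarrow> (\<forall>\<beta>. of_pair y \<beta> \<in> P \<beta>)"
  by (auto simp: mod_cat_sum_simps of_pair_def all_bool_eq)

lemma sum_cat_Hom:
  "f \<in> Hom sum_cat x y \<longleftrightarrow>
    (\<forall>\<beta>. of_pair f \<beta> \<in> Hom M (of_pair x \<beta>) (of_pair y \<beta>) \<and> of_pair x \<beta> \<in> P \<beta> \<and> of_pair y \<beta> \<in> P \<beta>)"
  by (auto simp: Hom_mod_cat_sum Hom_full_sub of_pair_def all_bool_eq)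

lemma sum_cat_ops:
  "Ident sum_cat y = to_pair (\<lambda>\<beta>. Ident M (of_pair y \<beta>))"
  "Comp sum_cat g f = to_pair (\<lambda>\<beta>. of_pair g \<beta> \<cdot> of_pair f \<beta>)"
  "Add sum_cat g f = to_pair (\<lambda>\<beta>. Add M (of_pair g \<beta>) (of_pair f \<beta>))"
  "Scale sum_cat k f = to_pair (\<lambda>\<beta>. Scale M k (of_pair f \<beta>))"
  "Act sum_cat c y = to_pair (\<lambda>\<beta>. c \<triangleright>\<^sub>o of_pair y \<beta>)"
  "ActA sum_cat e f = to_pair (\<lambda>\<beta>. e \<triangleright>\<^sub>a of_pair f \<beta>)"
  "MAssoc sum_cat c d y = to_pair (\<lambda>\<beta>. MAssoc M c d (of_pair y \<beta>))"
  "MUn sum_cat y = to_pair (\<lambda>\<beta>. MUn M (of_pair y \<beta>))"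
  by (simp_all add: mod_cat_sum_simps to_pair_def of_pair_def)

lemma sum_cat_iso:
  assumes "\<And>\<beta>. f \<beta> \<in> Hom M (A \<beta>) (B \<beta>)" "\<And>\<beta>. A \<beta> \<in> P \<beta>" "\<And>\<beta>. B \<beta> \<in> P \<beta>" "\<And>\<beta>. is_iso M (f \<beta>)"
  shows "is_iso sum_cat (to_pair f)"
  using assms HomD[OF assms(1)] by (simp add: is_iso_mod_cat_sum is_iso_full_sub)

text \<open>By multiplicativity, the entries of an inverse are inverse to the entries.\<close>

lemma entry_iso:
  assumes s: "splits x A u v" and s': "splits x' A' u' v'" and h: "h \<in> Hom M x x'" and "is_iso M h"
  shows "is_iso M (entry v' u h \<beta>)"
proof -
  obtain g where g: "g \<in> Hom M x' x" "g \<cdot> h = Ident M x" "h \<cdot> g = Ident M x'"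
    using M.is_isoE[OF assms(4) h] by metis
  show ?thesis
    using M.is_isoI[OF entry_Hom[OF s s' h] entry_Hom[OF s' s g(1)]]
      entry_Comp[OF s s' s h g(1), of \<beta>] entry_Comp[OF s' s s' g(1) h, of \<beta>] g(2,3)
      entry_Ident[OF s] entry_Ident[OF s'] by metis
qed

lemma glue_iso:
  assumes s: "splits x A u v" and s': "splits x' A' u' v'" and f: "\<And>\<beta>. f \<beta> \<in> Hom M (A \<beta>) (A' \<beta>)"
    and iso: "\<And>\<beta>. is_iso M (f \<beta>)"
  shows "is_iso M (glue u' v f)"
proof -
  have "\<exists>g. g \<in> Hom M (A' \<beta>) (A \<beta>) \<and> g \<cdot> f \<beta> = Ident M (A \<beta>) \<and> f \<beta> \<cdot> g = Ident M (A' \<beta>)" for \<beta>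
    using M.is_isoE[OF iso f] by metis
  then obtain g where g: "\<And>\<beta>. g \<beta> \<in> Hom M (A' \<beta>) (A \<beta>)"
      "\<And>\<beta>. g \<beta> \<cdot> f \<beta> = Ident M (A \<beta>)" "\<And>\<beta>. f \<beta> \<cdot> g \<beta> = Ident M (A' \<beta>)" by metis
  have F: "glue u' v f \<in> Hom M x x'" and G: "glue u v' g \<in> Hom M x' x"
    by (rule glue_Hom[OF s s' f]) (rule glue_Hom[OF s' s g(1)])
  note O = splitsD(1)[OF s] splitsD(1)[OF s']
  show ?thesis
  proof (rule M.is_isoI[OF F G])
    show "glue u v' g \<cdot> glue u' v f = Ident M x"
      by (rule eq_if_entries[OF s s M.Comp_Hom[OF F G] M.Ident_Hom[OF O(1)]])
        (simp add: entry_Comp[OF s s' s F G] entry_glue[OF s s' f] entry_glue[OF s' s g(1)] g(2)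
          entry_Ident[OF s])
    show "glue u' v f \<cdot> glue u v' g = Ident M x'"
      by (rule eq_if_entries[OF s' s' M.Comp_Hom[OF G F] M.Ident_Hom[OF O(2)]])
        (simp add: entry_Comp[OF s' s s' G F] entry_glue[OF s s' f] entry_glue[OF s' s g(1)] g(3)
          entry_Ident[OF s'])
  qed
qed

end

text \<open>All choices behind the equivalence: a splitting of every object of \<open>M\<close> for
  the functor \<open>F\<close>, and a direct sum of every pair of objects for its quasi-inverse
  \<open>G\<close>. The two are unrelated, so the composites are only shown to be isomorphic to the
  identities.\<close>

locale chosen_splittings = orthogonal_pair C M P
  for C :: "('c, 'f, 'p) mon_cat_scheme" and M :: "('c, 'f, 'o, 'a) mod_cat" (structure) and P +
  fixes A :: "'o \<Rightarrow> bool \<Rightarrow> 'o" and u v :: "'o \<Rightarrow> bool \<Rightarrow> 'a"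
    and S :: "'o \<times> 'o \<Rightarrow> 'o" and j q :: "'o \<times> 'o \<Rightarrow> bool \<Rightarrow> 'a"
  assumes splits: "x \<in> Obj M \<Longrightarrow> splits x (A x) (u x) (v x)"
    and splits_pair: "y \<in> Obj sum_cat \<Longrightarrow> splits (S y) (of_pair y) (j y) (q y)"
begin

definition F_obj :: "'o \<Rightarrow> 'o \<times> 'o" where
  "F_obj x = to_pair (A x)"

definition F_arr :: "'a \<Rightarrow> 'a \<times> 'a" where
  "F_arr f = to_pair (entry (v (Cod M f)) (u (Dom M f)) f)"

text \<open>The object \<open>c \<triangleright>\<^sub>o x\<close> carries two splittings, its
  chosen one and the one obtained by acting on that of \<open>x\<close>. Reading its identity
  against these two compares their summands.\<close>

definition F_mod :: "'c \<Rightarrow> 'o \<Rightarrow> 'a \<times> 'a" where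
  "F_mod c x = to_pair (entry (\<lambda>\<beta>. Ident C c \<triangleright>\<^sub>a v x \<beta>) (u (c \<triangleright>\<^sub>o x)) (Ident M (c \<triangleright>\<^sub>o x)))"

definition G_arr :: "'a \<times> 'a \<Rightarrow> 'a" where
  "G_arr f = glue (j (Cod sum_cat f)) (q (Dom sum_cat f)) (of_pair f)"

lemma F_obj: "x \<in> Obj M \<Longrightarrow> F_obj x \<in> Obj sum_cat"
  using splitsD(2)[OF splits] by (simp add: sum_cat_Obj F_obj_def)

lemma F_arr_eq: "f \<in> Hom M x y \<Longrightarrow> F_arr f = to_pair (entry (v y) (u x) f)"
  by (simp add: F_arr_def HomD)

lemma F_arr_Hom:
  assumes f: "f \<in> Hom M x y"
  shows "F_arr f \<in> Hom sum_cat (F_obj x) (F_obj y)"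
proof -
  note s = splits[OF M.Hom_Obj(1)[OF f]] splits[OF M.Hom_Obj(2)[OF f]]
  show ?thesis
    using entry_Hom[OF s f] splitsD(2)[OF s(1)] splitsD(2)[OF s(2)]
    by (simp add: sum_cat_Hom F_arr_eq[OF f] F_obj_def)
qed

lemma F_linear: "is_linear_functor M sum_cat F_obj F_arr"
  unfolding is_linear_functor_def
proof (intro conjI ballI allI)
  fix x assume x: "x \<in> Obj M"
  show "F_obj x \<in> Obj sum_cat" by (rule F_obj[OF x])
  show "F_arr (Ident M x) = Ident sum_cat (F_obj x)"
    by (simp add: F_arr_eq[OF M.Ident_Hom[OF x]] sum_cat_ops F_obj_def to_pair_eq_iff
        entry_Ident[OF splits[OF x]])
next
  fix x y f assume "f \<in> Hom M x y"
  then show "F_arr f \<in> Hom sum_cat (F_obj x) (F_obj y)" by (rule F_arr_Hom)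
next
  fix x y z f g assume f: "f \<in> Hom M x y" and g: "g \<in> Hom M y z"
  note s = splits[OF M.Hom_Obj(1)[OF f]] splits[OF M.Hom_Obj(2)[OF f]] splits[OF M.Hom_Obj(2)[OF g]]
  show "F_arr (g \<cdot> f) = Comp sum_cat (F_arr g) (F_arr f)"
    by (simp add: F_arr_eq[OF f] F_arr_eq[OF g] F_arr_eq[OF M.Comp_Hom[OF f g]] sum_cat_ops
        to_pair_eq_iff entry_Comp[OF s f g])
next
  fix x y f g assume f: "f \<in> Hom M x y" and g: "g \<in> Hom M x y"
  note s = splits[OF M.Hom_Obj(1)[OF f]] splits[OF M.Hom_Obj(2)[OF f]]
  show "F_arr (Add M f g) = Add sum_cat (F_arr f) (F_arr g)"
    by (simp add: F_arr_eq[OF f] F_arr_eq[OF g] F_arr_eq[OF M.Add_Hom[OF f g]] sum_cat_ops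
        to_pair_eq_iff entry_Add[OF s f g])
next
  fix k f assume "f \<in> Arr M"
  then have f: "f \<in> Hom M (Dom M f) (Cod M f)" by (simp add: Hom_def)
  note s = splits[OF M.Hom_Obj(1)[OF f]] splits[OF M.Hom_Obj(2)[OF f]]
  show "F_arr (Scale M k f) = Scale sum_cat k (F_arr f)"
    by (simp add: F_arr_eq[OF f] F_arr_eq[OF M.Scale_Hom[OF f]] sum_cat_ops
        to_pair_eq_iff entry_Scale[OF s f])
qed

lemma F_mod_Hom:
  assumes c: "c \<in> Obj C" and x: "x \<in> Obj M"
  shows "entry (\<lambda>\<beta>. Ident C c \<triangleright>\<^sub>a v x \<beta>) (u (c \<triangleright>\<^sub>o x)) (Ident M (c \<triangleright>\<^sub>o x)) \<beta>
      \<in> Hom M (A (c \<triangleright>\<^sub>o x) \<beta>) (c \<triangleright>\<^sub>o A x \<beta>)"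
  by (rule entry_Hom[OF splits splits_Act[OF splits] M.Ident_Hom]) (simp_all add: Act_Obj c x)

text \<open>Each coherence equation holds because both sides are the entry of one and the same arrow
  of \<open>M\<close>, read against the same splittings of its ends.\<close>

lemma F_module_functor: "is_module_functor C M sum_cat F_obj F_arr F_mod"
  unfolding is_module_functor_def
proof (intro conjI ballI allI)
  show "is_linear_functor M sum_cat F_obj F_arr" by (rule F_linear)
next
  fix c x assume c: "c \<in> Obj C" and x: "x \<in> Obj M"
  note cx = Act_Obj[OF c x]
  note s = splits[OF cx] splits_Act[OF splits[OF x] c]
  have AP: "A (c \<triangleright>\<^sub>o x) \<beta> \<in> P \<beta>" "c \<triangleright>\<^sub>o A x \<beta> \<in> P \<beta>" for \<beta>
    using splitsD(2)[OF s(1)] splitsD(2)[OF s(2)] by simp_all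
  show "F_mod c x \<in> Hom sum_cat (F_obj (c \<triangleright>\<^sub>o x)) (Act sum_cat c (F_obj x))"
    using F_mod_Hom[OF c x] AP by (simp add: sum_cat_Hom F_mod_def F_obj_def sum_cat_ops)
  have "is_iso M (Ident M (c \<triangleright>\<^sub>o x))"
    using M.Ident_Hom[OF cx] M.is_isoI[OF M.Ident_Hom[OF cx] M.Ident_Hom[OF cx]]
      M.Comp_Ident_left[OF M.Ident_Hom[OF cx]] by simp
  then show "is_iso sum_cat (F_mod c x)"
    unfolding F_mod_def
    by (intro sum_cat_iso[OF F_mod_Hom[OF c x] AP] entry_iso[OF s M.Ident_Hom[OF cx]])
next
  fix c d x y f g assume f: "f \<in> Hom C c d" and g: "g \<in> Hom M x y"
  have c: "c \<in> Obj C" and d: "d \<in> Obj C" using C.Hom_Obj[OF f] by simp_all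
  have x: "x \<in> Obj M" and y: "y \<in> Obj M" using M.Hom_Obj[OF g] by simp_all
  note cx = Act_Obj[OF c x] and dy = Act_Obj[OF d y]
  note fg = ActA_Hom[OF f g]
  note scx = splits[OF cx] and sdy = splits[OF dy]
  note tcx = splits_Act[OF splits[OF x] c] and tdy = splits_Act[OF splits[OF y] d]
  \<comment> \<open>Both sides are the entry of \<open>f \<triangleright>\<^sub>a g\<close> from the
    chosen splitting of \<open>c \<triangleright>\<^sub>o x\<close> to the acted splitting of
    \<open>d \<triangleright>\<^sub>o y\<close>.\<close>
  have "entry (\<lambda>\<beta>. Ident C d \<triangleright>\<^sub>a v y \<beta>) (u (d \<triangleright>\<^sub>o y)) (Ident M (d \<triangleright>\<^sub>o y)) \<beta>
        \<cdot> entry (v (d \<triangleright>\<^sub>o y)) (u (c \<triangleright>\<^sub>o x)) (f \<triangleright>\<^sub>a g) \<beta> =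
      (f \<triangleright>\<^sub>a entry (v y) (u x) g \<beta>)
        \<cdot> entry (\<lambda>\<beta>. Ident C c \<triangleright>\<^sub>a v x \<beta>) (u (c \<triangleright>\<^sub>o x)) (Ident M (c \<triangleright>\<^sub>o x)) \<beta>" for \<beta>
    using entry_Comp[OF scx sdy tdy fg M.Ident_Hom[OF dy], of \<beta>]
      entry_Comp[OF scx tcx tdy M.Ident_Hom[OF cx] fg, of \<beta>]
      entry_ActA[OF splits[OF x] splits[OF y] g f, of \<beta>]
      M.Comp_Ident_left[OF fg] M.Comp_Ident_right[OF fg] by simp
  then show "Comp sum_cat (F_mod d y) (F_arr (f \<triangleright>\<^sub>a g)) = Comp sum_cat (ActA sum_cat f (F_arr g)) (F_mod c x)"
    by (simp add: F_arr_eq[OF g] F_arr_eq[OF fg] F_mod_def sum_cat_ops to_pair_eq_iff)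
next
  fix c d x assume c: "c \<in> Obj C" and d: "d \<in> Obj C" and x: "x \<in> Obj M"
  note cd = C.Tens_Obj[OF c d]
  note dx = Act_Obj[OF d x] and cdx = Act_Obj[OF c Act_Obj[OF d x]] and cdx' = Act_Obj[OF cd x]
  note I = C.Ident_Hom[OF c]
  note a = MAssoc_Hom[OF c d x]
  note s1 = splits[OF cdx'] and s2 = splits[OF cdx] and s3 = splits_Act[OF splits[OF dx] c]
    and s4 = splits_Act[OF splits_Act[OF splits[OF x] d] c] and s5 = splits_Act[OF splits[OF x] cd]
  note Dx = splitsD[OF splits[OF x]]
  \<comment> \<open>By naturality in the module variable, the entries of the associator between
    acted splittings are the associators of the summands.\<close>
  have nat: "entry (\<lambda>\<beta>. Ident C c \<triangleright>\<^sub>a (Ident C d \<triangleright>\<^sub>a v x \<beta>)) (\<lambda>\<beta>. Ident C (c \<otimes>\<^sub>o\<^bsub>C\<^esub> d) \<triangleright>\<^sub>a u x \<beta>)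
      (MAssoc M c d x) \<beta> = MAssoc M c d (A x \<beta>)" for \<beta>
  proof -
    have "MAssoc M c d x \<cdot> (Ident C (c \<otimes>\<^sub>o\<^bsub>C\<^esub> d) \<triangleright>\<^sub>a u x \<beta>)
        = (Ident C c \<triangleright>\<^sub>a (Ident C d \<triangleright>\<^sub>a u x \<beta>)) \<cdot> MAssoc M c d (A x \<beta>)"
      using MAssoc_natural[OF I C.Ident_Hom[OF d] Dx(3)] C.TensA_Ident[OF c d] by simp
    then show ?thesis
      unfolding entry_def
      using M.Comp_assoc[OF MAssoc_Hom[OF c d P_Obj[OF Dx(2)]] splitsD(3)[OF s4] splitsD(4)[OF s4], of \<beta> \<beta>]
        splitsD(5)[OF s4, of \<beta>] M.Comp_Ident_left[OF MAssoc_Hom[OF c d P_Obj[OF Dx(2)]], of \<beta>] by simp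
  qed
  \<comment> \<open>Acting on a comparison of two splittings gives the comparison of the splittings
    acted on by \<open>c\<close>.\<close>
  have act: "Ident C c \<triangleright>\<^sub>a entry (\<lambda>\<beta>. Ident C d \<triangleright>\<^sub>a v x \<beta>) (u (d \<triangleright>\<^sub>o x)) (Ident M (d \<triangleright>\<^sub>o x)) \<beta> =
      entry (\<lambda>\<beta>. Ident C c \<triangleright>\<^sub>a (Ident C d \<triangleright>\<^sub>a v x \<beta>)) (\<lambda>\<beta>. Ident C c \<triangleright>\<^sub>a u (d \<triangleright>\<^sub>o x) \<beta>)
        (Ident M (c \<triangleright>\<^sub>o (d \<triangleright>\<^sub>o x))) \<beta>" for \<beta>
    using entry_ActA[OF splits[OF dx] splits_Act[OF splits[OF x] d] M.Ident_Hom[OF dx] I, of \<beta>]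
      ActA_Ident[OF c dx] by simp
  note Ic = M.Ident_Hom[OF cdx] and Ic' = M.Ident_Hom[OF cdx']
  \<comment> \<open>This path and the next one both yield the entry of the associator from the
    chosen splitting of its source to the splitting of its target obtained by acting twice.\<close>
  have "entry (\<lambda>\<beta>. Ident C c \<triangleright>\<^sub>a (Ident C d \<triangleright>\<^sub>a v x \<beta>)) (\<lambda>\<beta>. Ident C c \<triangleright>\<^sub>a u (d \<triangleright>\<^sub>o x) \<beta>)
        (Ident M (c \<triangleright>\<^sub>o (d \<triangleright>\<^sub>o x))) \<beta>
      \<cdot> (entry (\<lambda>\<beta>. Ident C c \<triangleright>\<^sub>a v (d \<triangleright>\<^sub>o x) \<beta>) (u (c \<triangleright>\<^sub>o (d \<triangleright>\<^sub>o x))) (Ident M (c \<triangleright>\<^sub>o (d \<triangleright>\<^sub>o x))) \<beta>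
      \<cdot> entry (v (c \<triangleright>\<^sub>o (d \<triangleright>\<^sub>o x))) (u ((c \<otimes>\<^sub>o\<^bsub>C\<^esub> d) \<triangleright>\<^sub>o x)) (MAssoc M c d x) \<beta>) =
      entry (\<lambda>\<beta>. Ident C c \<triangleright>\<^sub>a (Ident C d \<triangleright>\<^sub>a v x \<beta>)) (u ((c \<otimes>\<^sub>o\<^bsub>C\<^esub> d) \<triangleright>\<^sub>o x)) (MAssoc M c d x) \<beta>" for \<beta>
    using entry_Comp[OF s1 s3 s4 a Ic, of \<beta>] entry_Comp[OF s1 s2 s3 a Ic, of \<beta>]
      M.Comp_Ident_left[OF a] by simp
  moreover have "MAssoc M c d (A x \<beta>)
      \<cdot> entry (\<lambda>\<beta>. Ident C (c \<otimes>\<^sub>o\<^bsub>C\<^esub> d) \<triangleright>\<^sub>a v x \<beta>) (u ((c \<otimes>\<^sub>o\<^bsub>C\<^esub> d) \<triangleright>\<^sub>o x)) (Ident M ((c \<otimes>\<^sub>o\<^bsub>C\<^esub> d) \<triangleright>\<^sub>o x)) \<beta> =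
      entry (\<lambda>\<beta>. Ident C c \<triangleright>\<^sub>a (Ident C d \<triangleright>\<^sub>a v x \<beta>)) (u ((c \<otimes>\<^sub>o\<^bsub>C\<^esub> d) \<triangleright>\<^sub>o x)) (MAssoc M c d x) \<beta>" for \<beta>
    using entry_Comp[OF s1 s5 s4 Ic' a, of \<beta>] nat[of \<beta>] M.Comp_Ident_right[OF a] by simp
  ultimately show "Comp sum_cat (ActA sum_cat (Ident C c) (F_mod d x))
        (Comp sum_cat (F_mod c (d \<triangleright>\<^sub>o x)) (F_arr (MAssoc M c d x))) =
      Comp sum_cat (MAssoc sum_cat c d (F_obj x)) (F_mod (c \<otimes>\<^sub>o\<^bsub>C\<^esub> d) x)"
    by (simp add: F_arr_eq[OF a] F_mod_def F_obj_def sum_cat_ops to_pair_eq_iff act)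
next
  fix x assume x: "x \<in> Obj M"
  note ux = Act_Obj[OF C.Unit_Obj x]
  note s1 = splits[OF ux] and s2 = splits_Act[OF splits[OF x] C.Unit_Obj] and s3 = splits[OF x]
  note D = splitsD[OF s3] and mu = MUn_Hom[OF x]
  have nat: "entry (v x) (\<lambda>\<beta>. Ident C (Unit C) \<triangleright>\<^sub>a u x \<beta>) (MUn M x) \<beta> = MUn M (A x \<beta>)" for \<beta>
    unfolding entry_def
    using MUn_natural[OF D(3), of \<beta>] M.Comp_assoc[OF MUn_Hom[OF P_Obj[OF D(2)]] D(3) D(4), of \<beta> \<beta>]
      D(5)[of \<beta>] M.Comp_Ident_left[OF MUn_Hom[OF P_Obj[OF D(2)]], of \<beta>] by simp
  have "MUn M (A x \<beta>) \<cdot> entry (\<lambda>\<beta>. Ident C (Unit C) \<triangleright>\<^sub>a v x \<beta>) (u (Unit C \<triangleright>\<^sub>o x)) (Ident M (Unit C \<triangleright>\<^sub>o x)) \<beta>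
      = entry (v x) (u (Unit C \<triangleright>\<^sub>o x)) (MUn M x) \<beta>" for \<beta>
    using entry_Comp[OF s1 s2 s3 M.Ident_Hom[OF ux] mu, of \<beta>] nat[of \<beta>] M.Comp_Ident_right[OF mu] by simp
  then show "Comp sum_cat (MUn sum_cat (F_obj x)) (F_mod (Unit C) x) = F_arr (MUn M x)"
    by (simp add: F_arr_eq[OF mu] F_mod_def F_obj_def sum_cat_ops to_pair_eq_iff)
qed

lemma sum_cat_HomD:
  assumes "f \<in> Hom sum_cat y z"
  shows "of_pair f \<beta> \<in> Hom M (of_pair y \<beta>) (of_pair z \<beta>)" "splits (S y) (of_pair y) (j y) (q y)"
    "splits (S z) (of_pair z) (j z) (q z)" "G_arr f = glue (j z) (q y) (of_pair f)"
proof -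
  show "of_pair f \<beta> \<in> Hom M (of_pair y \<beta>) (of_pair z \<beta>)" using assms by (simp add: sum_cat_Hom)
  show "splits (S y) (of_pair y) (j y) (q y)" "splits (S z) (of_pair z) (j z) (q z)"
    using assms splits_pair by (simp_all add: sum_cat_Hom sum_cat_Obj)
  show "G_arr f = glue (j z) (q y) (of_pair f)"
    using HomD[OF assms] by (simp add: G_arr_def)
qed

lemma G_arr_Hom:
  assumes "f \<in> Hom sum_cat y z"
  shows "G_arr f \<in> Hom M (S y) (S z)"
  unfolding sum_cat_HomD(4)[OF assms]
  by (rule glue_Hom[OF sum_cat_HomD(2,3)[OF assms] sum_cat_HomD(1)[OF assms]])

lemma entry_G_arr:
  assumes "f \<in> Hom sum_cat y z"
  shows "entry (q z) (j y) (G_arr f) \<beta> = of_pair f \<beta>"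
  unfolding sum_cat_HomD(4)[OF assms]
  by (rule entry_glue[OF sum_cat_HomD(2,3)[OF assms] sum_cat_HomD(1)[OF assms]])

text \<open>The entries of \<open>G_arr f\<close> are the components of \<open>f\<close>, and arrows
  are determined by their entries, so each law is checked componentwise.\<close>

lemma G_linear: "is_linear_functor sum_cat M S G_arr"
  unfolding is_linear_functor_def
proof (intro conjI ballI allI)
  fix y assume y: "y \<in> Obj sum_cat"
  note s = splits_pair[OF y]
  show Sy: "S y \<in> Obj M" by (rule splitsD(1)[OF s])
  have I: "Ident sum_cat y \<in> Hom sum_cat y y"
    using y M.Ident_Hom[OF P_Obj] by (auto simp: sum_cat_Hom sum_cat_ops sum_cat_Obj)
  show "G_arr (Ident sum_cat y) = Ident M (S y)"
    by (rule eq_if_entries[OF s s G_arr_Hom[OF I] M.Ident_Hom[OF Sy]])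
      (unfold entry_G_arr[OF I] entry_Ident[OF s], simp add: sum_cat_ops)
next
  fix y z f assume "f \<in> Hom sum_cat y z"
  then show "G_arr f \<in> Hom M (S y) (S z)" by (rule G_arr_Hom)
next
  fix x y z f g assume f: "f \<in> Hom sum_cat x y" and g: "g \<in> Hom sum_cat y z"
  note s = sum_cat_HomD(2)[OF f] sum_cat_HomD(3)[OF f] sum_cat_HomD(3)[OF g]
  have gf: "Comp sum_cat g f \<in> Hom sum_cat x z"
    using f g M.Comp_Hom by (simp add: sum_cat_Hom sum_cat_ops) blast
  show "G_arr (Comp sum_cat g f) = G_arr g \<cdot> G_arr f"
    by (rule eq_if_entries[OF s(1,3) G_arr_Hom[OF gf] M.Comp_Hom[OF G_arr_Hom[OF f] G_arr_Hom[OF g]]])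
      (unfold entry_G_arr[OF gf] entry_Comp[OF s G_arr_Hom[OF f] G_arr_Hom[OF g]]
        entry_G_arr[OF f] entry_G_arr[OF g], simp add: sum_cat_ops)
next
  fix x y f g assume f: "f \<in> Hom sum_cat x y" and g: "g \<in> Hom sum_cat x y"
  note s = sum_cat_HomD(2)[OF f] sum_cat_HomD(3)[OF f]
  have fg: "Add sum_cat f g \<in> Hom sum_cat x y"
    using f g M.Add_Hom by (simp add: sum_cat_Hom sum_cat_ops)
  show "G_arr (Add sum_cat f g) = Add M (G_arr f) (G_arr g)"
    by (rule eq_if_entries[OF s G_arr_Hom[OF fg] M.Add_Hom[OF G_arr_Hom[OF f] G_arr_Hom[OF g]]])
      (unfold entry_G_arr[OF fg] entry_Add[OF s G_arr_Hom[OF f] G_arr_Hom[OF g]]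
        entry_G_arr[OF f] entry_G_arr[OF g], simp add: sum_cat_ops)
next
  fix k f assume "f \<in> Arr sum_cat"
  then obtain x y where f: "f \<in> Hom sum_cat x y" by (simp add: Hom_def)
  note s = sum_cat_HomD(2)[OF f] sum_cat_HomD(3)[OF f]
  have kf: "Scale sum_cat k f \<in> Hom sum_cat x y"
    using f M.Scale_Hom by (simp add: sum_cat_Hom sum_cat_ops)
  show "G_arr (Scale sum_cat k f) = Scale M k (G_arr f)"
    by (rule eq_if_entries[OF s G_arr_Hom[OF kf] M.Scale_Hom[OF G_arr_Hom[OF f]]])
      (unfold entry_G_arr[OF kf] entry_Scale[OF s G_arr_Hom[OF f]] entry_G_arr[OF f],
        simp add: sum_cat_ops)
qed

lemma F_equivalence: "is_equivalence M sum_cat F_obj F_arr"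
  unfolding is_equivalence_def
proof (intro conjI exI)
  show "is_linear_functor M sum_cat F_obj F_arr" by (rule F_linear)
  show "is_linear_functor sum_cat M S G_arr" by (rule G_linear)
  \<comment> \<open>\<open>x\<close> and \<open>S (F_obj x)\<close> have the same summands
    \<open>A x\<close>, so gluing identities compares them.\<close>
  define t where "t x = glue (j (F_obj x)) (v x) (\<lambda>\<beta>. Ident M (A x \<beta>))" for x
  have sF: "splits (S (F_obj x)) (A x) (j (F_obj x)) (q (F_obj x))" if "x \<in> Obj M" for x
    using splits_pair[OF F_obj[OF that]] by (simp add: F_obj_def)
  have IA: "Ident M (A x \<beta>) \<in> Hom M (A x \<beta>) (A x \<beta>)" if "x \<in> Obj M" for x \<beta>
    using M.Ident_Hom P_Obj splitsD(2)[OF splits[OF that]] by blast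
  have tH: "t x \<in> Hom M x (S (F_obj x))" if "x \<in> Obj M" for x
    unfolding t_def by (rule glue_Hom[OF splits[OF that] sF[OF that] IA[OF that]])
  have t_entry: "entry (q (F_obj x)) (u x) (t x) \<beta> = Ident M (A x \<beta>)" if "x \<in> Obj M" for x \<beta>
    unfolding t_def by (rule entry_glue[OF splits[OF that] sF[OF that] IA[OF that]])
  show "is_natural_iso M M id id (S \<circ> F_obj) (G_arr \<circ> F_arr) t"
    unfolding is_natural_iso_def comp_apply id_apply
  proof (intro conjI ballI allI)
    fix x assume x: "x \<in> Obj M"
    show "t x \<in> Hom M x (S (F_obj x))" by (rule tH[OF x])
    show "is_iso M (t x)"
      unfolding t_def
    proof (rule glue_iso[OF splits[OF x] sF[OF x] IA[OF x]])
      show "is_iso M (Ident M (A x \<beta>))" for \<beta>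
        by (rule M.is_isoI[OF IA[OF x] IA[OF x]]) (simp_all add: M.Comp_Ident_left[OF IA[OF x]])
    qed
  next
    fix x y f assume f: "f \<in> Hom M x y"
    have x: "x \<in> Obj M" and y: "y \<in> Obj M" using M.Hom_Obj[OF f] by simp_all
    note Ff = F_arr_Hom[OF f]
    note e = entry_Hom[OF splits[OF x] splits[OF y] f]
    have GF: "entry (q (F_obj y)) (j (F_obj x)) (G_arr (F_arr f)) \<beta> = entry (v y) (u x) f \<beta>" for \<beta>
      using entry_G_arr[OF Ff, of \<beta>] by (simp add: F_arr_eq[OF f])
    show "t y \<cdot> f = G_arr (F_arr f) \<cdot> t x"
      by (rule eq_if_entries[OF splits[OF x] sF[OF y] M.Comp_Hom[OF f tH[OF y]]
            M.Comp_Hom[OF tH[OF x] G_arr_Hom[OF Ff]]])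
        (simp add: entry_Comp[OF splits[OF x] splits[OF y] sF[OF y] f tH[OF y]] t_entry[OF x] t_entry[OF y]
          entry_Comp[OF splits[OF x] sF[OF x] sF[OF y] tH[OF x] G_arr_Hom[OF Ff]] GF
          M.Comp_Ident_left[OF e] M.Comp_Ident_right[OF e])
  qed
  \<comment> \<open>\<open>S y\<close> carries both its chosen splitting and the one that defines it
    from \<open>y\<close>; the entries of its identity compare the summands.\<close>
  define w where "w y = to_pair (entry (q y) (u (S y)) (Ident M (S y)))" for y
  show "is_natural_iso sum_cat sum_cat (F_obj \<circ> S) (F_arr \<circ> G_arr) id id w"
    unfolding is_natural_iso_def comp_apply id_apply
  proof (intro conjI ballI allI)
    fix y assume y: "y \<in> Obj sum_cat"
    note Sy = splitsD(1)[OF splits_pair[OF y]]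
    note s = splits[OF Sy] splits_pair[OF y] and I = M.Ident_Hom[OF splitsD(1)[OF splits_pair[OF y]]]
    note e = entry_Hom[OF s I]
    show "w y \<in> Hom sum_cat (F_obj (S y)) y"
      using e splitsD(2)[OF s(1)] splitsD(2)[OF s(2)] by (simp add: w_def sum_cat_Hom F_obj_def)
    have "is_iso M (Ident M (S y))"
      by (rule M.is_isoI[OF I I]) (simp_all add: M.Comp_Ident_left[OF I])
    then show "is_iso sum_cat (w y)"
      unfolding w_def
      by (intro sum_cat_iso[OF e splitsD(2)[OF s(1)] splitsD(2)[OF s(2)]] entry_iso[OF s I])
  next
    fix y z f assume f: "f \<in> Hom sum_cat y z"
    note sy = sum_cat_HomD(2)[OF f] and sz = sum_cat_HomD(3)[OF f] and Gf = G_arr_Hom[OF f]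
    note Sy = splits[OF splitsD(1)[OF sy]] and Sz = splits[OF splitsD(1)[OF sz]]
    note Iy = M.Ident_Hom[OF splitsD(1)[OF sy]] and Iz = M.Ident_Hom[OF splitsD(1)[OF sz]]
    have "entry (q z) (u (S z)) (Ident M (S z)) \<beta> \<cdot> entry (v (S z)) (u (S y)) (G_arr f) \<beta>
        = of_pair f \<beta> \<cdot> entry (q y) (u (S y)) (Ident M (S y)) \<beta>" for \<beta>
      using entry_Comp[OF Sy Sz sz Gf Iz, of \<beta>] entry_Comp[OF Sy sy sz Iy Gf, of \<beta>]
        entry_G_arr[OF f, of \<beta>] M.Comp_Ident_left[OF Gf] M.Comp_Ident_right[OF Gf] by simp
    then show "Comp sum_cat (w z) (F_arr (G_arr f)) = Comp sum_cat f (w y)"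
      by (simp add: w_def sum_cat_ops to_pair_eq_iff F_arr_eq[OF Gf])
  qed
qed

end

text \<open>Splittings of objects of \<open>M\<close> are assumed, and pairs are summed by
  biproducts; the axiom of choice turns both existence statements into the functions of
  \<open>chosen_splittings\<close>.\<close>

lemma (in orthogonal_pair) decomposition:
  assumes "\<And>x. x \<in> Obj M \<Longrightarrow> \<exists>A u v. splits x A u v"
  shows "module_equivalent C M sum_cat"
proof -
  obtain A u v where "\<And>x. x \<in> Obj M \<Longrightarrow> splits x (A x) (u x) (v x)"
    using assms by metis
  moreover have "\<exists>x u v. splits x (of_pair y) u v" if "y \<in> Obj sum_cat" for y
    using splits_from_summands[of "of_pair y"] that by (simp add: sum_cat_Obj)
  then obtain S j q where "\<And>y. y \<in> Obj sum_cat \<Longrightarrow> splits (S y) (of_pair y) (j y) (q y)"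
    by metis
  ultimately interpret chosen_splittings C M P A u v S j q
    by unfold_locales
  show ?thesis
    unfolding module_equivalent_def using F_module_functor F_equivalence by blast
qed

section \<open>Direct sums\<close>

context linear_category
begin

lemma is_direct_sumD:
  assumes "is_direct_sum C n X s inc pr"
  shows "s \<in> Obj C" "finsum (hom_space C s s) (\<lambda>i. inc i \<cdot> pr i) {..<n} = Ident C s"
    "i < n \<Longrightarrow> X i \<in> Obj C" "i < n \<Longrightarrow> inc i \<in> Hom C (X i) s" "i < n \<Longrightarrow> pr i \<in> Hom C s (X i)"
    "i < n \<Longrightarrow> pr i \<cdot> inc i = Ident C (X i)"
  using assms by (simp_all add: is_direct_sum_def)

lemma summand_Hom:
  "\<lbrakk>is_direct_sum C n X s inc pr; i < n\<rbrakk> \<Longrightarrow> inc i \<cdot> pr i \<in> Hom C s s"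
  using Comp_Hom is_direct_sumD(4,5) by blast

lemma direct_sum_source:
  assumes s: "is_direct_sum C n X s inc pr" and f: "f \<in> Hom C s y"
  shows "f = finsum (hom_space C s y) (\<lambda>i. f \<cdot> (inc i \<cdot> pr i)) {..<n}"
  using Comp_finsum_right[OF f is_direct_sumD(1)[OF s], of "{..<n}" "\<lambda>i. inc i \<cdot> pr i"]
    summand_Hom[OF s] is_direct_sumD(2)[OF s] Comp_Ident_right[OF f] by simp

lemma direct_sum_target:
  assumes s: "is_direct_sum C n X s inc pr" and f: "f \<in> Hom C y s"
  shows "f = finsum (hom_space C y s) (\<lambda>i. (inc i \<cdot> pr i) \<cdot> f) {..<n}"
  using Comp_finsum_left[OF f is_direct_sumD(1)[OF s], of "{..<n}" "\<lambda>i. inc i \<cdot> pr i"]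
    summand_Hom[OF s] is_direct_sumD(2)[OF s] Comp_Ident_left[OF f] by simp

lemma direct_sum_source_Zero:
  assumes s: "is_direct_sum C n X s inc pr" and f: "f \<in> Hom C s y"
    and "\<And>i. i < n \<Longrightarrow> f \<cdot> inc i = Zero C (X i) y"
  shows "f = Zero C s y"
proof -
  note O = Hom_Obj[OF f]
  have "f \<cdot> (inc i \<cdot> pr i) = Zero C s y" if "i < n" for i
    using Comp_assoc[OF is_direct_sumD(5)[OF s that] is_direct_sumD(4)[OF s that] f]
      Comp_Zero_left[OF is_direct_sumD(5)[OF s that] O(2)] assms(3)[OF that] by simp
  then have "finsum (hom_space C s y) (\<lambda>i. f \<cdot> (inc i \<cdot> pr i)) {..<n} = Zero C s y"
    using O by (intro finsum_Zero) auto
  then show ?thesis using direct_sum_source[OF s f] by simp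
qed

lemma direct_sum_target_Zero:
  assumes s: "is_direct_sum C n X s inc pr" and f: "f \<in> Hom C y s"
    and "\<And>i. i < n \<Longrightarrow> pr i \<cdot> f = Zero C y (X i)"
  shows "f = Zero C y s"
proof -
  note O = Hom_Obj[OF f]
  have "(inc i \<cdot> pr i) \<cdot> f = Zero C y s" if "i < n" for i
    using Comp_assoc[OF f is_direct_sumD(5)[OF s that] is_direct_sumD(4)[OF s that]]
      Comp_Zero_right[OF is_direct_sumD(4)[OF s that] O(1)] assms(3)[OF that] by simp
  then have "finsum (hom_space C y s) (\<lambda>i. (inc i \<cdot> pr i) \<cdot> f) {..<n} = Zero C y s"
    using O by (intro finsum_Zero) auto
  then show ?thesis using direct_sum_target[OF s f] by simp
qed

end

text \<open>Acting with \<open>c\<close> is an additive functor and so preserves biproducts;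
  \<open>finsum_additive\<close> carries over the decomposition of the identity.\<close>

lemma (in module_category) direct_sum_Act:
  assumes c: "c \<in> Obj C" and s: "is_direct_sum M n X s inc pr"
  shows "is_direct_sum M n (\<lambda>i. c \<triangleright>\<^sub>o X i) (c \<triangleright>\<^sub>o s) (\<lambda>i. Ident C c \<triangleright>\<^sub>a inc i) (\<lambda>i. Ident C c \<triangleright>\<^sub>a pr i)"
proof -
  have I: "Ident C c \<in> Hom C c c" by (rule C.Ident_Hom[OF c])
  have II: "Ident C c \<cdot>\<^bsub>C\<^esub> Ident C c = Ident C c" by (rule C.Comp_Ident_left[OF I])
  note D = M.is_direct_sumD[OF s]
  have act_Zero: "Ident C c \<triangleright>\<^sub>a Zero M x y = Zero M (c \<triangleright>\<^sub>o x) (c \<triangleright>\<^sub>o y)" if "x \<in> Obj M" "y \<in> Obj M" for x y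
    using ActA_Scale_right[OF I M.Zero_Hom[OF that], of 0] M.Scale_zero[OF M.Zero_Hom[OF that]]
      M.Scale_zero[OF ActA_Hom[OF I M.Zero_Hom[OF that]]] by simp
  have pi: "(Ident C c \<triangleright>\<^sub>a pr i) \<cdot> (Ident C c \<triangleright>\<^sub>a inc k) =
      (if i = k then Ident M (c \<triangleright>\<^sub>o X i) else Zero M (c \<triangleright>\<^sub>o X k) (c \<triangleright>\<^sub>o X i))" if "i < n" "k < n" for i k
  proof -
    have "(Ident C c \<triangleright>\<^sub>a pr i) \<cdot> (Ident C c \<triangleright>\<^sub>a inc k) = Ident C c \<triangleright>\<^sub>a (pr i \<cdot> inc k)"
      using ActA_Comp[OF I I D(4)[OF that(2)] D(5)[OF that(1)]] II by simp
    then show ?thesis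
      using s that act_Zero D(3) ActA_Ident[OF c] by (simp add: is_direct_sum_def)
  qed
  have ip: "(Ident C c \<triangleright>\<^sub>a inc i) \<cdot> (Ident C c \<triangleright>\<^sub>a pr i) = Ident C c \<triangleright>\<^sub>a (inc i \<cdot> pr i)" if "i < n" for i
    using ActA_Comp[OF I I D(5)[OF that] D(4)[OF that]] II by simp
  have "Ident C c \<triangleright>\<^sub>a finsum (hom_space M s s) (\<lambda>i. inc i \<cdot> pr i) {..<n} =
      finsum (hom_space M (c \<triangleright>\<^sub>o s) (c \<triangleright>\<^sub>o s)) (\<lambda>i. Ident C c \<triangleright>\<^sub>a (inc i \<cdot> pr i)) {..<n}"
    using D(1) M.summand_Hom[OF s] Act_Obj[OF c] act_Zero ActA_Hom[OF I] ActA_Add_right[OF I]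
    by (intro M.finsum_additive) auto
  also have "\<dots> = finsum (hom_space M (c \<triangleright>\<^sub>o s) (c \<triangleright>\<^sub>o s))
      (\<lambda>i. (Ident C c \<triangleright>\<^sub>a inc i) \<cdot> (Ident C c \<triangleright>\<^sub>a pr i)) {..<n}"
    using ip ActA_Hom[OF I M.summand_Hom[OF s]]
      M.hom_abelian_group[OF Act_Obj[OF c D(1)] Act_Obj[OF c D(1)]]
    by (intro abelian_monoid.finsum_cong' abelian_group.axioms(1)) auto
  finally have sum: "finsum (hom_space M (c \<triangleright>\<^sub>o s) (c \<triangleright>\<^sub>o s))
      (\<lambda>i. (Ident C c \<triangleright>\<^sub>a inc i) \<cdot> (Ident C c \<triangleright>\<^sub>a pr i)) {..<n} = Ident M (c \<triangleright>\<^sub>o s)"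
    using D(2) ActA_Ident[OF c D(1)] by simp
  show ?thesis
    unfolding is_direct_sum_def
    using pi sum Act_Obj[OF c] D(1,3) ActA_Hom[OF I D(4)] ActA_Hom[OF I D(5)] by simp
qed

section \<open>Endomorphisms of simple objects\<close>

text \<open>Gaussian elimination on one coordinate at a time. The family is indexed, rather than a
  set, because it is applied to the powers of an endomorphism, which may coincide.\<close>

lemma linear_dependence:
  fixes c :: "'i \<Rightarrow> 'b \<Rightarrow> 'k :: field"
  assumes "finite B" "finite I" "card B < card I"
  shows "\<exists>a. (\<exists>i\<in>I. a i \<noteq> 0) \<and> (\<forall>b\<in>B. (\<Sum>i\<in>I. a i * c i b) = 0)"
  using assms
proof (induction B arbitrary: c I rule: finite_induct)
  case empty
  then obtain i where "i \<in> I" by (metis card_gt_0_iff card.empty ex_in_conv)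
  then show ?case by (intro exI[of _ "\<lambda>_. 1"]) auto
next
  case (insert b0 B)
  show ?case
  proof (cases "\<forall>i\<in>I. c i b0 = 0")
    case True
    have "finite I" "card B < card I" using insert by simp_all
    then obtain a where "\<exists>i\<in>I. a i \<noteq> 0" "\<forall>b\<in>B. (\<Sum>i\<in>I. a i * c i b) = 0"
      using insert.IH[of I c] by blast
    then show ?thesis using True by (intro exI[of _ a]) auto
  next
    case False
    then obtain i0 where i0: "i0 \<in> I" "c i0 b0 \<noteq> 0" by blast
    define I' where "I' = I - {i0}"
    \<comment> \<open>Pivot on \<open>i0\<close>: subtracting \<open>r i\<close> times the pivot
      vector clears the coordinate \<open>b0\<close> of every other vector.\<close>
    define r where "r = (\<lambda>i. c i b0 / c i0 b0)"
    have "card B < card I'" "finite I'" using insert i0 by (simp_all add: I'_def)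
    then obtain a where a: "\<exists>i\<in>I'. a i \<noteq> 0" "\<forall>b\<in>B. (\<Sum>i\<in>I'. a i * (c i b - r i * c i0 b)) = 0"
      using insert.IH[of I' "\<lambda>i b. c i b - r i * c i0 b"] by auto
    \<comment> \<open>The pivot coefficient collects the multiples that were subtracted, so the two
      combinations agree in every coordinate.\<close>
    define a' where "a' = (\<lambda>i. if i = i0 then - (\<Sum>i\<in>I'. a i * r i) else a i)"
    have I: "I = Set.insert i0 I'" "i0 \<notin> I'" using i0 by (auto simp: I'_def)
    have sum: "(\<Sum>i\<in>I. a' i * c i b) = (\<Sum>i\<in>I'. a i * (c i b - r i * c i0 b))" for b
    proof -
      have "(\<Sum>i\<in>I'. a' i * c i b) = (\<Sum>i\<in>I'. a i * c i b)"
        using I by (intro sum.cong) (auto simp: a'_def)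
      then have "(\<Sum>i\<in>I. a' i * c i b) = - (\<Sum>i\<in>I'. a i * r i) * c i0 b + (\<Sum>i\<in>I'. a i * c i b)"
        using I \<open>finite I'\<close> by (simp add: a'_def)
      then show ?thesis
        by (simp add: algebra_simps sum_subtractf sum_distrib_left)
    qed
    have "(\<Sum>i\<in>I. a' i * c i b0) = 0"
      unfolding sum using i0 by (simp add: r_def)
    moreover have "\<exists>i\<in>I. a' i \<noteq> 0" using a(1) I by (auto simp: a'_def)
    ultimately show ?thesis using a(2) sum by (intro exI[of _ a']) auto
  qed
qed

section \<open>Module categories with a trace\<close>

locale traced_module_category = module_category C M + module_trace C M \<Theta>
  for C :: "('c, 'f, 'p) pivotal_cat_scheme" and M :: "('c, 'f, 'o, 'a, 'q) mod_cat_scheme" (structure)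
    and \<Theta>
begin

lemma trace_Zero:
  assumes "x \<in> Obj M"
  shows "\<Theta> x (Zero M x x) = 0"
  using trace_Scale[OF assms M.Zero_Hom[OF assms assms], of 0]
    M.Scale_zero[OF M.Zero_Hom[OF assms assms]] by simp

lemma trace_finsum:
  assumes "x \<in> Obj M" "finite I" "\<And>i. i \<in> I \<Longrightarrow> F i \<in> Hom M x x"
  shows "\<Theta> x (finsum (hom_space M x x) F I) = (\<Sum>i\<in>I. \<Theta> x (F i))"
  using assms(2,3)
proof (induction I rule: finite_induct)
  case empty
  then show ?case using assms(1) by (simp add: M.finsum_empty trace_Zero)
next
  case (insert i I)
  then show ?case
    using assms(1) by (subst M.finsum_insert) (auto simp: trace_Add M.finsum_Hom)
qed

text \<open>The trace pairs the two hom spaces without degeneracy, so one of them is zero as soon as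
  the other is.\<close>

lemma Hom_vanish_sym:
  assumes "\<And>g. g \<in> Hom M y x \<Longrightarrow> g = Zero M y x" and f: "f \<in> Hom M x y"
  shows "f = Zero M x y"
proof (rule trace_nondegenerate_left[OF M.Hom_Obj[OF f] f])
  fix g assume "g \<in> Hom M y x"
  then have "g = Zero M y x" by (rule assms(1))
  then show "\<Theta> x (g \<cdot> f) = 0"
    using M.Comp_Zero_left[OF f M.Hom_Obj(1)[OF f]] trace_Zero[OF M.Hom_Obj(1)[OF f]] by simp
qed

fun endo_power :: "'o \<Rightarrow> 'a \<Rightarrow> nat \<Rightarrow> 'a" where
  "endo_power x f 0 = Ident M x"
| "endo_power x f (Suc k) = f \<cdot> endo_power x f k"

lemma endo_power_Hom: "f \<in> Hom M x x \<Longrightarrow> endo_power x f k \<in> Hom M x x"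
  using M.Hom_Obj M.Ident_Hom M.Comp_Hom by (induction k) auto

text \<open>
  \<open>p\<close> annihilates \<open>f\<close> iff \<open>p(f) = 0\<close>, by non-degeneracy of the trace; testing against all \<open>h\<close>
  turns identities between endomorphisms into identities between complex numbers.
\<close>

definition annihilates :: "complex poly \<Rightarrow> 'o \<Rightarrow> 'a \<Rightarrow> bool" where
  "annihilates p x f \<longleftrightarrow>
    (\<forall>h \<in> Hom M x x. (\<Sum>i\<le>degree p. coeff p i * \<Theta> x (h \<cdot> endo_power x f i)) = 0)"

text \<open>The endomorphisms of \<open>x\<close> are spanned by finitely many arrows, so
  sufficiently many powers of \<open>f\<close> are linearly dependent.\<close>

lemma annihilating_poly:
  assumes f: "f \<in> Hom M x x"
  shows "\<exists>p. p \<noteq> 0 \<and> annihilates p x f"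
proof -
  note x = M.Hom_Obj(1)[OF f]
  obtain B where B: "finite B" "B \<subseteq> Hom M x x"
      "\<forall>f \<in> Hom M x x. \<exists>c. f = finsum (hom_space M x x) (\<lambda>b. Scale M (c b) b) B"
    using M.finite_dim_Hom[OF x x] by blast
  have "\<exists>c. endo_power x f k = finsum (hom_space M x x) (\<lambda>b. Scale M (c b) b) B" for k
    using B(3) endo_power_Hom[OF f] by blast
  then obtain c where c: "\<And>k. endo_power x f k = finsum (hom_space M x x) (\<lambda>b. Scale M (c k b) b) B"
    by metis
  \<comment> \<open>The exponents from 0 to \<open>card B\<close> give one power more than there are
    spanning arrows.\<close>
  obtain a where a: "\<exists>i\<in>{..card B}. a i \<noteq> 0" "\<forall>b\<in>B. (\<Sum>i\<in>{..card B}. a i * c i b) = 0"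
    using linear_dependence[of B "{..card B}" c] B(1) by auto
  \<comment> \<open>Trailing coefficients may vanish, so \<open>card B\<close> only bounds the
    degree; the sum up to the degree is later padded with zeros.\<close>
  define p where "p = Poly (map a [0..<Suc (card B)])"
  have coeff: "coeff p i = (if i \<le> card B then a i else 0)" for i
    by (simp add: p_def coeff_Poly_eq nth_default_def del: upt_Suc)
  have "p \<noteq> 0" using a(1) coeff by (metis atMost_iff coeff_0)
  moreover have "annihilates p x f"
    unfolding annihilates_def
  proof
    fix h assume h: "h \<in> Hom M x x"
    have "\<Theta> x (h \<cdot> endo_power x f k) = (\<Sum>b\<in>B. c k b * \<Theta> x (h \<cdot> b))" for k
    proof -
      have "h \<cdot> endo_power x f k = finsum (hom_space M x x) (\<lambda>b. h \<cdot> Scale M (c k b) b) B"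
        unfolding c using B(1,2) M.Scale_Hom by (intro M.Comp_finsum_right[OF h x]) auto
      then have "\<Theta> x (h \<cdot> endo_power x f k) = (\<Sum>b\<in>B. \<Theta> x (h \<cdot> Scale M (c k b) b))"
        using trace_finsum[OF x B(1), of "\<lambda>b. h \<cdot> Scale M (c k b) b"] M.Comp_Hom[OF M.Scale_Hom h] B(2)
        by auto
      also have "\<dots> = (\<Sum>b\<in>B. c k b * \<Theta> x (h \<cdot> b))"
        using B(2) M.Comp_Scale_right[OF _ h] trace_Scale[OF x M.Comp_Hom[OF _ h]]
        by (intro sum.cong) auto
      finally show ?thesis .
    qed
    then have "(\<Sum>i\<le>card B. a i * \<Theta> x (h \<cdot> endo_power x f i)) =
        (\<Sum>i\<le>card B. \<Sum>b\<in>B. a i * c i b * \<Theta> x (h \<cdot> b))"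
      by (simp add: sum_distrib_left mult.assoc)
    also have "\<dots> = (\<Sum>b\<in>B. (\<Sum>i\<le>card B. a i * c i b) * \<Theta> x (h \<cdot> b))"
      by (subst sum.swap) (simp add: sum_distrib_right)
    also have "\<dots> = 0" using a(2) by simp
    finally have "(\<Sum>i\<le>card B. coeff p i * \<Theta> x (h \<cdot> endo_power x f i)) = 0"
      by (simp add: coeff)
    moreover have "degree p \<le> card B"
      by (rule degree_le) (simp add: coeff)
    then have "(\<Sum>i\<le>degree p. coeff p i * \<Theta> x (h \<cdot> endo_power x f i)) =
        (\<Sum>i\<le>card B. coeff p i * \<Theta> x (h \<cdot> endo_power x f i))"
      by (intro sum.mono_neutral_left) (auto simp: coeff_eq_0)
    ultimately show "(\<Sum>i\<le>degree p. coeff p i * \<Theta> x (h \<cdot> endo_power x f i)) = 0" by simp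
  qed
  ultimately show ?thesis by blast
qed

text \<open>For p = (X - k) q one has h p(f) = (h (f - k)) q(f): a linear factor moves from the
  polynomial into the test arrow.\<close>

lemma annihilates_linear_factor:
  assumes f: "f \<in> Hom M x x" and h: "h \<in> Hom M x x" and "q \<noteq> 0"
    and ann: "annihilates ([:- k, 1:] * q) x f"
  shows "(\<Sum>i\<le>degree q. coeff q i * \<Theta> x ((h \<cdot> Add M f (Scale M (- k) (Ident M x))) \<cdot> endo_power x f i)) = 0"
proof -
  note x = M.Hom_Obj(1)[OF f]
  define G where "G i = \<Theta> x (h \<cdot> endo_power x f i)" for i
  let ?I = "Ident M x"
  have I: "?I \<in> Hom M x x" by (rule M.Ident_Hom[OF x])
  have step: "\<Theta> x ((h \<cdot> Add M f (Scale M (- k) ?I)) \<cdot> endo_power x f i) = G (Suc i) - k * G i" for i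
  proof -
    note e = endo_power_Hom[OF f, of i]
    have "(h \<cdot> Add M f (Scale M (- k) ?I)) \<cdot> endo_power x f i =
        h \<cdot> (Add M f (Scale M (- k) ?I) \<cdot> endo_power x f i)"
      by (rule M.Comp_assoc[OF e M.Add_Hom[OF f M.Scale_Hom[OF I]] h])
    also have "Add M f (Scale M (- k) ?I) \<cdot> endo_power x f i =
        Add M (endo_power x f (Suc i)) (Scale M (- k) (endo_power x f i))"
      using M.Comp_Add_left[OF e f M.Scale_Hom[OF I]] M.Comp_Scale_left[OF e I] M.Comp_Ident_left[OF e]
      by simp
    also have "h \<cdot> \<dots> = Add M (h \<cdot> endo_power x f (Suc i)) (Scale M (- k) (h \<cdot> endo_power x f i))"
      using M.Comp_Add_right[OF endo_power_Hom[OF f, of "Suc i"] M.Scale_Hom[OF e] h]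
        M.Comp_Scale_right[OF e h] by simp
    finally show ?thesis
      using trace_Add[OF x M.Comp_Hom[OF endo_power_Hom[OF f, of "Suc i"] h] M.Scale_Hom[OF M.Comp_Hom[OF e h]]]
        trace_Scale[OF x M.Comp_Hom[OF e h]] by (simp add: G_def)
  qed
  have deg: "degree ([:- k, 1:] * q) = Suc (degree q)"
    using \<open>q \<noteq> 0\<close> by (subst degree_mult_eq) auto
  have mult: "[:- k, 1:] * q = pCons 0 q - smult k q" by simp
  \<comment> \<open>Multiplication by the variable shifts the coefficients by one, and the
    coefficient of \<open>q\<close> at \<open>Suc (degree q)\<close> is zero, so both parts reduce
    to sums up to \<open>degree q\<close>.\<close>
  have "0 = (\<Sum>i\<le>Suc (degree q). coeff ([:- k, 1:] * q) i * G i)"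
    using ann h unfolding annihilates_def deg G_def by simp
  also have "\<dots> = (\<Sum>i\<le>Suc (degree q). coeff (pCons 0 q) i * G i) - (\<Sum>i\<le>Suc (degree q). k * coeff q i * G i)"
    unfolding mult by (simp only: coeff_diff coeff_smult left_diff_distrib sum_subtractf)
  also have "(\<Sum>i\<le>Suc (degree q). coeff (pCons 0 q) i * G i) = (\<Sum>i\<le>degree q. coeff q i * G (Suc i))"
    by (subst sum.atMost_Suc_shift) simp
  also have "(\<Sum>i\<le>Suc (degree q). k * coeff q i * G i) = (\<Sum>i\<le>degree q. k * coeff q i * G i)"
    by (simp add: coeff_eq_0)
  finally show ?thesis
    unfolding step by (simp add: right_diff_distrib sum_subtractf mult_ac)
qed

text \<open>An annihilating polynomial of least degree has a complex root \<open>k\<close>. As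
  \<open>x\<close> is simple, f - k is zero or invertible, and in the second case the linear factor
  could be cancelled, against minimality.\<close>

lemma simple_endo_scalar:
  assumes X: "simple M x" and f: "f \<in> Hom M x x"
  shows "\<exists>k. f = Scale M k (Ident M x)"
proof -
  note x = M.Hom_Obj(1)[OF f]
  let ?I = "Ident M x"
  have I: "?I \<in> Hom M x x" by (rule M.Ident_Hom[OF x])
  define p where "p = arg_min degree (\<lambda>p. p \<noteq> 0 \<and> annihilates p x f)"
  have p: "p \<noteq> 0" "annihilates p x f"
    and min: "\<And>q. \<lbrakk>q \<noteq> 0; annihilates q x f\<rbrakk> \<Longrightarrow> degree p \<le> degree q"
    using arg_min_nat_lemma[of "\<lambda>p. p \<noteq> 0 \<and> annihilates p x f" _ degree] annihilating_poly[OF f]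
    unfolding p_def by blast+
  \<comment> \<open>An annihilating nonzero constant would make the identity orthogonal to all
    endomorphisms for the trace pairing, so that \<open>x\<close> would be zero.\<close>
  have "degree p \<noteq> 0"
  proof
    assume d: "degree p = 0"
    have "\<Theta> x (g \<cdot> ?I) = 0" if "g \<in> Hom M x x" for g
    proof -
      have "coeff p 0 * \<Theta> x (g \<cdot> ?I) = 0"
        using p(2) that by (auto simp: annihilates_def d)
      moreover have "coeff p 0 \<noteq> 0" using p(1) d by (metis leading_coeff_0_iff)
      ultimately show ?thesis by simp
    qed
    then have "?I = Zero M x x" by (rule trace_nondegenerate_left[OF x x I])
    then show False using M.zero_objectI[OF x] X by (simp add: simple_def)
  qed
  then obtain k where "poly p k = 0"
    using fundamental_theorem_of_algebra[of p] by (auto simp: constant_degree)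
  then obtain q where q: "p = [:- k, 1:] * q" by (auto simp: poly_eq_0_iff_dvd dvd_def)
  have q0: "q \<noteq> 0" using p(1) q by auto
  let ?g = "Add M f (Scale M (- k) ?I)"
  have g: "?g \<in> Hom M x x" by (rule M.Add_Hom[OF f M.Scale_Hom[OF I]])
  have "?g = Zero M x x"
  proof (rule ccontr)
    assume "?g \<noteq> Zero M x x"
    then have "is_iso M ?g" by (rule M.simple_endo_iso[OF X g])
    then obtain l where l: "l \<in> Hom M x x" "l \<cdot> ?g = ?I" using M.is_isoE[OF _ g] by metis
    \<comment> \<open>Testing \<open>p\<close> with \<open>h \<cdot> l\<close> amounts to testing
      \<open>q\<close> with \<open>h\<close>, since \<open>l\<close> inverts f - k.\<close>
    have "annihilates q x f"
      unfolding annihilates_def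
    proof
      fix h assume h: "h \<in> Hom M x x"
      have "(h \<cdot> l) \<cdot> ?g = h"
        using M.Comp_assoc[OF g l(1) h] l(2) M.Comp_Ident_right[OF h] by simp
      then show "(\<Sum>i\<le>degree q. coeff q i * \<Theta> x (h \<cdot> endo_power x f i)) = 0"
        using annihilates_linear_factor[OF f M.Comp_Hom[OF l(1) h] q0 p(2)[unfolded q]] by simp
    qed
    then have "degree p \<le> degree q" by (rule min[OF q0])
    moreover have "degree p = Suc (degree q)"
      unfolding q using q0 by (subst degree_mult_eq) auto
    ultimately show False by simp
  qed
  then have "Add M f (Scale M (-1) (Scale M k ?I)) = Zero M x x"
    using M.Scale_Scale[OF I, of "-1" k] by simp
  then have "f = Scale M k ?I"
    by (rule M.eq_if_diff_Zero[OF f M.Scale_Hom[OF I]])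
  then show ?thesis ..
qed

text \<open>Every endomorphism of \<open>x\<close> is a multiple of the identity, so a zero value
  there would make the trace vanish on all of them. The ratio of two traces at a simple object
  thereby makes sense.\<close>

lemma trace_Ident_nonzero:
  assumes X: "simple M x"
  shows "\<Theta> x (Ident M x) \<noteq> 0"
proof
  assume t: "\<Theta> x (Ident M x) = 0"
  have x: "x \<in> Obj M" using X by (simp add: simple_def)
  note I = M.Ident_Hom[OF x]
  have "\<Theta> x (g \<cdot> Ident M x) = 0" if g: "g \<in> Hom M x x" for g
    using simple_endo_scalar[OF X g] trace_Scale[OF x I] t M.Comp_Ident_right[OF g] by auto
  then have "Ident M x = Zero M x x" by (rule trace_nondegenerate_left[OF x x I])
  then show False using M.zero_objectI[OF x] X by (simp add: simple_def)
qed

text \<open>Insert the decomposed identity of \<open>s\<close> and move each projection around the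
  trace by symmetry.\<close>

lemma trace_direct_sum:
  assumes s: "is_direct_sum M n X s inc pr" and f: "f \<in> Hom M s s"
  shows "\<Theta> s f = (\<Sum>i<n. \<Theta> (X i) (pr i \<cdot> (f \<cdot> inc i)))"
proof -
  note D = M.is_direct_sumD[OF s]
  have "\<Theta> s f = (\<Sum>i<n. \<Theta> s (f \<cdot> (inc i \<cdot> pr i)))"
    using trace_finsum[OF D(1), of "{..<n}" "\<lambda>i. f \<cdot> (inc i \<cdot> pr i)"] M.direct_sum_source[OF s f]
      M.Comp_Hom[OF M.summand_Hom[OF s] f] by simp
  also have "\<dots> = (\<Sum>i<n. \<Theta> (X i) (pr i \<cdot> (f \<cdot> inc i)))"
  proof (rule sum.cong[OF refl])
    fix i assume "i \<in> {..<n}"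
    then have i: "i < n" by simp
    show "\<Theta> s (f \<cdot> (inc i \<cdot> pr i)) = \<Theta> (X i) (pr i \<cdot> (f \<cdot> inc i))"
      using trace_symmetric[OF D(1) D(3)[OF i] D(5)[OF i] M.Comp_Hom[OF D(4)[OF i] f]]
        M.Comp_assoc[OF D(5)[OF i] D(4)[OF i] f] by simp
  qed
  finally show ?thesis .
qed

end

section \<open>Partial traces\<close>

context monoidal_linear_category
begin

lemma transpose_arr_Hom:
  assumes f: "f \<in> Hom C x y" and O: "x' \<in> Obj C" "y' \<in> Obj C"
    and ev: "ev \<in> Hom C (y' \<otimes>\<^sub>o y) (Unit C)" and coev: "coev \<in> Hom C (Unit C) (x \<otimes>\<^sub>o x')"
  shows "transpose_arr C y' ev x' coev f \<in> Hom C y' x'"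
proof -
  note xy = Hom_Obj[OF f]
  have run: "inv_arr C (Run C y') \<in> Hom C y' (y' \<otimes>\<^sub>o Unit C)"
    by (rule inv_arr_Hom[OF Run_iso[OF O(2)] Run_Hom[OF O(2)]])
  have mid: "Ident C y' \<otimes>\<^sub>a ((f \<otimes>\<^sub>a Ident C x') \<cdot> coev) \<in> Hom C (y' \<otimes>\<^sub>o Unit C) (y' \<otimes>\<^sub>o (y \<otimes>\<^sub>o x'))"
    by (rule TensA_Hom[OF Ident_Hom[OF O(2)] Comp_Hom[OF coev TensA_Hom[OF f Ident_Hom[OF O(1)]]]])
  have assoc: "inv_arr C (Assoc C y' y x') \<in> Hom C (y' \<otimes>\<^sub>o (y \<otimes>\<^sub>o x')) ((y' \<otimes>\<^sub>o y) \<otimes>\<^sub>o x')"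
    by (rule inv_arr_Hom[OF Assoc_iso[OF O(2) xy(2) O(1)] Assoc_Hom[OF O(2) xy(2) O(1)]])
  have ev': "ev \<otimes>\<^sub>a Ident C x' \<in> Hom C ((y' \<otimes>\<^sub>o y) \<otimes>\<^sub>o x') (Unit C \<otimes>\<^sub>o x')"
    by (rule TensA_Hom[OF ev Ident_Hom[OF O(1)]])
  show ?thesis
    unfolding transpose_arr_def HomD(3)[OF f]
    by (rule Comp_Hom[OF Comp_Hom[OF Comp_Hom[OF Comp_Hom[OF run mid] assoc] ev'] Lun_Hom[OF O(1)]])
qed

end

context fusion_category
begin

lemma RDual_props:
  assumes "c \<in> Obj C"
  shows "RDual C c \<in> Obj C" "Ev C c \<in> Hom C (RDual C c \<otimes>\<^sub>o c) (Unit C)"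
    "Coev C c \<in> Hom C (Unit C) (c \<otimes>\<^sub>o RDual C c)"
  using right_dual[OF assms] by (simp_all add: is_right_dual_def)

lemma LDual_props:
  assumes "c \<in> Obj C"
  shows "LDual C c \<in> Obj C" "LEv C c \<in> Hom C (c \<otimes>\<^sub>o LDual C c) (Unit C)"
    "LCoev C c \<in> Hom C (Unit C) (LDual C c \<otimes>\<^sub>o c)"
  using left_dual[OF assms] by (simp_all add: is_right_dual_def)

lemma dual_arr_Hom:
  assumes f: "f \<in> Hom C x y"
  shows "dual_arr C f \<in> Hom C (RDual C y) (RDual C x)"
  unfolding dual_arr_def HomD(2,3)[OF f]
  using RDual_props[OF Hom_Obj(1)[OF f]] RDual_props[OF Hom_Obj(2)[OF f]]
  by (intro transpose_arr_Hom[OF f])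

lemma left_right_dual_Hom:
  assumes c: "c \<in> Obj C"
  shows "left_right_dual C c \<in> Hom C c (RDual C (LDual C c))"
  unfolding left_right_dual_def
  using LDual_props[OF c] RDual_props[OF LDual_props(1)[OF c]] c
  by (intro transpose_arr_Hom[OF Ident_Hom[OF LDual_props(1)[OF c]]])

end

text \<open>This typing fact allows a relation between two traces at \<open>m\<close> to be applied
  to partial traces.\<close>

lemma partial_trace_Hom:
  fixes M (structure)
  assumes "pivotal_fusion_category C" "module_category C M" and c: "c \<in> Obj C" and m: "m \<in> Obj M"
    and f: "f \<in> Hom M (c \<triangleright>\<^sub>o m) (c \<triangleright>\<^sub>o m)"
  shows "partial_trace C M c m f \<in> Hom M m m"
proof -
  interpret C: pivotal_fusion_category C by fact
  interpret module_category C M by fact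
  note L = C.LDual_props[OF c] and R = C.RDual_props[OF c]
  note I = M.Ident_Hom[OF m] and um = M.inv_arr_Hom[OF MUn_iso[OF m] MUn_Hom[OF m]]
  have piv: "dual_arr C (left_right_dual C c) \<cdot>\<^bsub>C\<^esub> Piv C (LDual C c) \<in> Hom C (LDual C c) (RDual C c)"
    by (rule C.Comp_Hom[OF C.Piv_Hom[OF L(1)] C.dual_arr_Hom[OF C.left_right_dual_Hom[OF c]]])
  have assoc: "inv_arr M (MAssoc M (RDual C c) c m) \<in> Hom M (RDual C c \<triangleright>\<^sub>o (c \<triangleright>\<^sub>o m)) ((RDual C c \<otimes>\<^sub>o\<^bsub>C\<^esub> c) \<triangleright>\<^sub>o m)"
    by (rule M.inv_arr_Hom[OF MAssoc_iso[OF R(1) c m] MAssoc_Hom[OF R(1) c m]])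
  show ?thesis
    unfolding partial_trace_def
    by (rule M.Comp_Hom[OF M.Comp_Hom[OF M.Comp_Hom[OF M.Comp_Hom[OF M.Comp_Hom[OF M.Comp_Hom[OF um
      ActA_Hom[OF L(3) I]] MAssoc_Hom[OF L(1) c m]] ActA_Hom[OF piv f]] assoc] ActA_Hom[OF R(2) I]]
      MUn_Hom[OF m]])
qed

section \<open>Comparison of two module traces\<close>

locale two_traces = traced_module_category C M \<Theta> + T': traced_module_category C M \<Theta>'
  for C :: "('c, 'f, 'p) pivotal_cat_scheme" and M :: "('c, 'f, 'o, 'a) mod_cat" (structure)
    and \<Theta> \<Theta>' +
  assumes pivotal: "pivotal_fusion_category C"
begin

text \<open>Zero objects lie in \<open>proportional z\<close> for every \<open>z\<close>, so these
  sets overlap, though only in zero objects.\<close>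

definition proportional :: "complex \<Rightarrow> 'o set" where
  "proportional z = {x \<in> Obj M. \<forall>f \<in> Hom M x x. \<Theta>' x f = z * \<Theta> x f}"

text \<open>Symmetry of both traces gives
  \<open>z * \<Theta> x (g \<cdot> f) = w * \<Theta> x (g \<cdot> f)\<close> for all
  \<open>g\<close>, so these traces vanish.\<close>

lemma proportional_orthogonal:
  assumes f: "f \<in> Hom M x y" and xy: "x \<in> proportional z" "y \<in> proportional w" "z \<noteq> w"
  shows "f = Zero M x y"
proof (rule trace_nondegenerate_left[OF M.Hom_Obj[OF f] f])
  fix g assume g: "g \<in> Hom M y x"
  note O = M.Hom_Obj[OF f]
  have "z * \<Theta> x (g \<cdot> f) = \<Theta>' x (g \<cdot> f)"
    using xy M.Comp_Hom[OF f g] by (simp add: proportional_def)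
  also have "\<dots> = w * \<Theta> y (f \<cdot> g)"
    using T'.trace_symmetric[OF O f g] xy M.Comp_Hom[OF g f] by (simp add: proportional_def)
  also have "\<dots> = w * \<Theta> x (g \<cdot> f)" using trace_symmetric[OF O f g] by simp
  finally show "\<Theta> x (g \<cdot> f) = 0" using xy(3) by simp
qed

text \<open>Both traces on \<open>c \<triangleright>\<^sub>o x\<close> are computed at
  \<open>x\<close> from the same partial trace, whose formula involves neither of them.\<close>

lemma proportional_Act:
  assumes c: "c \<in> Obj C" and x: "x \<in> proportional z"
  shows "c \<triangleright>\<^sub>o x \<in> proportional z"
proof -
  have xO: "x \<in> Obj M" using x by (simp add: proportional_def)
  have "\<Theta>' (c \<triangleright>\<^sub>o x) f = z * \<Theta> (c \<triangleright>\<^sub>o x) f" if f: "f \<in> Hom M (c \<triangleright>\<^sub>o x) (c \<triangleright>\<^sub>o x)" for f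
    using partial_trace_Hom[OF pivotal module_category_axioms c xO f] x
    by (simp add: trace_compatible[OF c xO f] T'.trace_compatible[OF c xO f] proportional_def)
  then show ?thesis using Act_Obj[OF c xO] by (simp add: proportional_def)
qed

lemma proportional_direct_sum:
  assumes s: "is_direct_sum M n X s inc pr" and X: "\<And>i. i < n \<Longrightarrow> X i \<in> proportional z"
  shows "s \<in> proportional z"
proof -
  note D = M.is_direct_sumD[OF s]
  have "\<Theta>' s f = z * \<Theta> s f" if f: "f \<in> Hom M s s" for f
  proof -
    have "pr i \<cdot> (f \<cdot> inc i) \<in> Hom M (X i) (X i)" if "i < n" for i
      using M.Comp_Hom[OF M.Comp_Hom[OF D(4)[OF that] f] D(5)[OF that]] .
    then show ?thesis
      using X unfolding trace_direct_sum[OF s f] T'.trace_direct_sum[OF s f] sum_distrib_left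
      by (intro sum.cong) (auto simp: proportional_def)
  qed
  then show ?thesis using D(1) by (simp add: proportional_def)
qed

lemma simple_proportional:
  assumes X: "simple M x"
  shows "x \<in> proportional (\<Theta>' x (Ident M x) / \<Theta> x (Ident M x))"
proof -
  have x: "x \<in> Obj M" using X by (simp add: simple_def)
  note I = M.Ident_Hom[OF x]
  have "\<Theta>' x f = \<Theta>' x (Ident M x) / \<Theta> x (Ident M x) * \<Theta> x f" if f: "f \<in> Hom M x x" for f
  proof -
    obtain k where "f = Scale M k (Ident M x)" using simple_endo_scalar[OF X f] by blast
    then show ?thesis
      using trace_Scale[OF x I] T'.trace_Scale[OF x I] trace_Ident_nonzero[OF X] by simp
  qed
  then show ?thesis using x by (simp add: proportional_def)
qed

text \<open>
  The two blocks of the decomposition that would exist if some simple object were not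
  \<open>z\<close>-proportional.
\<close>

definition block :: "complex \<Rightarrow> bool \<Rightarrow> 'o set" where
  "block z \<beta> = (\<Union>w \<in> {w. (w = z) = \<beta>}. proportional w)"

text \<open>Formulated with arrows into \<open>x\<close> alone; the other direction follows by
  \<open>Hom_vanish_sym\<close>. Thus \<open>perp z True\<close> is orthogonal to all ratios other
  than \<open>z\<close>, and \<open>perp z False\<close> to \<open>z\<close> itself.\<close>

definition perp :: "complex \<Rightarrow> bool \<Rightarrow> 'o set" where
  "perp z \<beta> = {x \<in> Obj M. \<forall>y \<in> block z (\<not> \<beta>). \<forall>f \<in> Hom M y x. f = Zero M y x}"

section \<open>Blocks and their orthogonal complements\<close>

lemma block_orthogonal:
  "\<lbrakk>f \<in> Hom M x y; x \<in> block z \<beta>; y \<in> block z (\<not> \<beta>)\<rbrakk> \<Longrightarrow> f = Zero M x y"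
  using proportional_orthogonal[of f x y] by (auto simp: block_def)

lemma block_subset_perp: "block z \<beta> \<subseteq> perp z \<beta>"
proof
  fix x assume x: "x \<in> block z \<beta>"
  then have "x \<in> Obj M" by (auto simp: block_def proportional_def)
  moreover have "f = Zero M y x" if "y \<in> block z (\<not> \<beta>)" "f \<in> Hom M y x" for y f
    using block_orthogonal[of f y x z "\<not> \<beta>"] that x by simp
  ultimately show "x \<in> perp z \<beta>" by (simp add: perp_def)
qed

lemma perp_left:
  "\<lbrakk>x \<in> perp z \<beta>; y \<in> block z (\<not> \<beta>); f \<in> Hom M y x\<rbrakk> \<Longrightarrow> f = Zero M y x"
  by (simp add: perp_def)

lemma perp_right:
  "\<lbrakk>x \<in> perp z \<beta>; y \<in> block z (\<not> \<beta>); f \<in> Hom M x y\<rbrakk> \<Longrightarrow> f = Zero M x y"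
  using Hom_vanish_sym[of y x f] perp_left by blast

lemma perpI:
  assumes x: "x \<in> Obj M" and "\<And>y f. \<lbrakk>y \<in> block z (\<not> \<beta>); f \<in> Hom M x y\<rbrakk> \<Longrightarrow> f = Zero M x y"
  shows "x \<in> perp z \<beta>"
  using x Hom_vanish_sym[of x] assms(2) unfolding perp_def by blast

text \<open>Subobjects inherit the absence of arrows into them, quotients the absence of arrows out
  of them; non-degeneracy makes the two conditions equivalent. Arrows into a direct sum are tested
  on the projections.\<close>

lemma closed_subset_perp: "closed_subset M (perp z \<beta>)"
proof unfold_locales
  show "perp z \<beta> \<subseteq> Obj M" by (auto simp: perp_def)
next
  fix k x y assume mono: "monic M k" and k: "k \<in> Hom M x y" and y: "y \<in> perp z \<beta>"
  have "f = Zero M w x" if "w \<in> block z (\<not> \<beta>)" and f: "f \<in> Hom M w x" for w f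
    using M.monic_Zero[OF mono k f] perp_left[OF y that(1) M.Comp_Hom[OF f k]] by simp
  then show "x \<in> perp z \<beta>" using M.Hom_Obj[OF k] by (simp add: perp_def)
next
  fix q x y assume epi: "epic M q" and q: "q \<in> Hom M x y" and x: "x \<in> perp z \<beta>"
  show "y \<in> perp z \<beta>"
  proof (rule perpI[OF M.Hom_Obj(2)[OF q]])
    fix w f assume "w \<in> block z (\<not> \<beta>)" and f: "f \<in> Hom M y w"
    then show "f = Zero M y w"
      using M.epic_Zero[OF epi q f] perp_right[OF x _ M.Comp_Hom[OF q f]] by simp
  qed
next
  fix n X s inc pr assume s: "is_direct_sum M n X s inc pr" and X: "\<And>i. i < n \<Longrightarrow> X i \<in> perp z \<beta>"
  note D = M.is_direct_sumD[OF s]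
  have "f = Zero M y s" if y: "y \<in> block z (\<not> \<beta>)" and f: "f \<in> Hom M y s" for y f
    using M.direct_sum_target_Zero[OF s f] perp_left[OF X y M.Comp_Hom[OF f D(5)]] by blast
  then show "s \<in> perp z \<beta>" using D(1) by (simp add: perp_def)
qed

lemma simple_block: "simple M x \<Longrightarrow> \<exists>\<beta>. x \<in> block z \<beta>"
  using simple_proportional[of x] by (auto simp: block_def)

lemma block_Act: "\<lbrakk>c \<in> Obj C; x \<in> block z \<beta>\<rbrakk> \<Longrightarrow> c \<triangleright>\<^sub>o x \<in> block z \<beta>"
  using proportional_Act by (auto simp: block_def)

text \<open>The inclusion of a simple summand from the opposite block would be one of the forbidden
  arrows, hence zero, and then the summand would be zero.\<close>

lemma perp_summand_block:
  assumes s: "is_direct_sum M n X s inc pr" and "s \<in> perp z \<beta>" "i < n" and simple: "simple M (X i)"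
  shows "X i \<in> block z \<beta>"
proof -
  note D = M.is_direct_sumD[OF s]
  obtain \<gamma> where \<gamma>: "X i \<in> block z \<gamma>" using simple_block[OF simple] by blast
  have "\<gamma> = \<beta>"
  proof (rule ccontr)
    assume "\<gamma> \<noteq> \<beta>"
    then have "X i \<in> block z (\<not> \<beta>)" using \<gamma> by (cases \<beta>; cases \<gamma>) auto
    then have "inc i = Zero M (X i) s" using perp_left assms(2) D(4)[OF assms(3)] by blast
    then have "Ident M (X i) = Zero M (X i) (X i)"
      using D(6)[OF assms(3)] M.Comp_Zero_right[OF D(5)[OF assms(3)] D(3)[OF assms(3)]] by simp
    then show False using M.zero_objectI[OF D(3)[OF assms(3)]] simple by (simp add: simple_def)
  qed
  then show ?thesis using \<gamma> by simp
qed

text \<open>Instead of moving \<open>c\<close> to the other side by duality, decompose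
  \<open>x\<close>: its simple summands lie in the block, which is stable under the action, and
  complements are closed under direct sums.\<close>

lemma perp_Act:
  assumes c: "c \<in> Obj C" and x: "x \<in> perp z \<beta>"
  shows "c \<triangleright>\<^sub>o x \<in> perp z \<beta>"
proof -
  have "x \<in> Obj M" using x by (simp add: perp_def)
  then obtain n X inc pr where X: "\<forall>i<n. simple M (X i)" and s: "is_direct_sum M n X x inc pr"
    using M.semisimple by blast
  show ?thesis
  proof (rule closed_subset.direct_sum_closed[OF closed_subset_perp direct_sum_Act[OF c s]])
    fix i assume "i < n"
    then show "c \<triangleright>\<^sub>o X i \<in> perp z \<beta>"
      using block_Act[OF c perp_summand_block[OF s x]] X block_subset_perp by blast
  qed
qed

text \<open>The simple summands of \<open>x\<close> lie in block \<open>\<beta>\<close>, and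
  \<open>y\<close> receives no nonzero arrow from there.\<close>

lemma perp_orthogonal:
  assumes f: "f \<in> Hom M x y" and x: "x \<in> perp z \<beta>" and y: "y \<in> perp z (\<not> \<beta>)"
  shows "f = Zero M x y"
proof -
  obtain n X inc pr where X: "\<forall>i<n. simple M (X i)" and s: "is_direct_sum M n X x inc pr"
    using M.semisimple[OF M.Hom_Obj(1)[OF f]] by blast
  show ?thesis
  proof (rule M.direct_sum_source_Zero[OF s f])
    fix i assume i: "i < n"
    show "f \<cdot> inc i = Zero M (X i) y"
      using perp_left[OF y _ M.Comp_Hom[OF M.is_direct_sumD(4)[OF s i] f]]
        perp_summand_block[OF s x i] X i by simp
  qed
qed

lemma orthogonal_pair_perp: "orthogonal_pair C M (perp z)"
  by (rule orthogonal_pair.intro[OF module_category_axioms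
        orthogonal_pair_axioms.intro[OF closed_subset_perp perp_Act perp_orthogonal]])

text \<open>The partial sum projects onto summands from block \<open>\<beta>\<close>, where every
  component of an arrow from the opposite block vanishes.\<close>

lemma partial_identity_Zero:
  assumes s: "is_direct_sum M n X x inc pr" and J: "J \<subseteq> {..<n}" "\<And>i. i \<in> J \<Longrightarrow> X i \<in> block z \<beta>"
    and f: "f \<in> Hom M y x" and y: "y \<in> block z (\<not> \<beta>)"
  shows "finsum (hom_space M x x) (\<lambda>i. inc i \<cdot> pr i) J \<cdot> f = Zero M y x"
proof -
  note D = M.is_direct_sumD[OF s] and O = M.Hom_Obj[OF f]
  have fin: "finite J" using J(1) finite_subset by blast
  have ip: "inc i \<cdot> pr i \<in> Hom M x x" if "i \<in> J" for i using M.summand_Hom[OF s] J(1) that by blast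
  have "finsum (hom_space M x x) (\<lambda>i. inc i \<cdot> pr i) J \<cdot> f =
      finsum (hom_space M y x) (\<lambda>i. (inc i \<cdot> pr i) \<cdot> f) J"
    by (rule M.Comp_finsum_left[OF f O(2) fin ip])
  also have "\<dots> = Zero M y x"
  proof (rule M.finsum_Zero[OF O fin])
    fix i assume iJ: "i \<in> J"
    then have i: "i < n" using J(1) by blast
    have "pr i \<cdot> f = Zero M y (X i)"
      using block_orthogonal[OF M.Comp_Hom[OF f D(5)[OF i]] y] J(2)[OF iJ] by simp
    then show "(inc i \<cdot> pr i) \<cdot> f = Zero M y x"
      using M.Comp_assoc[OF f D(5)[OF i] D(4)[OF i]] M.Comp_Zero_right[OF D(4)[OF i] O(1)] by simp
  qed
  finally show ?thesis .
qed

text \<open>The simple summands in one block add up to an idempotent \<open>e \<beta>\<close> of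
  \<open>x\<close>. Cutting out its image as a kernel avoids renumbering a subfamily of the direct
  sum as an initial segment of the naturals.\<close>

lemma perp_splitting:
  assumes x: "x \<in> Obj M"
  shows "\<exists>A u v. orthogonal_pair.splits M (perp z) x A u v"
proof -
  interpret P: orthogonal_pair C M "perp z" by (rule orthogonal_pair_perp)
  obtain n X inc pr where X: "\<forall>i<n. simple M (X i)" and s: "is_direct_sum M n X x inc pr"
    using M.semisimple[OF x] by blast
  note D = M.is_direct_sumD[OF s]
  \<comment> \<open>Membership in \<open>block z True\<close> alone decides, so the index sets
    partition \<open>{..<n}\<close>; a simple summand outside that block lies in the other
    one.\<close>
  define J where "J \<beta> = {i \<in> {..<n}. (X i \<in> block z True) = \<beta>}" for \<beta>
  have J: "J \<beta> \<subseteq> {..<n}" "finite (J \<beta>)" for \<beta> by (auto simp: J_def)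
  have XJ: "X i \<in> block z \<beta>" if "i \<in> J \<beta>" for i \<beta>
  proof -
    have "simple M (X i)" using X that by (simp add: J_def)
    then obtain \<gamma> where "X i \<in> block z \<gamma>" using simple_block by blast
    then show ?thesis using that by (cases \<gamma>; cases \<beta>) (auto simp: J_def)
  qed
  have ip: "inc i \<cdot> pr i \<in> Hom M x x" if "i \<in> J \<beta>" for i \<beta>
    using M.summand_Hom[OF s] J(1) that by blast
  define e where "e \<beta> = finsum (hom_space M x x) (\<lambda>i. inc i \<cdot> pr i) (J \<beta>)" for \<beta>
  have e: "e \<beta> \<in> Hom M x x" for \<beta>
    unfolding e_def by (rule M.finsum_Hom[OF x x ip])
  have U: "{..<n} = J True \<union> J False" "J True \<inter> J False = {}" by (auto simp: J_def)
  have "finsum (hom_space M x x) (\<lambda>i. inc i \<cdot> pr i) (J True \<union> J False) = Add M (e True) (e False)"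
    using abelian_monoid.finsum_Un_disjoint[OF abelian_group.axioms(1)[OF M.hom_abelian_group[OF x x]]
      J(2) J(2) U(2), of "\<lambda>i. inc i \<cdot> pr i"] ip unfolding e_def by auto
  then have sumTF: "Add M (e True) (e False) = Ident M x" using D(2) U(1) by simp
  have sum: "Add M (e \<beta>) (e (\<not> \<beta>)) = Ident M x" for \<beta>
    using sumTF M.Add_commute[OF e e, of True False] by (cases \<beta>) auto
  \<comment> \<open>Checked on the inclusions: the \<open>e\<close> of the block containing
    \<open>X i\<close> fixes \<open>inc i\<close>, and the other one kills it.\<close>
  have ee: "e (\<not> \<beta>) \<cdot> e \<beta> = Zero M x x" for \<beta>
  proof (rule M.direct_sum_source_Zero[OF s M.Comp_Hom[OF e e]])
    fix i assume i: "i < n"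
    obtain \<gamma> where \<gamma>: "i \<in> J \<gamma>" using i by (auto simp: J_def)
    note inc = D(4)[OF i]
    have kill: "e (\<not> \<gamma>) \<cdot> inc i = Zero M (X i) x"
      unfolding e_def using partial_identity_Zero[OF s J(1) XJ inc] XJ[OF \<gamma>] by simp
    have keep: "e \<gamma> \<cdot> inc i = inc i"
      using M.Comp_Add_left[OF inc e e, of \<gamma> "\<not> \<gamma>"] kill sum M.Comp_Ident_left[OF inc]
        M.Add_Zero_right[OF M.Comp_Hom[OF inc e]] by simp
    show "(e (\<not> \<beta>) \<cdot> e \<beta>) \<cdot> inc i = Zero M (X i) x"
    proof (cases "\<gamma> = \<beta>")
      case True
      then show ?thesis using M.Comp_assoc[OF inc e e] kill keep by simp
    next
      case False
      then have "\<gamma> = (\<not> \<beta>)" by auto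
      then show ?thesis
        using M.Comp_assoc[OF inc e e] kill M.Comp_Zero_right[OF e D(3)[OF i]] by simp
    qed
  qed
  \<comment> \<open>The two idempotents are orthogonal and add up to the identity, so the image of
    one is the kernel of the other.\<close>
  have "\<exists>k. is_kernel M k (e (\<not> \<beta>))" for \<beta> using M.kernels HomD(1)[OF e] by blast
  then obtain u where u: "\<And>\<beta>. is_kernel M (u \<beta>) (e (\<not> \<beta>))" by metis
  define A where "A \<beta> = Dom M (u \<beta>)" for \<beta>
  have uH: "u \<beta> \<in> Hom M (A \<beta>) x" and eu: "e (\<not> \<beta>) \<cdot> u \<beta> = Zero M (A \<beta>) x" for \<beta>
    using M.is_kernelD(1,2)[OF u e] by (simp_all add: A_def)
  have mono: "monic M (u \<beta>)" for \<beta> by (rule M.kernel_monic[OF u])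
  \<comment> \<open>As \<open>e (\<not> \<beta>)\<close> kills \<open>e \<beta>\<close>, the latter
    factors through the kernel, and the factor serves as projection.\<close>
  have "\<exists>w \<in> Hom M x (A \<beta>). u \<beta> \<cdot> w = e \<beta>" for \<beta>
    using M.is_kernelD(3)[OF u e e ee] by (simp add: A_def)
  then obtain v where v: "\<And>\<beta>. v \<beta> \<in> Hom M x (A \<beta>)" "\<And>\<beta>. u \<beta> \<cdot> v \<beta> = e \<beta>" by metis
  have fix_u: "e \<beta> \<cdot> u \<beta> = u \<beta>" for \<beta>
    using M.Comp_Add_left[OF uH[of \<beta>] e[of \<beta>] e[of "\<not> \<beta>"]] eu sum M.Comp_Ident_left[OF uH]
      M.Add_Zero_right[OF M.Comp_Hom[OF uH e]] by simp
  have vu: "v \<beta> \<cdot> u \<beta> = Ident M (A \<beta>)" for \<beta>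
  proof (rule M.monic_cancel[OF mono uH M.Comp_Hom[OF uH v(1)] M.Ident_Hom[OF M.Hom_Obj(1)[OF uH]]])
    show "u \<beta> \<cdot> (v \<beta> \<cdot> u \<beta>) = u \<beta> \<cdot> Ident M (A \<beta>)"
      using M.Comp_assoc[OF uH v(1) uH] v(2) fix_u M.Comp_Ident_right[OF uH] by simp
  qed
  \<comment> \<open>After inclusion into \<open>x\<close>, an arrow from the opposite block into
    \<open>A \<beta>\<close> is both fixed and killed by \<open>e \<beta>\<close>.\<close>
  have "A \<beta> \<in> perp z \<beta>" for \<beta>
  proof -
    have "g = Zero M y (A \<beta>)" if y: "y \<in> block z (\<not> \<beta>)" and g: "g \<in> Hom M y (A \<beta>)" for y g
    proof (rule M.monic_Zero[OF mono uH g])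
      have "u \<beta> \<cdot> g = e \<beta> \<cdot> (u \<beta> \<cdot> g)"
        using M.Comp_assoc[OF g uH e, of \<beta>] fix_u by simp
      also have "\<dots> = Zero M y x"
        unfolding e_def by (rule partial_identity_Zero[OF s J(1) XJ M.Comp_Hom[OF g uH] y])
      finally show "u \<beta> \<cdot> g = Zero M y x" .
    qed
    then show ?thesis using M.Hom_Obj(1)[OF uH] by (simp add: perp_def)
  qed
  then have "P.splits x A u v"
    unfolding P.splits_def using x uH v vu sumTF by simp
  then show ?thesis by blast
qed

text \<open>If \<open>y\<close> had another ratio than \<open>x\<close>, the two would lie in
  different complements; both full subcategories would be nonzero, and their sum would decompose
  \<open>M\<close>.\<close>

lemma all_simple_proportional:
  assumes indec: "indecomposable_module_category C M"
    and x: "simple M x" "x \<in> proportional z" and y: "simple M y"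
  shows "y \<in> proportional z"
proof (rule ccontr)
  assume "y \<notin> proportional z"
  then have "x \<in> block z True" "y \<in> block z False"
    using x(2) simple_proportional[OF y] by (auto simp: block_def)
  then have xy: "x \<in> perp z True" "y \<in> perp z False" using block_subset_perp by blast+
  have nonzero: "nonzero_category (full_sub M (perp z \<beta>))" if "w \<in> perp z \<beta>" "simple M w" for w \<beta>
    unfolding nonzero_category_def
    using that closed_subset.zero_object_full_sub[OF closed_subset_perp, of z \<beta> w]
    by (auto simp: simple_def)
  have mc: "module_category C (full_sub M (perp z \<beta>))" for \<beta>
    by (rule module_category_full_sub[OF module_category_axioms closed_subset_perp perp_Act])
  have "module_equivalent C M (mod_cat_sum (full_sub M (perp z True)) (full_sub M (perp z False)))"
    by (rule orthogonal_pair.decomposition[OF orthogonal_pair_perp perp_splitting])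
  then show False
    using indec mc nonzero[OF xy(1) x(1)] nonzero[OF xy(2) y]
    unfolding indecomposable_module_category_def by blast
qed

end

theorem proposition4p4:
  fixes C :: "('c, 'f) pivotal_cat"
    and M :: "('c, 'f, 'o, 'a) mod_cat"
    and \<Theta> \<Theta>' :: "'o \<Rightarrow> 'a \<Rightarrow> complex"
  assumes "pivotal_fusion_category C"
    and "indecomposable_module_category C M"
    and "module_trace C M \<Theta>"
    and "module_trace C M \<Theta>'"
  shows "\<exists>z. z \<noteq> 0 \<and> (\<forall>m \<in> Obj M. \<forall>f \<in> Hom M m m. \<Theta>' m f = z * \<Theta> m f)"
proof -
  have mc: "module_category C M" and nz: "nonzero_category M"
    using assms(2) by (simp_all add: indecomposable_module_category_def)
  interpret two_traces C M \<Theta> \<Theta>'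
    using mc assms by (intro two_traces.intro traced_module_category.intro two_traces_axioms.intro)
  obtain m where m: "m \<in> Obj M" "\<not> zero_object M m"
    using nz by (auto simp: nonzero_category_def)
  obtain n X inc pr where X: "\<forall>i<n. simple M (X i)" and s: "is_direct_sum M n X m inc pr"
    using M.semisimple[OF m(1)] by blast
  \<comment> \<open>An empty direct sum is a zero object, so the nonzero object \<open>m\<close> has
    a simple summand.\<close>
  have "n \<noteq> 0"
  proof
    assume "n = 0"
    then have "Ident M m = Zero M m m"
      using M.is_direct_sumD(2)[OF s] by (simp add: M.finsum_empty[OF m(1) m(1)])
    then show False using M.zero_objectI[OF m(1)] m(2) by simp
  qed
  then have x: "simple M (X 0)" using X by simp
  \<comment> \<open>The ratio at one arbitrary simple object; indecomposability makes it the ratio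
    at all of them.\<close>
  define z where "z = \<Theta>' (X 0) (Ident M (X 0)) / \<Theta> (X 0) (Ident M (X 0))"
  have "z \<noteq> 0"
    using trace_Ident_nonzero[OF x] T'.trace_Ident_nonzero[OF x] by (simp add: z_def)
  moreover have xz: "X 0 \<in> proportional z"
    unfolding z_def by (rule simple_proportional[OF x])
  have "m \<in> proportional z" if m: "m \<in> Obj M" for m
  proof -
    obtain n X' inc pr where "\<forall>i<n. simple M (X' i)" and s: "is_direct_sum M n X' m inc pr"
      using M.semisimple[OF m] by blast
    then show ?thesis
      using proportional_direct_sum[OF s] all_simple_proportional[OF assms(2) x xz] by blast
  qed
  ultimately show ?thesis
    by (intro exI[of _ z]) (auto simp: proportional_def)
qed

end
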